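(* Let $r_3\colon\mathrm{Aut}(P_3)\to\mathrm{Aut}(Z_3/\mathrm{Bd}_3)\cong\mathrm{Aut}(\pi_3(S^2))$ be the homomorphism sending an automorphism of $P_3$ to the automorphism it induces on $Z_3/\mathrm{Bd}_3$. Then $r_3$ is non-trivial, and $\mathrm{Im}(r_3)=\{\mathrm{id},-\mathrm{id}\}$.
   Context: $B_n$ is the Artin braid group on $n$ strands with standard generators $\sigma_1,\dots,\sigma_{n-1}$, and $P_n$ is the pure braid group, the kernel of the homomorphism $B_n\to\Sigma_n$, $\sigma_i\mapsto (i\ i{+}1)$. $P_n$ is generated by $A_{i,j}=\sigma_{j-1}\sigma_{j-2}\cdots\sigma_{i+1}\sigma_i^2\sigma_{i+1}^{-1}\cdots\sigma_{j-2}^{-1}\sigma_{j-1}^{-1}$ for $1\le i<j\le n$. Put $A_{j,i}=A_{i,j}$, $A_{i,i}=1$, and $A_{0,j}=(A_{1,j}A_{2,j}\cdots A_{n,j})^{-1}\in P_n$ for $1\le j\le n$. For $1\le k\le n$, $d_k\colon P_n\to P_{n-1}$ is the homomorphism removing the $k$th strand: $d_k(A_{i,j})=1$ if $k\in\{i,j\}$, and otherwise $d_k(A_{i,j})=A_{i',j'}$ where each index larger than $k$ is decreased by $1$. The automorphism $\theta_n$ of $P_n$ is given by $\theta_n(A_{i,j})=A_{i,j}$ for $2\le i<j\le n$ and $\theta_n(A_{1,j})=A_{1,j}^{-1}A_{0,j}A_{1,j}$ for $2\le j\le n$ (it is known that this is a well-defined automorphism). Put $\partial_n=d_1\circ\theta_n\colon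 P_n\to P_{n-1}$. $\mathrm{Brun}_n=\bigcap_{k=1}^n\ker(d_k)$, $Z_n=\mathrm{Brun}_n\cap\ker(\partial_n)$, and $\mathrm{Bd}_n=\partial_{n+1}(\mathrm{Brun}_{n+1})$. It is known that $\mathrm{Bd}_n$ is normal in $Z_n$ and $Z_n/\mathrm{Bd}_n\cong\pi_n(S^2)$ for $n\ge2$; in particular $Z_3/\mathrm{Bd}_3\cong\pi_3(S^2)\cong\mathbb{Z}$. Both $Z_n$ and $\mathrm{Bd}_n$ are characteristic subgroups of $P_n$, so every automorphism of $P_n$ induces an automorphism of $Z_n/\mathrm{Bd}_n$, and $r_3$ is well defined. *)

theory Defs
  imports "HOL-Algebra.Algebra"
begin

section \<open>Artin braid groups\<close>

text \<open>A letter (i, True) stands for the generator \<open>\<sigma>\<^sub>i\<close>, and (i, False) for its inverse.\<close>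

type_synonym braid_word = "(nat \<times> bool) list"

definition braid_words :: "nat \<Rightarrow> braid_word set" where
  "braid_words n = lists ({1..<n} \<times> UNIV)"

inductive braid_eq :: "nat \<Rightarrow> braid_word \<Rightarrow> braid_word \<Rightarrow> bool" for n :: nat where
  refl: "w \<in> braid_words n \<Longrightarrow> braid_eq n w w"
| sym: "braid_eq n u v \<Longrightarrow> braid_eq n v u"
| trans: "braid_eq n u v \<Longrightarrow> braid_eq n v w \<Longrightarrow> braid_eq n u w"
| append: "braid_eq n u u' \<Longrightarrow> braid_eq n v v' \<Longrightarrow> braid_eq n (u @ v) (u' @ v')"
| cancel: "1 \<le> i \<Longrightarrow> i < n \<Longrightarrow> braid_eq n [(i, b), (i, \<not> b)] []"
| far: "1 \<le> i \<Longrightarrow> i + 2 \<le> j \<Longrightarrow> j < n \<Longrightarrow>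
    braid_eq n [(i, True), (j, True)] [(j, True), (i, True)]"
| braid: "1 \<le> i \<Longrightarrow> i + 1 < n \<Longrightarrow>
    braid_eq n [(i, True), (i + 1, True), (i, True)] [(i + 1, True), (i, True), (i + 1, True)]"

definition braid_rel :: "nat \<Rightarrow> (braid_word \<times> braid_word) set" where
  "braid_rel n = {(u, v). braid_eq n u v}"

definition braid_class :: "nat \<Rightarrow> braid_word \<Rightarrow> braid_word set" where
  "braid_class n w = braid_rel n `` {w}"

definition braid_group :: "nat \<Rightarrow> braid_word set monoid" where
  "braid_group n =
    \<lparr>carrier = braid_words n // braid_rel n,
     monoid.mult = (\<lambda>x y. \<Union>u\<in>x. \<Union>v\<in>y. braid_class n (u @ v)),
     one = braid_class n []\<rparr>"


section \<open>Pure braid groups\<close>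

definition word_perm :: "braid_word \<Rightarrow> nat \<Rightarrow> nat" where
  "word_perm w = foldr (\<lambda>(i, b) p. Transposition.transpose i (i + 1) \<circ> p) w id"

text \<open>Equivalent words have the same permutation, so the choice of representative is irrelevant
  (lemma \<open>braid_perm_class\<close> below).\<close>

definition braid_perm :: "nat \<Rightarrow> braid_word set \<Rightarrow> nat \<Rightarrow> nat" where
  "braid_perm n x = word_perm (SOME w. w \<in> x)"

definition pure_braid_group :: "nat \<Rightarrow> braid_word set monoid" where
  "pure_braid_group n =
    (braid_group n)\<lparr>carrier := kernel (braid_group n) (sym_group n) (braid_perm n)\<rparr>"

definition A_word :: "nat \<Rightarrow> nat \<Rightarrow> braid_word" where
  "A_word i j =
    map (\<lambda>m. (m, True)) (rev [i + 1..<j]) @ [(i, True), (i, True)] @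
    map (\<lambda>m. (m, False)) [i + 1..<j]"

definition A_elem :: "nat \<Rightarrow> nat \<Rightarrow> nat \<Rightarrow> braid_word set" where
  "A_elem n i j =
    (if i < j then braid_class n (A_word i j)
     else if j < i then braid_class n (A_word j i)
     else \<one>\<^bsub>pure_braid_group n\<^esub>)"

definition A0_elem :: "nat \<Rightarrow> nat \<Rightarrow> braid_word set" where
  "A0_elem n j =
    inv\<^bsub>pure_braid_group n\<^esub>
      (foldr (\<lambda>i x. A_elem n i j \<otimes>\<^bsub>pure_braid_group n\<^esub> x) [1..<n + 1] \<one>\<^bsub>pure_braid_group n\<^esub>)"


section \<open>Strand removal and the automorphism theta\<close>

text \<open>Homomorphisms are given by their values on the generators \<open>A\<^sub>i\<^sub>,\<^sub>j\<close>; they are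
  taken to be extensional so that the description determines the HOL function uniquely.\<close>

definition strand_removal :: "nat \<Rightarrow> nat \<Rightarrow> braid_word set \<Rightarrow> braid_word set" where
  "strand_removal n k = (THE f.
     f \<in> hom (pure_braid_group n) (pure_braid_group (n - 1)) \<and>
     f \<in> extensional (carrier (pure_braid_group n)) \<and>
     (\<forall>i j. 1 \<le> i \<and> i < j \<and> j \<le> n \<longrightarrow>
        f (A_elem n i j) =
          (if k \<in> {i, j} then \<one>\<^bsub>pure_braid_group (n - 1)\<^esub>
           else A_elem (n - 1) (if k < i then i - 1 else i) (if k < j then j - 1 else j))))"

text \<open>Membership in \<^const>\<open>auto\<close> includes extensionality.\<close>

definition theta :: "nat \<Rightarrow> braid_word set \<Rightarrow> braid_word set" where
  "theta n = (THE f.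
     f \<in> auto (pure_braid_group n) \<and>
     (\<forall>i j. 2 \<le> i \<and> i < j \<and> j \<le> n \<longrightarrow> f (A_elem n i j) = A_elem n i j) \<and>
     (\<forall>j. 2 \<le> j \<and> j \<le> n \<longrightarrow>
        f (A_elem n 1 j) =
          inv\<^bsub>pure_braid_group n\<^esub> (A_elem n 1 j) \<otimes>\<^bsub>pure_braid_group n\<^esub> A0_elem n j
            \<otimes>\<^bsub>pure_braid_group n\<^esub> A_elem n 1 j))"

definition bdry :: "nat \<Rightarrow> braid_word set \<Rightarrow> braid_word set" where
  "bdry n = compose (carrier (pure_braid_group n)) (strand_removal n 1) (theta n)"


section \<open>Brunnian braids, cycles and boundaries\<close>

definition Brun :: "nat \<Rightarrow> braid_word set set" where
  "Brun n =
    (\<Inter>k\<in>{1..n}. kernel (pure_braid_group n) (pure_braid_group (n - 1)) (strand_removal n k))"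

definition Zn :: "nat \<Rightarrow> braid_word set set" where
  "Zn n = Brun n \<inter> kernel (pure_braid_group n) (pure_braid_group (n - 1)) (bdry n)"

definition Bd :: "nat \<Rightarrow> braid_word set set" where
  "Bd n = bdry (n + 1) ` Brun (n + 1)"

definition ZBd :: "nat \<Rightarrow> braid_word set set monoid" where
  "ZBd n = (pure_braid_group n)\<lparr>carrier := Zn n\<rparr> Mod Bd n"

text \<open>An automorphism \<open>\<phi>\<close> preserving \<^term>\<open>Zn n\<close> and \<^term>\<open>Bd n\<close> sends the coset of z
  to the coset of \<open>\<phi> z\<close>; as a set, the latter is the image of the former under \<open>\<phi>\<close>.\<close>

definition induced_aut ::
  "nat \<Rightarrow> (braid_word set \<Rightarrow> braid_word set) \<Rightarrow> braid_word set set \<Rightarrow> braid_word set set" where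
  "induced_aut n \<phi> = (\<lambda>C\<in>carrier (ZBd n). \<phi> ` C)"


section \<open>Basic facts\<close>

lemma braid_words_simps [simp]:
  "[] \<in> braid_words n"
  "(p # w) \<in> braid_words n \<longleftrightarrow> 1 \<le> fst p \<and> fst p < n \<and> w \<in> braid_words n"
  "u @ v \<in> braid_words n \<longleftrightarrow> u \<in> braid_words n \<and> v \<in> braid_words n"
  by (cases p; auto simp: braid_words_def)+

lemma braid_eq_words: "braid_eq n u v \<Longrightarrow> u \<in> braid_words n \<and> v \<in> braid_words n"
  by (induction rule: braid_eq.induct) auto

lemma equiv_braid_rel: "equiv (braid_words n) (braid_rel n)"
proof (rule equivI)
  show "braid_rel n \<subseteq> braid_words n \<times> braid_words n"
    by (auto simp: braid_rel_def dest: braid_eq_words)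
  show "refl_on (braid_words n) (braid_rel n)"
    by (simp add: braid_rel_def refl_on_def braid_eq.refl)
  show "sym (braid_rel n)"
    unfolding braid_rel_def sym_def using braid_eq.sym by blast
  show "trans (braid_rel n)"
    unfolding braid_rel_def trans_def using braid_eq.trans by blast
qed

lemma braid_class_eq_iff:
  "u \<in> braid_words n \<Longrightarrow> v \<in> braid_words n \<Longrightarrow> braid_class n u = braid_class n v \<longleftrightarrow> braid_eq n u v"
  unfolding braid_class_def using eq_equiv_class_iff[OF equiv_braid_rel] by (simp add: braid_rel_def)

lemma mem_braid_class: "v \<in> braid_class n u \<longleftrightarrow> braid_eq n u v"
  by (simp add: braid_class_def braid_rel_def)

lemma carrier_braid_group: "carrier (braid_group n) = braid_class n ` braid_words n"
  by (auto simp: braid_group_def quotient_def braid_class_def)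

lemma mult_braid_class:
  assumes "u \<in> braid_words n" "v \<in> braid_words n"
  shows "braid_class n u \<otimes>\<^bsub>braid_group n\<^esub> braid_class n v = braid_class n (u @ v)"
proof -
  have *: "braid_class n (u' @ v') = braid_class n (u @ v)"
    if "u' \<in> braid_class n u" "v' \<in> braid_class n v" for u' v'
  proof -
    have "braid_eq n (u @ v) (u' @ v')"
      using that by (simp add: mem_braid_class braid_eq.append)
    from this braid_eq_words[OF this] show ?thesis
      by (simp add: braid_class_eq_iff braid_eq.sym)
  qed
  have "u \<in> braid_class n u" "v \<in> braid_class n v"
    using assms by (auto simp: mem_braid_class intro: braid_eq.refl)
  then have "(\<Union>u'\<in>braid_class n u. \<Union>v'\<in>braid_class n v. braid_class n (u' @ v'))
      = braid_class n (u @ v)"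
    using * by blast
  then show ?thesis
    by (simp add: braid_group_def)
qed

lemma one_braid_group: "\<one>\<^bsub>braid_group n\<^esub> = braid_class n []"
  by (simp add: braid_group_def)

lemma braid_eq_inverse:
  "w \<in> braid_words n \<Longrightarrow> braid_eq n (rev (map (\<lambda>(i, b). (i, \<not> b)) w) @ w) []"
proof (induction w)
  case Nil
  show ?case by (simp add: braid_eq.refl)
next
  case (Cons p w)
  obtain i b where p: "p = (i, b)" by (cases p)
  let ?r = "rev (map (\<lambda>(i, b). (i, \<not> b)) w)"
  have w: "w \<in> braid_words n" "1 \<le> i" "i < n" using Cons.prems p by auto
  have r: "?r \<in> braid_words n"
    using braid_eq_words[OF Cons.IH[OF w(1)]] by simp
  have "braid_eq n ([(i, \<not> b), (i, b)] @ w) ([] @ w)"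
    using braid_eq.cancel[of i n "\<not> b"] w by (intro braid_eq.append braid_eq.refl) auto
  then have "braid_eq n (?r @ [(i, \<not> b), (i, b)] @ w) (?r @ w)"
    using braid_eq.append[OF braid_eq.refl[OF r]] by force
  then show ?case
    using braid_eq.trans[OF _ Cons.IH[OF w(1)]] p by simp
qed

lemma group_braid_group: "group (braid_group n)"
proof (rule groupI)
  fix x assume "x \<in> carrier (braid_group n)"
  then obtain w where w: "x = braid_class n w" "w \<in> braid_words n"
    by (auto simp: carrier_braid_group)
  let ?r = "rev (map (\<lambda>(i, b). (i, \<not> b)) w)"
  have e: "braid_eq n (?r @ w) []" using braid_eq_inverse[OF w(2)] .
  then have r: "?r \<in> braid_words n" using braid_eq_words by fastforce
  show "\<exists>y\<in>carrier (braid_group n). y \<otimes>\<^bsub>braid_group n\<^esub> x = \<one>\<^bsub>braid_group n\<^esub>"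
    using w r e braid_class_eq_iff[of "?r @ w" n "[]"]
    by (intro bexI[of _ "braid_class n ?r"])
       (simp_all add: mult_braid_class one_braid_group carrier_braid_group)
qed (auto simp: carrier_braid_group mult_braid_class one_braid_group)

lemma word_perm_append: "word_perm (u @ v) = word_perm u \<circ> word_perm v"
  by (induction u) (auto simp: word_perm_def)

lemma word_perm_simps [simp]:
  "word_perm [] = id"
  "word_perm ((i, b) # w) = Transposition.transpose i (i + 1) \<circ> word_perm w"
  by (simp_all add: word_perm_def)

lemma word_perm_cong: "braid_eq n u v \<Longrightarrow> word_perm u = word_perm v"
proof (induction rule: braid_eq.induct)
  case (append u u' v v')
  then show ?case by (simp add: word_perm_append)
next
  case (far i j)
  then have "i \<noteq> j" "i \<noteq> Suc j" "Suc i \<noteq> j" by auto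
  then show ?case by (simp add: fun_eq_iff Transposition.transpose_def)
next
  case (braid i)
  show ?case by (simp add: fun_eq_iff Transposition.transpose_def)
next
  case (cancel i b)
  show ?case by (simp add: fun_eq_iff)
qed auto

lemma word_perm_permutes: "w \<in> braid_words n \<Longrightarrow> word_perm w permutes {1..n}"
proof (induction w)
  case Nil
  then show ?case by (simp only: word_perm_simps permutes_id)
next
  case (Cons p w)
  obtain i b where "p = (i, b)" by (cases p)
  then show ?case
    using Cons permutes_compose[of "word_perm w" "{1..n}" "Transposition.transpose i (i + 1)"]
      permutes_swap_id[of i "{1..n}" "i + 1"]
    by (simp add: comp_def)
qed

lemma braid_perm_class:
  assumes "w \<in> braid_words n"
  shows "braid_perm n (braid_class n w) = word_perm w"
proof -
  have "w \<in> braid_class n w" using assms by (simp add: mem_braid_class braid_eq.refl)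
  then have "(SOME v. v \<in> braid_class n w) \<in> braid_class n w" by (rule someI)
  then show ?thesis unfolding braid_perm_def mem_braid_class by (metis word_perm_cong)
qed

lemma braid_perm_hom: "braid_perm n \<in> hom (braid_group n) (sym_group n)"
  by (rule homI)
     (auto simp: carrier_braid_group braid_perm_class mult_braid_class word_perm_append
       sym_group_def word_perm_permutes simp del: One_nat_def)

lemma subgroup_pure_braid:
  "subgroup (kernel (braid_group n) (sym_group n) (braid_perm n)) (braid_group n)"
  using group_hom.subgroup_kernel[of "braid_group n" "sym_group n" "braid_perm n"]
    group_braid_group sym_group_is_group braid_perm_hom
  by (simp add: group_hom_def group_hom_axioms_def)

lemma group_pure_braid_group: "group (pure_braid_group n)"
  unfolding pure_braid_group_def
  using subgroup.subgroup_is_group[OF subgroup_pure_braid group_braid_group] .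

lemma word_perm_conj:
  "word_perm (map (\<lambda>m. (m, True)) (rev ms) @ [(i, True), (i, True)] @ map (\<lambda>m. (m, False)) ms) = id"
proof (induction ms rule: rev_induct)
  case Nil
  show ?case by (simp add: fun_eq_iff)
next
  case (snoc m ms)
  have "word_perm (map (\<lambda>m. (m, True)) (rev (ms @ [m])) @ [(i, True), (i, True)] @
          map (\<lambda>m. (m, False)) (ms @ [m]))
      = Transposition.transpose m (m + 1) \<circ>
          word_perm (map (\<lambda>m. (m, True)) (rev ms) @ [(i, True), (i, True)] @ map (\<lambda>m. (m, False)) ms) \<circ>
          Transposition.transpose m (m + 1)"
    by (simp add: word_perm_append comp_assoc)
  then show ?case unfolding snoc.IH by (simp add: fun_eq_iff)
qed

lemma A_elem_in_pure_braid:
  assumes "1 \<le> i" "i \<le> n" "1 \<le> j" "j \<le> n"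
  shows "A_elem n i j \<in> carrier (pure_braid_group n)"
proof -
  have *: "braid_class n (A_word i j) \<in> carrier (pure_braid_group n)"
    if "1 \<le> i" "i < j" "j \<le> n" for i j
  proof -
    have "A_word i j \<in> braid_words n"
      using that by (auto simp: A_word_def braid_words_def)
    moreover have "word_perm (A_word i j) = id"
      unfolding A_word_def by (rule word_perm_conj)
    ultimately show ?thesis
      by (simp add: pure_braid_group_def kernel_def carrier_braid_group braid_perm_class sym_group_def)
  qed
  show ?thesis
    using assms group.is_monoid[OF group_pure_braid_group]
    by (auto simp: A_elem_def intro!: * monoid.one_closed)
qed

end

(* The three strand removals and the boundary map of P_3 take values in the infinite cyclic group
   P_2, so Brun_3 = Z_3 is the set of braids killed by every homomorphism from P_3 to the integers.
   P_3 is generated by a = A_{1,3}, b = A_{2,3} and the central full twist. Put c = [a^-1, b].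
   Iterated commutators give Brunnian braids on four strands whose boundaries are [c, a] and [c, b];
   modulo these c is central, so Z_3 is generated by c and Bd_3. For the converse let zeta be the
   central coordinate of a homomorphism from P_3 to the Heisenberg group. On P_4 the function
   zeta(boundary x) - zeta(d_1 x) + zeta(d_2 x) - zeta(d_3 x) + zeta(d_4 x) is additive because the
   bilinear correction terms cancel; additive functions vanish on Brun_4, hence zeta vanishes on
   Bd_3. Thus Bd_3 is the kernel of zeta on Z_3, zeta(c) is not 0, Z_3/Bd_3 is infinite cyclic and
   automorphisms of P_3 act on it by a sign. Conjugation by sigma_1 gives the sign -1. *)
theory Submission
  imports Defs
begin

section \<open>Deciding equality of braid words\<close>

text \<open>\<open>strand_removal\<close> and \<open>theta\<close> are definite descriptions by
  values on the A_{i,j}, so nothing can be computed before existence and uniqueness are proved.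
  Uniqueness is generation of P_n by the A_{i,j}. Existence needs no presentation of P_n: both maps
  are written on braid words by the Reidemeister-Schreier process for the stabilizer of a strand,
  and only the relations of B_n, read from each starting position, have to be checked. As n is at
  most 4, this reduces to finite lists of word identities, certified by handle reduction. The
  Heisenberg group enters because P_3 modulo its centre is free on a and b, and c survives in the
  quotient of nilpotency class two. Its central coordinate is additive up to the determinant of the
  (p, q) parts; zeta is tied to boundaries by the vanishing on P_4 of the alternating sum of these
  determinants over the five faces. No homotopy theory is used: that automorphisms preserve Z_3 and
  Bd_3, and that the quotient is infinite cyclic, is derived from zeta and the linking
  numbers.\<close>

definition winv :: "braid_word \<Rightarrow> braid_word" where
  "winv w = rev (map (\<lambda>(i, b). (i, \<not> b)) w)"

lemma winv_simps [simp]: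
  "winv [] = []"
  "winv ((i, b) # w) = winv w @ [(i, \<not> b)]"
  "winv (u @ v) = winv v @ winv u"
  "winv (winv w) = w"
  by (auto simp: winv_def rev_map o_def case_prod_unfold)

lemma winv_words [simp]: "winv w \<in> braid_words n \<longleftrightarrow> w \<in> braid_words n"
  by (induction w) auto

lemma braid_eq_winv_left: "w \<in> braid_words n \<Longrightarrow> braid_eq n (winv w @ w) []"
  unfolding winv_def by (rule braid_eq_inverse)

lemma braid_eq_winv_right: "w \<in> braid_words n \<Longrightarrow> braid_eq n (w @ winv w) []"
  using braid_eq_winv_left[of "winv w" n] by simp

lemma braid_class_in_carrier [simp]:
  "w \<in> braid_words n \<Longrightarrow> braid_class n w \<in> carrier (braid_group n)"
  by (simp add: carrier_braid_group)

lemma inv_braid_class: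
  assumes "w \<in> braid_words n"
  shows "inv\<^bsub>braid_group n\<^esub> braid_class n w = braid_class n (winv w)"
proof -
  interpret group "braid_group n" by (rule group_braid_group)
  have "braid_class n (winv w) \<otimes>\<^bsub>braid_group n\<^esub> braid_class n w = \<one>\<^bsub>braid_group n\<^esub>"
    using assms braid_eq_winv_left[of w n]
    by (simp add: mult_braid_class one_braid_group braid_class_eq_iff)
  then show ?thesis
    using assms by (intro inv_equality) auto
qed

lemma braid_eq_winv:
  assumes "braid_eq n u v"
  shows "braid_eq n (winv u) (winv v)"
proof -
  have "u \<in> braid_words n" "v \<in> braid_words n" using braid_eq_words[OF assms] by auto
  then show ?thesis
    using assms inv_braid_class[of u n] inv_braid_class[of v n]
      braid_class_eq_iff[of u n v] braid_class_eq_iff[of "winv u" n "winv v"] by simp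
qed

lemma braid_eq_context:
  assumes "braid_eq n v v'" "u \<in> braid_words n" "w \<in> braid_words n"
  shows "braid_eq n (u @ v @ w) (u @ v' @ w)"
  using assms by (intro braid_eq.append braid_eq.refl)

lemma braid_eq_cancel_right:
  assumes "braid_eq n (u @ winv v) []"
    and "v \<in> braid_words n"
  shows "braid_eq n u v"
proof -
  have u: "u \<in> braid_words n" using braid_eq_words[OF assms(1)] by simp
  have "braid_eq n u (u @ winv v @ v)"
    using braid_eq.sym[OF braid_eq_context[OF braid_eq_winv_left[OF assms(2)] u, of "[]"]] by simp
  moreover have "braid_eq n (u @ winv v @ v) v"
    using braid_eq.append[OF assms(1) braid_eq.refl[OF assms(2)]] by simp
  ultimately show ?thesis by (rule braid_eq.trans)
qed

text \<open>The defining relations involve positive letters only. Read as a conjugation, x y = z x,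
  a relation passes to the inverse of x (here) and to the inverses of y and z (next lemma), which
  yields all sign patterns.\<close>

lemma braid_eq_conj_winv:
  assumes "braid_eq n (x @ y) (z @ x)"
  shows "braid_eq n (y @ winv x) (winv x @ z)"
proof -
  have w: "x \<in> braid_words n" "y \<in> braid_words n" "z \<in> braid_words n"
    using braid_eq_words[OF assms] by auto
  have "braid_eq n (winv x @ (x @ y) @ winv x) (winv x @ (z @ x) @ winv x)"
    using assms w by (intro braid_eq_context) auto
  moreover have "braid_eq n (winv x @ (x @ y) @ winv x) (y @ winv x)"
    using braid_eq.append[OF braid_eq_winv_left[of x n] braid_eq.refl[of "y @ winv x" n]] w by simp
  moreover have "braid_eq n (winv x @ (z @ x) @ winv x) (winv x @ z)"
    using braid_eq.append[OF braid_eq.refl[of "winv x @ z" n] braid_eq_winv_right[of x n]] w by simp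
  ultimately show ?thesis by (meson braid_eq.sym braid_eq.trans)
qed

lemma braid_eq_conj_inv:
  assumes "braid_eq n (x @ y) (z @ x)"
  shows "braid_eq n (x @ winv y) (winv z @ x)"
  using braid_eq_winv[OF braid_eq_conj_winv[OF assms]] by simp

lemma braid_eq_commute:
  assumes "1 \<le> i" "i < n" "1 \<le> j" "j < n" "i + 2 \<le> j \<or> j + 2 \<le> i"
  shows "braid_eq n [(i, b), (j, c)] [(j, c), (i, b)]"
proof -
  have *: "braid_eq n [(i, b), (j, c)] [(j, c), (i, b)]"
    if "1 \<le> i" "i + 2 \<le> j" "j < n" for i j b c
  proof -
    have 1: "braid_eq n ([(i, True)] @ [(j, True)]) ([(j, True)] @ [(i, True)])"
      using braid_eq.far[of i j n] that by simp
    have 2: "braid_eq n ([(i, True)] @ [(j, c)]) ([(j, c)] @ [(i, True)])"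
      using 1 braid_eq_conj_inv[OF 1] by (cases c) auto
    show ?thesis
      using 2 braid_eq.sym[OF braid_eq_conj_winv[OF 2]] braid_eq_conj_winv[OF 2] by (cases b) auto
  qed
  show ?thesis
    using assms(5) *[of i j b c] braid_eq.sym[OF *[of j i c b]] assms by auto
qed

text \<open>The braid relation says that \<open>?x\<close> conjugates sigma_{i+1} to sigma_i, hence
  also their inverses; moving the letters of \<open>?x\<close> to the outer sides gives the
  identity. It removes a handle whose inner word is a single sigma_{i+1}.\<close>

lemma braid_eq_slide:
  assumes "1 \<le> i" "i + 1 < n"
  shows "braid_eq n [(i, e), (i + 1, d), (i, \<not> e)] [(i + 1, \<not> e), (i, d), (i + 1, e)]"
proof -
  let ?x = "[(i + 1, e), (i, e)]"
  have 0: "braid_eq n [(i, True), (i + 1, True), (i, True)] [(i + 1, True), (i, True), (i + 1, True)]"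
    using assms by (rule braid_eq.braid)
  have 1: "braid_eq n (?x @ [(i + 1, e)]) ([(i, e)] @ ?x)"
  proof (cases e)
    case True
    then show ?thesis using braid_eq.sym[OF 0] by simp
  next
    case False
    then show ?thesis using braid_eq.sym[OF braid_eq_winv[OF 0]] by simp
  qed
  have 2: "braid_eq n (?x @ [(i + 1, d)]) ([(i, d)] @ ?x)"
    using 1 braid_eq_conj_inv[OF 1] by (cases "d = e") auto
  have c: "braid_eq n [(i + 1, \<not> e), (i + 1, e)] []" "braid_eq n [(i, e), (i, \<not> e)] []"
    using braid_eq.cancel[of "i + 1" n "\<not> e"] braid_eq.cancel[of i n e] assms by auto
  have "braid_eq n ([(i + 1, \<not> e)] @ (?x @ [(i + 1, d)]) @ [(i, \<not> e)])
      ([(i + 1, \<not> e)] @ ([(i, d)] @ ?x) @ [(i, \<not> e)])"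
    using 2 assms by (intro braid_eq_context) auto
  moreover have "braid_eq n ([(i + 1, \<not> e)] @ (?x @ [(i + 1, d)]) @ [(i, \<not> e)])
      [(i, e), (i + 1, d), (i, \<not> e)]"
    using braid_eq.append[OF c(1) braid_eq.refl[of "[(i, e), (i + 1, d), (i, \<not> e)]" n]] assms by simp
  moreover have "braid_eq n ([(i + 1, \<not> e)] @ ([(i, d)] @ ?x) @ [(i, \<not> e)])
      [(i + 1, \<not> e), (i, d), (i + 1, e)]"
    using braid_eq.append[OF braid_eq.refl[of "[(i + 1, \<not> e), (i, d), (i + 1, e)]" n] c(2)] assms by simp
  ultimately show ?thesis by (meson braid_eq.sym braid_eq.trans)
qed

text \<open>Dehornoy's handle reduction. A handle is a subword \<open>\<sigma>\<^sub>i\<^sup>e u \<sigma>\<^sub>i\<^sup>-\<^sup>e\<close> where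
  \<open>\<sigma>\<^sub>i\<close> and \<open>\<sigma>\<^sub>i\<^sub>-\<^sub>1\<close> do not occur in u; it is removed by conjugating u letterwise.
  In \<open>handle_reduce f r w\<close>, r is the part of the word already scanned, in reverse, and f is
  fuel. Only soundness of the procedure is needed.\<close>

fun slide :: "nat \<Rightarrow> bool \<Rightarrow> braid_word \<Rightarrow> braid_word" where
  "slide i e [] = []"
| "slide i e ((j, d) # u) =
    (if j = Suc i then (j, \<not> e) # (i, d) # (j, e) # slide i e u else (j, d) # slide i e u)"

fun find_handle :: "nat \<Rightarrow> bool \<Rightarrow> braid_word \<Rightarrow> braid_word \<Rightarrow> (braid_word \<times> braid_word) option" where
  "find_handle i b u [] = None"
| "find_handle i b u ((j, c) # r) =
    (if j = i then if c = b then None else Some (u, r)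
     else if Suc j = i then None
     else find_handle i b ((j, c) # u) r)"

fun handle_reduce :: "nat \<Rightarrow> braid_word \<Rightarrow> braid_word \<Rightarrow> braid_word" where
  "handle_reduce 0 r w = rev r @ w"
| "handle_reduce (Suc f) r [] = rev r"
| "handle_reduce (Suc f) r ((i, b) # w) =
    (case find_handle i b [] r of
       None \<Rightarrow> handle_reduce f ((i, b) # r) w
     | Some (u, r') \<Rightarrow> handle_reduce f r' (slide i (\<not> b) u @ w))"

lemma rev_words [simp]: "rev w \<in> braid_words n \<longleftrightarrow> w \<in> braid_words n"
  by (induction w) auto

lemma slide_braid_eq:
  assumes "u \<in> braid_words n" "1 \<le> i" "i < n" "\<forall>(j, d) \<in> set u. j \<noteq> i \<and> Suc j \<noteq> i"
  shows "braid_eq n ((i, e) # u @ [(i, \<not> e)]) (slide i e u)"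
  using assms
proof (induction u)
  case Nil
  then show ?case using braid_eq.cancel[of i n e] by simp
next
  case (Cons p u)
  obtain j d where p: "p = (j, d)" by (cases p)
  have IH: "braid_eq n ((i, e) # u @ [(i, \<not> e)]) (slide i e u)" using Cons by simp
  have j: "1 \<le> j" "j < n" "j \<noteq> i" "Suc j \<noteq> i" and u: "u \<in> braid_words n" using Cons.prems p by auto
  define v where "v = (if j = Suc i then [(j, \<not> e), (i, d), (j, e)] else [(j, d)])"
  have 1: "braid_eq n [(i, e), (j, d), (i, \<not> e)] v"
  proof (cases "j = Suc i")
    case True
    then show ?thesis using braid_eq_slide[of i n e d] Cons.prems j v_def by simp
  next
    case False
    with j have "i + 2 \<le> j \<or> j + 2 \<le> i" by linarith
    then have "braid_eq n ([(i, e), (j, d)] @ [(i, \<not> e)]) ([(j, d), (i, e)] @ [(i, \<not> e)])"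
      using braid_eq_commute[of i n j e d] Cons.prems j by (intro braid_eq.append braid_eq.refl) auto
    moreover have "braid_eq n ([(j, d)] @ [(i, e), (i, \<not> e)]) ([(j, d)] @ [])"
      using braid_eq.cancel[of i n e] Cons.prems j by (intro braid_eq.append braid_eq.refl) auto
    ultimately have "braid_eq n [(i, e), (j, d), (i, \<not> e)] [(j, d)]"
      using braid_eq.trans by simp
    then show ?thesis using False v_def by simp
  qed
  \<comment> \<open>Inserting a cancelling pair behind the first inner letter splits the handle into
    a one-letter handle and a shorter one.\<close>
  have "braid_eq n ([(i, e), (j, d)] @ [] @ u @ [(i, \<not> e)])
      ([(i, e), (j, d)] @ [(i, \<not> e), (i, e)] @ u @ [(i, \<not> e)])"
    using braid_eq.sym[OF braid_eq.cancel[of i n "\<not> e"]] u j Cons.prems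
    by (intro braid_eq_context) auto
  then have 2: "braid_eq n ((i, e) # (j, d) # u @ [(i, \<not> e)])
      ([(i, e), (j, d), (i, \<not> e)] @ ((i, e) # u @ [(i, \<not> e)]))"
    by simp
  have "braid_eq n ((i, e) # (j, d) # u @ [(i, \<not> e)]) (v @ slide i e u)"
    using 2 braid_eq.append[OF 1 IH] by (rule braid_eq.trans)
  then show ?case using p v_def by (cases "j = Suc i") auto
qed

lemma find_handle_Some:
  assumes "find_handle i b u r = Some (u', r')" "\<forall>(j, d) \<in> set u. j \<noteq> i \<and> Suc j \<noteq> i"
  shows "rev r @ u = rev r' @ (i, \<not> b) # u' \<and> (\<forall>(j, d) \<in> set u'. j \<noteq> i \<and> Suc j \<noteq> i)"
  using assms by (induction i b u r rule: find_handle.induct) (auto split: if_splits)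

lemma handle_reduce_braid_eq:
  assumes "r \<in> braid_words n" "w \<in> braid_words n"
  shows "braid_eq n (rev r @ w) (handle_reduce f r w)"
  using assms
proof (induction f r w rule: handle_reduce.induct)
  case (3 f r i b w)
  show ?case
  proof (cases "find_handle i b [] r")
    case None
    then show ?thesis using 3 by simp
  next
    case (Some a)
    obtain u r' where a: "a = (u, r')" by (cases a)
    have r: "rev r = rev r' @ (i, \<not> b) # u" "\<forall>(j, d) \<in> set u. j \<noteq> i \<and> Suc j \<noteq> i"
      using find_handle_Some[of i b "[]" r u r'] Some a by auto
    have "rev r \<in> braid_words n" using 3 by simp
    then have w: "r' \<in> braid_words n" "u \<in> braid_words n" "1 \<le> i" "i < n" unfolding r(1) by auto
    have *: "braid_eq n ((i, \<not> b) # u @ [(i, b)]) (slide i (\<not> b) u)"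
      using slide_braid_eq[of u n i "\<not> b"] w r by simp
    have "braid_eq n (rev r' @ ((i, \<not> b) # u @ [(i, b)]) @ w) (rev r' @ slide i (\<not> b) u @ w)"
      using * w 3 by (intro braid_eq_context) auto
    moreover have "braid_eq n (rev r' @ slide i (\<not> b) u @ w) (handle_reduce f r' (slide i (\<not> b) u @ w))"
      using 3(2)[OF Some a[symmetric]] w braid_eq_words[OF *] 3 by simp
    ultimately have "braid_eq n (rev r' @ ((i, \<not> b) # u @ [(i, b)]) @ w)
        (handle_reduce f r' (slide i (\<not> b) u @ w))"
      by (rule braid_eq.trans)
    then show ?thesis using Some a r by simp
  qed
qed (simp_all add: braid_eq.refl)

text \<open>Only soundness matters, so the fuel 200 merely has to be large enough for the words
  tested below; it is not a bound for general words.\<close>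

definition braid_test :: "nat \<Rightarrow> braid_word \<Rightarrow> braid_word \<Rightarrow> bool" where
  "braid_test n u v \<longleftrightarrow> list_all (\<lambda>(i, b). 1 \<le> i \<and> i < n) (u @ v)
     \<and> handle_reduce 200 [] (u @ winv v) = []"

lemma braid_words_list_all: "w \<in> braid_words n \<longleftrightarrow> list_all (\<lambda>(i, b). 1 \<le> i \<and> i < n) w"
  by (induction w) auto

lemma braid_test_sound:
  assumes "braid_test n u v"
  shows "braid_eq n u v"
proof -
  have w: "u \<in> braid_words n" "v \<in> braid_words n"
    using assms unfolding braid_test_def braid_words_list_all list_all_append by blast+
  have "braid_eq n (rev [] @ u @ winv v) (handle_reduce 200 [] (u @ winv v))"
    using w by (intro handle_reduce_braid_eq) simp_all
  moreover have "handle_reduce 200 [] (u @ winv v) = []"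
    using assms unfolding braid_test_def by blast
  ultimately have "braid_eq n (u @ winv v) []"
    by (simp only: rev.simps append_Nil)
  then show ?thesis using w(2) by (rule braid_eq_cancel_right)
qed

section \<open>Generators of the pure braid group\<close>

lemma A_word_words: "1 \<le> i \<Longrightarrow> i < j \<Longrightarrow> j \<le> n \<Longrightarrow> A_word i j \<in> braid_words n"
  by (auto simp: A_word_def braid_words_def)

lemma word_perm_A_word: "word_perm (A_word i j) = id"
  unfolding A_word_def by (rule word_perm_conj)

lemma word_perm_winv: "word_perm w = id \<Longrightarrow> w \<in> braid_words n \<Longrightarrow> word_perm (winv w) = id"
  using word_perm_cong[OF braid_eq_winv_left[of w n]] by (simp add: word_perm_append)

definition word_products :: "braid_word set \<Rightarrow> braid_word set" where
  "word_products S = concat ` lists (S \<union> winv ` S)"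

lemma word_products_Nil [simp]: "[] \<in> word_products S"
  unfolding word_products_def by (rule image_eqI[of _ _ "[]"]) auto

lemma word_products_append:
  assumes "u \<in> word_products S" "v \<in> word_products S"
  shows "u @ v \<in> word_products S"
proof -
  obtain us vs where "u = concat us" "us \<in> lists (S \<union> winv ` S)"
      "v = concat vs" "vs \<in> lists (S \<union> winv ` S)"
    using assms by (auto simp: word_products_def)
  then show ?thesis
    unfolding word_products_def by (intro image_eqI[of _ _ "us @ vs"]) auto
qed

lemma word_products_mono: "S \<subseteq> T \<Longrightarrow> word_products S \<subseteq> word_products T"
  unfolding word_products_def by (intro image_mono lists_mono) auto

definition A_words :: "nat \<Rightarrow> braid_word set" where
  "A_words n = {A_word i j |i j. 1 \<le> i \<and> i < j \<and> j \<le> n}"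

definition last_A_words :: "nat \<Rightarrow> braid_word set" where
  "last_A_words n = {A_word k n |k. 1 \<le> k \<and> k < n}"

definition last_product :: "nat \<Rightarrow> (nat \<times> bool) list \<Rightarrow> braid_word" where
  "last_product n xs = concat (map (\<lambda>(k, b). if b then A_word k n else winv (A_word k n)) xs)"

lemma last_product_in:
  "\<forall>(k, b) \<in> set xs. 1 \<le> k \<and> k < n \<Longrightarrow> last_product n xs \<in> word_products (last_A_words n)"
  unfolding last_product_def word_products_def
  by (rule image_eqI[OF HOL.refl]) (fastforce simp: last_A_words_def)

text \<open>Every word is \<open>h u c\<^sub>k\<close> with h a product of the \<open>A\<^sub>i\<^sub>,\<^sub>n\<close> and their
  inverses, u a word on the first \<open>n - 1\<close> strands, and
  \<open>c\<^sub>k = \<sigma>\<^sub>n\<^sub>-\<^sub>1 \<dots> \<sigma>\<^sub>k\<close>. \<open>coset_step\<close> decomposes \<open>c\<^sub>k\<close> followed by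
  a letter in this way, and \<open>conj_letter\<close> conjugates \<open>A\<^sub>k\<^sub>,\<^sub>n\<close> by a letter.\<close>

definition coset_word :: "nat \<Rightarrow> nat \<Rightarrow> braid_word" where
  "coset_word n k = map (\<lambda>m. (m, True)) (rev [k..<n])"

fun conj_letter :: "nat \<Rightarrow> bool \<Rightarrow> nat \<Rightarrow> (nat \<times> bool) list" where
  "conj_letter i b k =
    (if i = k then if b then [(Suc k, True)] else [(k, True), (Suc k, True), (k, False)]
     else if Suc i = k then if b then [(k, False), (i, True), (k, True)] else [(i, True)]
     else [(k, True)])"

fun coset_step :: "nat \<Rightarrow> nat \<Rightarrow> bool \<Rightarrow> (nat \<times> bool) list \<times> braid_word \<times> nat" where
  "coset_step k i b =
    (if i = k then (if b then [(k, True)] else [], [], Suc k)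
     else if Suc i = k then (if b then [] else [(i, False)], [], i)
     else ([], [(if k < i then i - 1 else i, b)], k))"

lemma list_all_upt: "list_all P [a..<b] \<longleftrightarrow> (\<forall>i. a \<le> i \<and> i < b \<longrightarrow> P i)"
  by (auto simp: list_all_iff)

text \<open>At most four strands ever occur, so the cases n = 2, 3, 4 are settled by computation.
  The conjugating letters stop at n - 2 because they come from the braid group on the first n - 1
  strands.\<close>

lemma conj_letter_check:
  "list_all (\<lambda>n. list_all (\<lambda>k. list_all (\<lambda>i. list_all (\<lambda>b.
     list_all (\<lambda>(k, b). 1 \<le> k \<and> k < n) (conj_letter i b k) \<and>
     braid_test n ([(i, b)] @ A_word k n @ [(i, \<not> b)]) (last_product n (conj_letter i b k)))
     [True, False]) [1..<n - 1]) [1..<n]) [2..<5]"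
  by code_simp

lemma coset_step_check:
  "list_all (\<lambda>n. list_all (\<lambda>k. list_all (\<lambda>i. list_all (\<lambda>b.
     case coset_step k i b of (h, u, k') \<Rightarrow>
       list_all (\<lambda>(k, b). 1 \<le> k \<and> k < n) h \<and>
       list_all (\<lambda>(i, b). 1 \<le> i \<and> i < n - 1) u \<and> 1 \<le> k' \<and> k' \<le> n \<and>
       braid_test n (coset_word n k @ [(i, b)]) (last_product n h @ u @ coset_word n k'))
     [True, False]) [1..<n]) [1..<Suc n]) [2..<5]"
  by code_simp

lemma conj_letter:
  assumes "2 \<le> n" "n \<le> 4" "1 \<le> k" "k < n" "1 \<le> i" "i < n - 1"
  shows "\<exists>v \<in> word_products (last_A_words n). braid_eq n ([(i, b)] @ A_word k n @ [(i, \<not> b)]) v"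
proof -
  have *: "list_all (\<lambda>(k, b). 1 \<le> k \<and> k < n) (conj_letter i b k) \<and>
     braid_test n ([(i, b)] @ A_word k n @ [(i, \<not> b)]) (last_product n (conj_letter i b k))"
    using conj_letter_check assms unfolding list_all_upt by (cases b) auto
  show ?thesis
    by (rule bexI[OF braid_test_sound last_product_in]) (use * in \<open>auto simp: list_all_iff\<close>)
qed

lemma coset_step:
  assumes "2 \<le> n" "n \<le> 4" "1 \<le> k" "k \<le> n" "1 \<le> i" "i < n"
  obtains h u k' where "h \<in> word_products (last_A_words n)" "u \<in> braid_words (n - 1)"
    "1 \<le> k'" "k' \<le> n" "braid_eq n (coset_word n k @ [(i, b)]) (h @ u @ coset_word n k')"
proof -
  obtain h u k' where s: "coset_step k i b = (h, u, k')" by (cases "coset_step k i b")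
  have *: "list_all (\<lambda>(k, b). 1 \<le> k \<and> k < n) h \<and>
       list_all (\<lambda>(i, b). 1 \<le> i \<and> i < n - 1) u \<and> 1 \<le> k' \<and> k' \<le> n \<and>
       braid_test n (coset_word n k @ [(i, b)]) (last_product n h @ u @ coset_word n k')"
  proof -
    have "\<forall>b \<in> {True, False}. case coset_step k i b of (h, u, k') \<Rightarrow>
       list_all (\<lambda>(k, b). 1 \<le> k \<and> k < n) h \<and>
       list_all (\<lambda>(i, b). 1 \<le> i \<and> i < n - 1) u \<and> 1 \<le> k' \<and> k' \<le> n \<and>
       braid_test n (coset_word n k @ [(i, b)]) (last_product n h @ u @ coset_word n k')"
      using coset_step_check assms unfolding list_all_upt
      by (auto simp only: list.pred_inject less_Suc_eq_le numeral_eq_Suc pred_numeral_simps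
          ball_simps insert_iff empty_iff)
    then show ?thesis using s by (cases b) (simp_all del: coset_step.simps)
  qed
  show thesis
    by (rule that[of "last_product n h" u k', OF last_product_in _ _ _ braid_test_sound])
      (use * in \<open>auto simp: list_all_iff braid_words_list_all\<close>)
qed

lemma last_A_words_words: "last_A_words n \<subseteq> braid_words n"
  by (auto simp: last_A_words_def intro!: A_word_words)

lemma word_products_words:
  assumes "S \<subseteq> braid_words n"
  shows "word_products S \<subseteq> braid_words n"
proof -
  have "concat ws \<in> braid_words n" if "ws \<in> lists (S \<union> winv ` S)" for ws
    using that assms by (induction ws) auto
  then show ?thesis by (auto simp: word_products_def)
qed

text \<open>Conjugation is multiplicative, so it suffices to treat the A_{k,n} and, by
  \<open>winv_P\<close>, their inverses. The purpose is to let a factor on the first n - 1 strands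
  pass such a product in \<open>coset_decomposition\<close>.\<close>

lemma conj_letter_products:
  assumes "2 \<le> n" "n \<le> 4" "1 \<le> i" "i < n - 1" "x \<in> word_products (last_A_words n)"
  shows "\<exists>v \<in> word_products (last_A_words n). braid_eq n ([(i, b)] @ x @ [(i, \<not> b)]) v"
proof -
  let ?P = "word_products (last_A_words n)"
  obtain ws where ws: "x = concat ws" "ws \<in> lists (last_A_words n \<union> winv ` last_A_words n)"
    using assms(5) by (auto simp: word_products_def)
  have winv_P: "winv v \<in> ?P" if "v \<in> ?P" for v
  proof -
    obtain vs where vs: "v = concat vs" "vs \<in> lists (last_A_words n \<union> winv ` last_A_words n)"
      using \<open>v \<in> ?P\<close> by (auto simp: word_products_def)
    have "winv (concat vs) = concat (rev (map winv vs))" by (induction vs) auto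
    then show ?thesis
      using vs unfolding word_products_def by (intro image_eqI[of _ _ "rev (map winv vs)"]) fastforce+
  qed
  have one: "\<exists>v \<in> ?P. braid_eq n ([(i, b)] @ w @ [(i, \<not> b)]) v"
    if w: "w \<in> last_A_words n \<union> winv ` last_A_words n" for w
  proof -
    obtain k where k: "1 \<le> k" "k < n" "w = A_word k n \<or> w = winv (A_word k n)"
      using w by (auto simp: last_A_words_def)
    obtain v where v: "v \<in> ?P" "braid_eq n ([(i, b)] @ A_word k n @ [(i, \<not> b)]) v"
      using conj_letter[OF assms(1,2) k(1,2) assms(3,4)] by blast
    show ?thesis
      using k(3) v winv_P[OF v(1)] braid_eq_winv[OF v(2)] by auto
  qed
  show ?thesis
    using ws(2) unfolding ws(1)
  proof (induction ws)
    case Nil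
    show ?case
      using assms braid_eq.cancel[of i n b] by (intro bexI[of _ "[]"]) auto
  next
    case (Cons w ws)
    obtain v v' where v: "v \<in> ?P" "braid_eq n ([(i, b)] @ w @ [(i, \<not> b)]) v"
      "v' \<in> ?P" "braid_eq n ([(i, b)] @ concat ws @ [(i, \<not> b)]) v'"
      using one[of w] Cons by auto
    have W: "w \<in> braid_words n" "concat ws \<in> braid_words n"
      using braid_eq_words[OF v(2)] braid_eq_words[OF v(4)] by auto
    have "braid_eq n (([(i, b)] @ w) @ [] @ (concat ws @ [(i, \<not> b)]))
        (([(i, b)] @ w) @ [(i, \<not> b), (i, b)] @ (concat ws @ [(i, \<not> b)]))"
      using braid_eq.sym[OF braid_eq.cancel[of i n "\<not> b"]] W assms
      by (intro braid_eq_context) auto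
    then have "braid_eq n ([(i, b)] @ concat (w # ws) @ [(i, \<not> b)])
        (([(i, b)] @ w @ [(i, \<not> b)]) @ ([(i, b)] @ concat ws @ [(i, \<not> b)]))"
      by simp
    then have "braid_eq n ([(i, b)] @ concat (w # ws) @ [(i, \<not> b)]) (v @ v')"
      using braid_eq.append[OF v(2,4)] by (rule braid_eq.trans)
    then show ?case using word_products_append[OF v(1,3)] by blast
  qed
qed

lemma conj_word_products:
  assumes "2 \<le> n" "n \<le> 4" "u \<in> braid_words (n - 1)" "x \<in> word_products (last_A_words n)"
  shows "\<exists>v \<in> word_products (last_A_words n). braid_eq n (u @ x @ winv u) v"
  using assms(3)
proof (induction u)
  case Nil
  have "x \<in> braid_words n"
    using assms word_products_words[OF last_A_words_words] by blast
  then show ?case using assms by (intro bexI[of _ x]) (auto intro: braid_eq.refl)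
next
  case (Cons p u)
  obtain i b where p: "p = (i, b)" by (cases p)
  obtain v where v: "v \<in> word_products (last_A_words n)" "braid_eq n (u @ x @ winv u) v"
    using Cons by auto
  have i: "1 \<le> i" "i < n - 1" using Cons p by auto
  obtain v' where v': "v' \<in> word_products (last_A_words n)"
      "braid_eq n ([(i, b)] @ v @ [(i, \<not> b)]) v'"
    using conj_letter_products[OF assms(1,2) i v(1)] by blast
  have "braid_eq n ([(i, b)] @ (u @ x @ winv u) @ [(i, \<not> b)]) ([(i, b)] @ v @ [(i, \<not> b)])"
    using v(2) i by (intro braid_eq_context) auto
  then have "braid_eq n ([(i, b)] @ (u @ x @ winv u) @ [(i, \<not> b)]) v'"
    using v'(2) by (rule braid_eq.trans)
  then show ?case using v'(1) p by auto
qed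

lemma braid_words_mono: "m \<le> n \<Longrightarrow> w \<in> braid_words m \<Longrightarrow> w \<in> braid_words n"
  by (induction w) auto

lemma braid_eq_mono: "braid_eq m u v \<Longrightarrow> m \<le> n \<Longrightarrow> braid_eq n u v"
proof (induction rule: braid_eq.induct)
  case (refl w) then show ?case by (simp add: braid_eq.refl braid_words_mono)
next
  case (sym u v) then show ?case using braid_eq.sym by blast
next
  case (trans u v w) then show ?case using braid_eq.trans by blast
next
  case (append u u' v v') then show ?case by (simp add: braid_eq.append)
next
  case (cancel i b) then show ?case by (simp add: braid_eq.cancel)
next
  case (far i j) then show ?case by (simp add: braid_eq.far)
next
  case (braid i) then show ?case using braid_eq.braid[of i n] by simp
qed

text \<open>Appending a letter p keeps the shape: h u c_k p = h u (h' u' c_{k'}) = h (u h' u^-1) (u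
  u') c_{k'}, where the conjugate of h' is again a product of the A_{i,n} and their
  inverses.\<close>

lemma coset_decomposition:
  assumes "2 \<le> n" "n \<le> 4" "w \<in> braid_words n"
  shows "\<exists>h \<in> word_products (last_A_words n). \<exists>u \<in> braid_words (n - 1). \<exists>k \<in> {1..n}.
    braid_eq n w (h @ u @ coset_word n k)"
  using assms(3)
proof (induction w rule: rev_induct)
  case Nil
  show ?case
    using assms by (intro bexI[of _ "[]"] bexI[of _ n]) (auto simp: coset_word_def braid_eq.refl)
next
  case (snoc p w)
  let ?P = "word_products (last_A_words n)"
  obtain i b where p: "p = (i, b)" by (cases p)
  have i: "1 \<le> i" "i < n" using snoc p by auto
  obtain h u k where 1: "h \<in> ?P" "u \<in> braid_words (n - 1)" "1 \<le> k" "k \<le> n"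
      "braid_eq n w (h @ u @ coset_word n k)"
    using snoc by auto
  obtain h' u' k' where 2: "h' \<in> ?P" "u' \<in> braid_words (n - 1)" "1 \<le> k'" "k' \<le> n"
      "braid_eq n (coset_word n k @ [(i, b)]) (h' @ u' @ coset_word n k')"
    by (rule coset_step[OF assms(1,2) 1(3,4) i]) blast
  obtain v where v: "v \<in> ?P" "braid_eq n (u @ h' @ winv u) v"
    using conj_word_products[OF assms(1,2) 1(2) 2(1)] by blast
  have W: "h \<in> braid_words n" "u \<in> braid_words n" "h' \<in> braid_words n"
      "u' \<in> braid_words n" "coset_word n k' \<in> braid_words n"
    using braid_eq_words[OF 1(5)] braid_eq_words[OF 2(5)] by auto
  have "braid_eq n (w @ [(i, b)]) ((h @ u @ coset_word n k) @ [(i, b)])"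
    using 1(5) i by (intro braid_eq.append braid_eq.refl) auto
  moreover have "braid_eq n ((h @ u) @ (coset_word n k @ [(i, b)])) ((h @ u) @ (h' @ u' @ coset_word n k'))"
    using W by (intro braid_eq.append[OF braid_eq.refl 2(5)]) auto
  moreover have "braid_eq n ((h @ u @ h') @ [] @ (u' @ coset_word n k'))
      ((h @ u @ h') @ (winv u @ u) @ (u' @ coset_word n k'))"
    using braid_eq.sym[OF braid_eq_winv_left[OF W(2)]] W by (intro braid_eq_context) auto
  moreover have "braid_eq n (h @ (u @ h' @ winv u) @ (u @ u' @ coset_word n k'))
      (h @ v @ (u @ u' @ coset_word n k'))"
    using v(2) W by (intro braid_eq_context) auto
  ultimately have "braid_eq n (w @ [(i, b)]) ((h @ v) @ (u @ u') @ coset_word n k')"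
    unfolding append.assoc append_Nil by (blast intro: braid_eq.trans)
  then show ?case
    unfolding p using 1(2) 2(2-4) word_products_append[OF 1(1) v(1)]
    by (intro bexI[of _ "h @ v"] bexI[of _ "u @ u'"] bexI[of _ k']) auto
qed

lemma word_perm_coset_word: "k \<le> n \<Longrightarrow> word_perm (coset_word n k) k = n"
proof (induction n)
  case (Suc n)
  then show ?case
    by (cases "k = Suc n") (auto simp: coset_word_def)
qed (simp add: coset_word_def)

lemma word_perm_products:
  assumes "S \<subseteq> braid_words n" "\<And>w. w \<in> S \<Longrightarrow> word_perm w = id" "w \<in> word_products S"
  shows "word_perm w = id"
proof -
  obtain ws where ws: "w = concat ws" "ws \<in> lists (S \<union> winv ` S)"
    using assms(3) by (auto simp: word_products_def)
  show ?thesis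
    using ws(2) unfolding ws(1)
  proof (induction ws)
    case (Cons v ws)
    have "word_perm v = id" using Cons assms(1,2) word_perm_winv by auto
    then show ?case using Cons by (simp add: word_perm_append)
  qed simp
qed

text \<open>A pure braid leaves nothing of the coset factor: h is pure, u fixes n and c_k sends k to
  n, so k = n. Then u is pure on one strand fewer and the induction applies to it.\<close>

lemma pure_word_product:
  assumes "n \<le> 4" "w \<in> braid_words n" "word_perm w = id"
  shows "\<exists>v \<in> word_products (A_words n). braid_eq n w v"
  using assms
proof (induction n arbitrary: w)
  case 0
  then have "w = []" by (cases w) auto
  then show ?case by (intro bexI[of _ "[]"]) (auto intro: braid_eq.refl)
next
  case (Suc m)
  show ?case
  proof (cases "m = 0")
    case True
    then have "w = []" using Suc by (cases w) auto
    then show ?thesis by (intro bexI[of _ "[]"]) (auto intro: braid_eq.refl)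
  next
    case False
    define n where "n = Suc m"
    have n: "2 \<le> n" "n \<le> 4" "w \<in> braid_words n" using Suc.prems False n_def by auto
    obtain h u k where *: "h \<in> word_products (last_A_words n)" "u \<in> braid_words (n - 1)"
        "1 \<le> k" "k \<le> n" "braid_eq n w (h @ u @ coset_word n k)"
      using coset_decomposition[OF n] by auto
    have h: "word_perm h = id"
      by (rule word_perm_products[OF last_A_words_words _ *(1)])
        (auto simp: last_A_words_def word_perm_A_word)
    have perm: "word_perm u \<circ> word_perm (coset_word n k) = id"
      using word_perm_cong[OF *(5)] h unfolding word_perm_append Suc.prems(3) by simp
    have "word_perm u n = n"
      using word_perm_permutes[OF *(2)] n(1) by (auto simp: permutes_def)
    then have "k = n"
      using fun_cong[OF perm, of k] word_perm_coset_word[OF *(4)] by simp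
    then have c: "coset_word n k = []" by (simp add: coset_word_def)
    have u: "u \<in> braid_words m" "word_perm u = id" using * perm c n_def by auto
    obtain v where v: "v \<in> word_products (A_words m)" "braid_eq m u v"
      using Suc.IH[of u] Suc.prems(1) u by auto
    have "h \<in> braid_words n" using braid_eq_words[OF *(5)] by simp
    then have "braid_eq n (h @ u) (h @ v)"
      using braid_eq_mono[OF v(2), of n] n_def by (intro braid_eq.append braid_eq.refl) auto
    then have "braid_eq n w (h @ v)"
      using *(5) c braid_eq.trans by force
    moreover have "last_A_words n \<subseteq> A_words n" "A_words m \<subseteq> A_words n"
      using n_def by (fastforce simp: last_A_words_def A_words_def)+
    then have "h @ v \<in> word_products (A_words n)"
      using *(1) v(1) word_products_mono by (intro word_products_append) blast+
    ultimately show ?thesis using n_def by blast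
  qed
qed

lemma hom_eq_on_generate:
  assumes "group G" "group H" "f \<in> hom G H" "g \<in> hom G H" "S \<subseteq> carrier G"
    and "\<And>s. s \<in> S \<Longrightarrow> f s = g s" and "x \<in> generate G S"
  shows "f x = g x"
proof -
  interpret f: group_hom G H f using assms by (simp add: group_hom_def group_hom_axioms_def)
  interpret g: group_hom G H g using assms by (simp add: group_hom_def group_hom_axioms_def)
  show ?thesis
    using assms(7)
  proof (induction rule: generate.induct)
    case (inv h)
    then show ?case using assms(5,6) f.hom_inv[of h] g.hom_inv[of h] by auto
  next
    case (eng h1 h2)
    then show ?case using f.G.generate_in_carrier[OF assms(5)] by simp
  qed (use assms in auto)
qed

lemma carrier_pure:
  "carrier (pure_braid_group n) = braid_class n ` {w \<in> braid_words n. word_perm w = id}"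
  by (auto simp: pure_braid_group_def kernel_def carrier_braid_group braid_perm_class sym_group_def)

lemma pure_class_in [simp]:
  "w \<in> braid_words n \<Longrightarrow> word_perm w = id \<Longrightarrow> braid_class n w \<in> carrier (pure_braid_group n)"
  by (auto simp: carrier_pure)

lemma mult_pure_eq: "x \<otimes>\<^bsub>pure_braid_group n\<^esub> y = x \<otimes>\<^bsub>braid_group n\<^esub> y"
  by (simp add: pure_braid_group_def)

lemma one_pure: "\<one>\<^bsub>pure_braid_group n\<^esub> = braid_class n []"
  by (simp add: pure_braid_group_def one_braid_group)

lemma mult_pure:
  "u \<in> braid_words n \<Longrightarrow> v \<in> braid_words n \<Longrightarrow>
    braid_class n u \<otimes>\<^bsub>pure_braid_group n\<^esub> braid_class n v = braid_class n (u @ v)"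
  by (simp add: mult_pure_eq mult_braid_class)

lemma inv_pure:
  assumes "w \<in> braid_words n" "word_perm w = id"
  shows "inv\<^bsub>pure_braid_group n\<^esub> braid_class n w = braid_class n (winv w)"
proof -
  interpret group "pure_braid_group n" by (rule group_pure_braid_group)
  show ?thesis
    using assms word_perm_winv[OF assms(2,1)] braid_eq_winv_left[OF assms(1)]
    by (intro inv_equality) (auto simp: mult_pure one_pure braid_class_eq_iff)
qed

lemma A_elem_less: "i < j \<Longrightarrow> A_elem n i j = braid_class n (A_word i j)"
  by (simp add: A_elem_def)

definition A_gens :: "nat \<Rightarrow> braid_word set set" where
  "A_gens n = {A_elem n i j |i j. 1 \<le> i \<and> i < j \<and> j \<le> n}"

lemma A_gens_subset: "A_gens n \<subseteq> carrier (pure_braid_group n)"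
  by (auto simp: A_gens_def intro!: A_elem_in_pure_braid)

lemma pure_generated:
  assumes "n \<le> 4"
  shows "carrier (pure_braid_group n) = generate (pure_braid_group n) (A_gens n)"
proof
  interpret group "pure_braid_group n" by (rule group_pure_braid_group)
  show "generate (pure_braid_group n) (A_gens n) \<subseteq> carrier (pure_braid_group n)"
    using A_gens_subset by (rule generate_incl)
  have A: "braid_class n w \<in> generate (pure_braid_group n) (A_gens n) \<and> w \<in> braid_words n"
    if w: "w \<in> A_words n \<union> winv ` A_words n" for w
  proof -
    obtain i j where ij: "1 \<le> i" "i < j" "j \<le> n" "w = A_word i j \<or> w = winv (A_word i j)"
    proof -
      obtain w' where w': "w' \<in> A_words n" "w = w' \<or> w = winv w'" using w by blast
      then obtain i j where "w' = A_word i j \<and> 1 \<le> i \<and> i < j \<and> j \<le> n"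
        unfolding A_words_def mem_Collect_eq by metis
      then show thesis using that w'(2) by blast
    qed
    have "A_elem n i j \<in> A_gens n" using ij by (auto simp: A_gens_def)
    then have "braid_class n (A_word i j) \<in> generate (pure_braid_group n) (A_gens n)"
      "inv\<^bsub>pure_braid_group n\<^esub> braid_class n (A_word i j) \<in> generate (pure_braid_group n) (A_gens n)"
      using generate.incl[of "A_elem n i j"] generate.inv[of "A_elem n i j"] A_elem_less[OF ij(2)] by auto
    then show ?thesis
      using ij(4) A_word_words[OF ij(1-3)] inv_pure[OF A_word_words[OF ij(1-3)] word_perm_A_word]
      by auto
  qed
  have "braid_class n (concat ws) \<in> generate (pure_braid_group n) (A_gens n)
      \<and> concat ws \<in> braid_words n"
    if "ws \<in> lists (A_words n \<union> winv ` A_words n)" for ws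
    using that
  proof (induction ws)
    case Nil
    then show ?case using generate.one[of "pure_braid_group n"] by (simp add: one_pure)
  next
    case (Cons w ws)
    then show ?case
      using A[of w] generate.eng[of "braid_class n w" "pure_braid_group n" "A_gens n" "braid_class n (concat ws)"]
      by (simp add: mult_pure)
  qed
  then have *: "braid_class n v \<in> generate (pure_braid_group n) (A_gens n) \<and> v \<in> braid_words n"
    if "v \<in> word_products (A_words n)" for v
    using that by (auto simp: word_products_def)
  show "carrier (pure_braid_group n) \<subseteq> generate (pure_braid_group n) (A_gens n)"
  proof
    fix x assume "x \<in> carrier (pure_braid_group n)"
    then obtain w where w: "x = braid_class n w" "w \<in> braid_words n" "word_perm w = id"
      by (auto simp: carrier_pure)
    obtain v where v: "v \<in> word_products (A_words n)" "braid_eq n w v"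
      using pure_word_product[OF assms w(2,3)] by blast
    have "braid_class n w = braid_class n v"
      using v(2) braid_eq_words[OF v(2)] by (simp add: braid_class_eq_iff)
    then show "x \<in> generate (pure_braid_group n) (A_gens n)"
      using w(1) *[OF v(1)] by simp
  qed
qed

text \<open>This is the uniqueness half of the definite descriptions \<open>strand_removal\<close>
  and \<open>theta\<close>, and it reduces later identities between homomorphisms to
  generators.\<close>

lemma pure_hom_ext:
  assumes "n \<le> 4" "group H" "f \<in> hom (pure_braid_group n) H" "g \<in> hom (pure_braid_group n) H"
    and "\<And>i j. 1 \<le> i \<Longrightarrow> i < j \<Longrightarrow> j \<le> n \<Longrightarrow> f (A_elem n i j) = g (A_elem n i j)"
    and "x \<in> carrier (pure_braid_group n)"
  shows "f x = g x"
proof (rule hom_eq_on_generate[OF group_pure_braid_group assms(2-4) A_gens_subset])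
  show "f s = g s" if "s \<in> A_gens n" for s
    using that assms(5) by (auto simp: A_gens_def)
  show "x \<in> generate (pure_braid_group n) (A_gens n)"
    using assms(6) pure_generated[OF assms(1)] by simp
qed

section \<open>Following a strand\<close>

text \<open>A strand at position k of a braid word read from left to right contributes a word
  \<open>g k p\<close> at each letter p.\<close>

fun cross :: "nat \<Rightarrow> nat \<Rightarrow> nat" where
  "cross i k = (if k = i then Suc i else if k = Suc i then i else k)"

fun track :: "(nat \<Rightarrow> nat \<times> bool \<Rightarrow> braid_word) \<Rightarrow> nat \<Rightarrow> braid_word \<Rightarrow> braid_word" where
  "track g k [] = []"
| "track g k (p # w) = g k p @ track g (cross (fst p) k) w"

fun end_position :: "braid_word \<Rightarrow> nat \<Rightarrow> nat" where
  "end_position [] k = k"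
| "end_position (p # w) k = end_position w (cross (fst p) k)"

lemma track_append: "track g k (u @ v) = track g k u @ track g (end_position u k) v"
  by (induction u arbitrary: k) auto

lemma cross_eq_transpose: "cross i k = Transposition.transpose i (Suc i) k"
  by (auto simp: Transposition.transpose_def)

text \<open>\<open>word_perm\<close> applies the last letter first and \<open>end_position\<close>
  the first letter first, so the two permutations are inverse to each other.\<close>

lemma end_position_word_perm: "end_position w (word_perm w k) = k"
  by (induction w arbitrary: k) (auto simp: cross_eq_transpose simp del: cross.simps)

lemma end_position_id: "word_perm w = id \<Longrightarrow> end_position w k = k"
  using end_position_word_perm[of w k] by simp

lemma end_position_cong:
  assumes "braid_eq n u v"
  shows "end_position u k = end_position v k"
proof -
  have "surj (word_perm u)"
    using word_perm_permutes[of u n] braid_eq_words[OF assms] permutes_surj by blast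
  then obtain m where "k = word_perm u m" by (metis surjD)
  then show ?thesis
    using word_perm_cong[OF assms] end_position_word_perm by metis
qed

lemma end_position_range:
  "w \<in> braid_words n \<Longrightarrow> k \<in> {1..n} \<Longrightarrow> end_position w k \<in> {1..n}"
  by (induction w arbitrary: k) auto

definition braid_relators :: "nat \<Rightarrow> (braid_word \<times> braid_word) list" where
  "braid_relators n =
    [([(i, b), (i, \<not> b)], []). i \<leftarrow> [1..<n], b \<leftarrow> [True, False]] @
    [([(i, True), (j, True)], [(j, True), (i, True)]). i \<leftarrow> [1..<n], j \<leftarrow> [i + 2..<n]] @
    [([(i, True), (i + 1, True), (i, True)], [(i + 1, True), (i, True), (i + 1, True)]). i \<leftarrow> [1..<n - 1]]"

lemma braid_relatorsI:
  "1 \<le> i \<Longrightarrow> i < n \<Longrightarrow> ([(i, b), (i, \<not> b)], []) \<in> set (braid_relators n)"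
  "1 \<le> i \<Longrightarrow> i + 2 \<le> j \<Longrightarrow> j < n \<Longrightarrow>
    ([(i, True), (j, True)], [(j, True), (i, True)]) \<in> set (braid_relators n)"
  "1 \<le> i \<Longrightarrow> i + 1 < n \<Longrightarrow>
    ([(i, True), (i + 1, True), (i, True)], [(i + 1, True), (i, True), (i + 1, True)])
      \<in> set (braid_relators n)"
  by (cases b; auto simp: braid_relators_def image_iff)+

text \<open>\<open>track\<close> is multiplicative up to a change of starting position, so
  compatibility with \<open>braid_eq\<close> follows from the defining relations read from every
  starting position. This is the executable form of that condition.\<close>

definition track_test :: "nat \<Rightarrow> nat \<Rightarrow> (nat \<Rightarrow> nat \<times> bool \<Rightarrow> braid_word) \<Rightarrow> bool" where
  "track_test n m g \<longleftrightarrow> list_all (\<lambda>k.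
     list_all (\<lambda>i. list_all (\<lambda>b. list_all (\<lambda>(j, c). 1 \<le> j \<and> j < m) (g k (i, b))) [True, False]) [1..<n]
     \<and> list_all (\<lambda>(u, v). braid_test m (track g k u) (track g k v)) (braid_relators n)) [1..<Suc n]"

lemma track_test_letter:
  assumes "track_test n m g" "1 \<le> k" "k \<le> n" "1 \<le> i" "i < n"
  shows "g k (i, b) \<in> braid_words m"
proof -
  have "1 \<le> k \<and> k < Suc n" using assms by simp
  then have "list_all (\<lambda>b. list_all (\<lambda>(j, c). 1 \<le> j \<and> j < m) (g k (i, b))) [True, False]"
    using assms(1,4,5) unfolding track_test_def list_all_upt by blast
  then show ?thesis by (cases b) (simp_all add: braid_words_list_all)
qed

lemma track_words:
  assumes "track_test n m g" "w \<in> braid_words n" "k \<in> {1..n}"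
  shows "track g k w \<in> braid_words m"
  using assms(2,3)
proof (induction w arbitrary: k)
  case (Cons p w)
  obtain i b where "p = (i, b)" by (cases p)
  then show ?case using Cons track_test_letter[OF assms(1), of k i b] by auto
qed simp

lemma track_cong:
  assumes g: "track_test n m g" and "braid_eq n u v" "k \<in> {1..n}"
  shows "braid_eq m (track g k u) (track g k v)"
proof -
  have rel: "braid_eq m (track g k u) (track g k v)"
    if "(u, v) \<in> set (braid_relators n)" "k \<in> {1..n}" for u v k
  proof -
    have "1 \<le> k \<and> k < Suc n" using that(2) by simp
    then have "list_all (\<lambda>(u, v). braid_test m (track g k u) (track g k v)) (braid_relators n)"
      using g unfolding track_test_def list_all_upt by blast
    then have "braid_test m (track g k u) (track g k v)"
      using that(1) unfolding list_all_iff by blast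
    then show ?thesis by (rule braid_test_sound)
  qed
  show ?thesis
    using assms(2,3)
  proof (induction arbitrary: k rule: braid_eq.induct)
    case (refl w)
    then show ?case using track_words[OF g] by (simp add: braid_eq.refl)
  next
    case (sym u v)
    show ?case by (rule braid_eq.sym[OF sym.IH[OF sym.prems]])
  next
    case (trans u v w)
    show ?case by (rule braid_eq.trans[OF trans.IH(1)[OF trans.prems] trans.IH(2)[OF trans.prems]])
  next
    case (append u u' v v')
    have "end_position u k \<in> {1..n}"
      using end_position_range append.prems braid_eq_words[OF append.hyps(1)] by blast
    then show ?case
      unfolding track_append end_position_cong[OF append.hyps(1), symmetric]
      by (intro braid_eq.append append.IH append.prems)
  next
    case (cancel i b)
    show ?case by (rule rel[OF braid_relatorsI(1)[OF cancel.hyps] cancel.prems])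
  next
    case (far i j)
    show ?case by (rule rel[OF braid_relatorsI(2)[OF far.hyps] far.prems])
  next
    case (braid i)
    show ?case by (rule rel[OF braid_relatorsI(3)[OF braid.hyps] braid.prems])
  qed
qed

definition track_map ::
  "nat \<Rightarrow> nat \<Rightarrow> (nat \<Rightarrow> nat \<times> bool \<Rightarrow> braid_word) \<Rightarrow> nat \<Rightarrow> braid_word set \<Rightarrow> braid_word set" where
  "track_map n m g k =
    (\<lambda>x\<in>carrier (pure_braid_group n). braid_class m (track g k (SOME w. w \<in> x)))"

lemma track_map_class:
  assumes "track_test n m g" "k \<in> {1..n}" "w \<in> braid_words n" "word_perm w = id"
  shows "track_map n m g k (braid_class n w) = braid_class m (track g k w)"
proof -
  have "w \<in> braid_class n w" using assms by (simp add: mem_braid_class braid_eq.refl)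
  then have "(SOME v. v \<in> braid_class n w) \<in> braid_class n w" by (rule someI)
  then have e: "braid_eq n w (SOME v. v \<in> braid_class n w)" by (simp add: mem_braid_class)
  have "braid_eq m (track g k w) (track g k (SOME v. v \<in> braid_class n w))"
    by (rule track_cong[OF assms(1) e assms(2)])
  from this braid_eq_words[OF this]
  have "braid_class m (track g k (SOME v. v \<in> braid_class n w)) = braid_class m (track g k w)"
    by (metis braid_class_eq_iff)
  then show ?thesis using assms by (simp add: track_map_def)
qed

text \<open>A pure braid brings the tracked strand back to position k, so the second factor is again
  read from k and the contributions concatenate. Purity of the values is added afterwards by
  \<open>hom_into_pure\<close>, on generators.\<close>

lemma track_map_hom:
  assumes g: "track_test n m g" "k \<in> {1..n}"
  shows "track_map n m g k \<in> hom (pure_braid_group n) (braid_group m)"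
proof (rule homI)
  fix x assume "x \<in> carrier (pure_braid_group n)"
  then obtain u where u: "x = braid_class n u" "u \<in> braid_words n" "word_perm u = id"
    by (auto simp: carrier_pure)
  show "track_map n m g k x \<in> carrier (braid_group m)"
    using u track_words[OF g(1)] g(2) by (simp add: track_map_class[OF g])
  fix y assume "y \<in> carrier (pure_braid_group n)"
  then obtain v where v: "y = braid_class n v" "v \<in> braid_words n" "word_perm v = id"
    by (auto simp: carrier_pure)
  show "track_map n m g k (x \<otimes>\<^bsub>pure_braid_group n\<^esub> y)
      = track_map n m g k x \<otimes>\<^bsub>braid_group m\<^esub> track_map n m g k y"
    using u v track_words[OF g(1)] g(2)
    by (simp add: mult_pure track_map_class[OF g] word_perm_append mult_braid_class track_append end_position_id)
qed

lemma hom_into_pure: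
  assumes "n \<le> 4" "f \<in> hom (pure_braid_group n) (braid_group m)"
    and "\<And>i j. 1 \<le> i \<Longrightarrow> i < j \<Longrightarrow> j \<le> n \<Longrightarrow> f (A_elem n i j) \<in> carrier (pure_braid_group m)"
  shows "f \<in> hom (pure_braid_group n) (pure_braid_group m)"
proof -
  interpret group_hom "pure_braid_group n" "braid_group m" f
    using assms group_pure_braid_group group_braid_group by (simp add: group_hom_def group_hom_axioms_def)
  interpret P: subgroup "carrier (pure_braid_group m)" "braid_group m"
    using subgroup_pure_braid[of m] by (simp add: pure_braid_group_def)
  have "f x \<in> carrier (pure_braid_group m)" if "x \<in> generate (pure_braid_group n) (A_gens n)" for x
    using that
  proof (induction rule: generate.induct)
    case one then show ?case using P.one_closed by simp
  next
    case (incl h) then show ?case using assms(3) by (auto simp: A_gens_def)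
  next
    case (inv h)
    then have "h \<in> carrier (pure_braid_group n)" "f h \<in> carrier (pure_braid_group m)"
      using assms(3) A_gens_subset by (auto simp: A_gens_def intro!: A_elem_in_pure_braid)
    then show ?case by simp
  next
    case (eng h1 h2)
    then show ?case using G.generate_in_carrier[OF A_gens_subset] by simp
  qed
  then show ?thesis
    using assms(2) pure_generated[OF assms(1)] by (auto simp: hom_def mult_pure_eq Pi_def)
qed

section \<open>Strand removal on braid words\<close>

definition removal_letter :: "nat \<Rightarrow> nat \<times> bool \<Rightarrow> braid_word" where
  "removal_letter k = (\<lambda>(i, b).
    if k = i \<or> k = Suc i then [] else [(if k < i then i - 1 else i, b)])"

lemma removal_track_test:
  assumes "n \<in> {3, 4}"
  shows "track_test n (n - 1) removal_letter"
proof -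
  have "list_all (\<lambda>n. track_test n (n - 1) removal_letter) [3..<5]" by code_simp
  moreover have "3 \<le> n" "n < 5" using assms by auto
  ultimately show ?thesis unfolding list_all_upt by blast
qed

lemma removal_A_test:
  "list_all (\<lambda>n. list_all (\<lambda>k. list_all (\<lambda>j. list_all (\<lambda>i.
     braid_test (n - 1) (track removal_letter k (A_word i j))
       (if k \<in> {i, j} then [] else A_word (if k < i then i - 1 else i) (if k < j then j - 1 else j)))
     [1..<j]) [1..<Suc n]) [1..<Suc n]) [3..<5]"
  by code_simp

text \<open>The tracked map has the prescribed values on generators by computation, which gives
  existence; uniqueness is \<open>pure_hom_ext\<close>. From here on strand removal can be evaluated
  on words.\<close>

lemma strand_removal_eq:
  assumes n: "n \<in> {3, 4}" and k: "1 \<le> k" "k \<le> n"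
  shows "strand_removal n k = track_map n (n - 1) removal_letter k"
    and "track_map n (n - 1) removal_letter k \<in> hom (pure_braid_group n) (pure_braid_group (n - 1))"
proof -
  let ?f = "track_map n (n - 1) removal_letter k"
  have n4: "3 \<le> n" "n \<le> 4" using n by auto
  have t: "track_test n (n - 1) removal_letter"
    using n by (rule removal_track_test)
  have k': "k \<in> {1..n}" using k by auto
  have val: "?f (A_elem n i j) =
      (if k \<in> {i, j} then \<one>\<^bsub>pure_braid_group (n - 1)\<^esub>
       else A_elem (n - 1) (if k < i then i - 1 else i) (if k < j then j - 1 else j))"
    if ij: "1 \<le> i" "i < j" "j \<le> n" for i j
  proof -
    let ?i = "if k < i then i - 1 else i" and ?j = "if k < j then j - 1 else j"
    have "braid_test (n - 1) (track removal_letter k (A_word i j))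
       (if k \<in> {i, j} then [] else A_word ?i ?j)"
      using removal_A_test n4 k ij unfolding list_all_upt less_Suc_eq_le by auto
    from braid_test_sound[OF this] have e: "braid_class (n - 1) (track removal_letter k (A_word i j))
        = braid_class (n - 1) (if k \<in> {i, j} then [] else A_word ?i ?j)"
      using braid_eq_words braid_class_eq_iff by blast
    have "?f (A_elem n i j) = braid_class (n - 1) (track removal_letter k (A_word i j))"
      using track_map_class[OF t k' A_word_words[OF ij] word_perm_A_word] A_elem_less[OF ij(2)] by simp
    then show ?thesis
      using e ij by (auto simp: one_pure A_elem_less)
  qed
  show hom: "?f \<in> hom (pure_braid_group n) (pure_braid_group (n - 1))"
  proof (rule hom_into_pure[OF n4(2) track_map_hom[OF t k']])
    fix i j assume ij: "1 \<le> i" "i < j" "j \<le> n"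
    show "?f (A_elem n i j) \<in> carrier (pure_braid_group (n - 1))"
      unfolding val[OF ij] using ij k
      by (auto intro!: A_elem_in_pure_braid monoid.one_closed group.is_monoid group_pure_braid_group)
  qed
  show "strand_removal n k = ?f"
    unfolding strand_removal_def
  proof (rule the_equality, intro conjI allI impI)
    show "?f \<in> extensional (carrier (pure_braid_group n))" by (simp add: track_map_def)
    fix f assume f: "f \<in> hom (pure_braid_group n) (pure_braid_group (n - 1)) \<and>
       f \<in> extensional (carrier (pure_braid_group n)) \<and>
       (\<forall>i j. 1 \<le> i \<and> i < j \<and> j \<le> n \<longrightarrow>
        f (A_elem n i j) =
          (if k \<in> {i, j} then \<one>\<^bsub>pure_braid_group (n - 1)\<^esub>
           else A_elem (n - 1) (if k < i then i - 1 else i) (if k < j then j - 1 else j)))"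
    show "f = ?f"
    proof (rule extensionalityI[of _ "carrier (pure_braid_group n)"])
      show "f x = ?f x" if "x \<in> carrier (pure_braid_group n)" for x
        by (rule pure_hom_ext[OF n4(2) group_pure_braid_group _ hom _ that]) (use f val in auto)
    qed (use f in \<open>auto simp: track_map_def\<close>)
  qed (use hom val in auto)
qed

text \<open>The letter \<open>\<sigma>\<^sub>1\<^sup>2\<close> and \<open>\<sigma>\<^sub>2, \<dots>, \<sigma>\<^sub>n\<^sub>-\<^sub>1\<close> generate the braids
  fixing the first position, with the relations of the Artin group of type B. Replacing \<open>\<sigma>\<^sub>1\<^sup>2\<close>
  by t gives an endomorphism of that group, evaluated here with coset representatives
  \<open>\<sigma>\<^sub>1 \<dots> \<sigma>\<^sub>k\<^sub>-\<^sub>1\<close>.\<close>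

definition substitute_letter :: "braid_word \<Rightarrow> nat \<Rightarrow> nat \<times> bool \<Rightarrow> braid_word" where
  "substitute_letter t k = (\<lambda>(i, b).
    let s = map (\<lambda>m. (m, True)) [2..<Suc i]; d = winv s @ t @ s in
    if k = i then (if b then [] else winv d)
    else if k = Suc i then (if b then d else [])
    else [(if k < i then i else Suc i, b)])"

text \<open>With \<open>Y = A\<^sub>2\<^sub>,\<^sub>3 \<dots> A\<^sub>2\<^sub>,\<^sub>n\<close>, theta maps \<open>\<sigma>\<^sub>1\<^sup>2\<close> to
  \<open>(Y \<sigma>\<^sub>1\<^sup>2)\<^sup>-\<^sup>1\<close>, and its inverse maps \<open>\<sigma>\<^sub>1\<^sup>2\<close> to \<open>(\<sigma>\<^sub>1\<^sup>2 Y)\<^sup>-\<^sup>1\<close>.\<close>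

definition theta_letter :: "nat \<Rightarrow> bool \<Rightarrow> nat \<Rightarrow> nat \<times> bool \<Rightarrow> braid_word" where
  "theta_letter n c =
    (let y = map (\<lambda>m. (m, True)) ([2..<n] @ rev [2..<n]); t = [(1, True), (1, True)]
     in substitute_letter (winv (if c then y @ t else t @ y)))"

definition A_row_word :: "nat \<Rightarrow> nat \<Rightarrow> braid_word" where
  "A_row_word n j = concat (map (\<lambda>i. if i < j then A_word i j else if j < i then A_word j i else [])
     [1..<n + 1])"

lemma theta_track_test:
  assumes "n \<in> {3, 4}"
  shows "track_test n n (theta_letter n c)"
proof -
  have "list_all (\<lambda>n. list_all (\<lambda>c. track_test n n (theta_letter n c)) [True, False]) [3..<5]"
    by code_simp
  moreover have "3 \<le> n" "n < 5" using assms by auto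
  ultimately show ?thesis unfolding list_all_upt by (cases c) simp_all
qed

lemma theta_A_test:
  "list_all (\<lambda>n. list_all (\<lambda>j. list_all (\<lambda>i.
     braid_test n (track (theta_letter n True) 1 (A_word i j))
       (if i = 1 then winv (A_word 1 j) @ winv (A_row_word n j) @ A_word 1 j else A_word i j))
     [1..<j]) [1..<Suc n]) [3..<5]"
  by code_simp

lemma theta_inverse_test:
  "list_all (\<lambda>n. list_all (\<lambda>c. list_all (\<lambda>j. list_all (\<lambda>i.
     braid_test n (track (theta_letter n c) 1 (track (theta_letter n (\<not> c)) 1 (A_word i j))) (A_word i j))
     [1..<j]) [1..<Suc n]) [True, False]) [3..<5]"
  by code_simp

lemma A_row_word_props:
  assumes "1 \<le> j" "j \<le> n"
  shows "A_row_word n j \<in> braid_words n" "word_perm (A_row_word n j) = id"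
    "A0_elem n j = braid_class n (winv (A_row_word n j))"
proof -
  let ?a = "\<lambda>i. if i < j then A_word i j else if j < i then A_word j i else []"
  have *: "concat (map ?a is) \<in> braid_words n \<and> word_perm (concat (map ?a is)) = id \<and>
      foldr (\<lambda>i x. A_elem n i j \<otimes>\<^bsub>pure_braid_group n\<^esub> x) is \<one>\<^bsub>pure_braid_group n\<^esub>
        = braid_class n (concat (map ?a is))"
    if "set is \<subseteq> {1..n}" for "is"
    using that
  proof (induction "is")
    case (Cons i "is")
    have i: "?a i \<in> braid_words n" "word_perm (?a i) = id" "A_elem n i j = braid_class n (?a i)"
      using Cons.prems assms by (auto simp: A_word_words word_perm_A_word A_elem_def one_pure)
    have IH: "concat (map ?a is) \<in> braid_words n" "word_perm (concat (map ?a is)) = id"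
      "foldr (\<lambda>i x. A_elem n i j \<otimes>\<^bsub>pure_braid_group n\<^esub> x) is \<one>\<^bsub>pure_braid_group n\<^esub>
        = braid_class n (concat (map ?a is))"
      using Cons.IH Cons.prems by auto
    have "A_elem n i j \<otimes>\<^bsub>pure_braid_group n\<^esub> braid_class n (concat (map ?a is))
        = braid_class n (?a i @ concat (map ?a is))"
      unfolding i(3) by (rule mult_pure[OF i(1) IH(1)])
    then show ?case
      using i(1,2) IH by (simp add: word_perm_append)
  qed (simp add: one_pure)
  have set: "set [1..<n + 1] \<subseteq> {1..n}" by auto
  show 1: "A_row_word n j \<in> braid_words n" "word_perm (A_row_word n j) = id"
    unfolding A_row_word_def using *[OF set] by blast+
  show "A0_elem n j = braid_class n (winv (A_row_word n j))"
    using *[OF set] inv_pure[OF 1] unfolding A0_elem_def A_row_word_def by simp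
qed

lemma pure_braid_word_cases:
  assumes "x \<in> carrier (pure_braid_group n)"
  obtains w where "w \<in> braid_words n" "word_perm w = id" "x = braid_class n w"
  using assms by (auto simp: carrier_pure)

lemma word_perm_track:
  assumes "track_map n m g k \<in> hom (pure_braid_group n) (pure_braid_group m)"
    "track_test n m g" "k \<in> {1..n}" "w \<in> braid_words n" "word_perm w = id"
  shows "word_perm (track g k w) = id"
proof -
  have "braid_class m (track g k w) \<in> carrier (pure_braid_group m)"
    using hom_in_carrier[OF assms(1), of "braid_class n w"] track_map_class[OF assms(2-5)] assms(4,5) by simp
  then obtain v where v: "v \<in> braid_words m" "word_perm v = id" "braid_class m (track g k w) = braid_class m v"
    by (rule pure_braid_word_cases)
  have "braid_eq m (track g k w) v"
    using v braid_class_eq_iff[OF track_words[OF assms(2,4,3)] v(1)] by simp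
  then show ?thesis using word_perm_cong v(2) by metis
qed

text \<open>This makes purity a finite computation: \<open>end_position\<close> inverts
  \<open>word_perm\<close>, and letters below n move no position outside 1 to n.\<close>

lemma word_perm_eq_id:
  assumes "w \<in> braid_words n" "\<And>k. 1 \<le> k \<Longrightarrow> k \<le> n \<Longrightarrow> end_position w k = k"
  shows "word_perm w = id"
proof
  fix k
  have p: "word_perm w permutes {1..n}" using assms(1) by (rule word_perm_permutes)
  show "word_perm w k = id k"
  proof (cases "k \<in> {1..n}")
    case True
    then have "word_perm w k \<in> {1..n}" using permutes_in_image[OF p] by blast
    then have "end_position w (word_perm w k) = word_perm w k" using assms(2) by simp
    then show ?thesis unfolding end_position_word_perm by simp
  next
    case False
    then show ?thesis using permutes_not_in[OF p] by simp
  qed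
qed

lemma theta_pure_test:
  "list_all (\<lambda>n. list_all (\<lambda>c. list_all (\<lambda>j. list_all (\<lambda>i. list_all (\<lambda>k.
     end_position (track (theta_letter n c) 1 (A_word i j)) k = k)
     [1..<Suc n]) [1..<j]) [1..<Suc n]) [True, False]) [3..<5]"
  by code_simp

text \<open>Tracking the first strand with the letters for \<open>True\<close> realizes the
  prescribed values. The letters for \<open>False\<close> give the inverse substitution; that both
  composites fix the generators yields bijectivity.\<close>

lemma theta_eq:
  assumes n: "n \<in> {3, 4}"
  shows "theta n = track_map n n (theta_letter n True) 1"
    and "track_map n n (theta_letter n True) 1 \<in> auto (pure_braid_group n)"
proof -
  let ?P = "pure_braid_group n"
  let ?f = "\<lambda>c. track_map n n (theta_letter n c) 1"
  interpret P: group ?P by (rule group_pure_braid_group)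
  have n4: "3 \<le> n" "n \<le> 4" and one: "1 \<in> {1..n}" using n by auto
  have t: "track_test n n (theta_letter n c)" for c
    using n by (rule theta_track_test)
  have cls: "?f c (A_elem n i j) = braid_class n (track (theta_letter n c) 1 (A_word i j))"
    if "1 \<le> i" "i < j" "j \<le> n" for c i j
    using track_map_class[OF t one A_word_words[OF that] word_perm_A_word] A_elem_less[OF that(2)] by simp
  have val: "?f True (A_elem n i j) =
      (if i = 1 then inv\<^bsub>?P\<^esub> (A_elem n 1 j) \<otimes>\<^bsub>?P\<^esub> A0_elem n j \<otimes>\<^bsub>?P\<^esub> A_elem n 1 j
       else A_elem n i j)"
    if ij: "1 \<le> i" "i < j" "j \<le> n" for i j
  proof -
    let ?v = "if i = 1 then winv (A_word 1 j) @ winv (A_row_word n j) @ A_word 1 j else A_word i j"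
    have "braid_test n (track (theta_letter n True) 1 (A_word i j)) ?v"
      using theta_A_test n4 ij unfolding list_all_upt less_Suc_eq_le by simp
    from braid_test_sound[OF this] have "?f True (A_elem n i j) = braid_class n ?v"
      unfolding cls[OF ij] using braid_eq_words braid_class_eq_iff by blast
    moreover have "inv\<^bsub>?P\<^esub> (A_elem n 1 j) \<otimes>\<^bsub>?P\<^esub> A0_elem n j \<otimes>\<^bsub>?P\<^esub> A_elem n 1 j
        = braid_class n (winv (A_word 1 j) @ winv (A_row_word n j) @ A_word 1 j)"
      using ij A_row_word_props[of j n] A_word_words[of 1 j n]
      by (simp add: A_elem_less inv_pure word_perm_A_word mult_pure)
    ultimately show ?thesis using ij by (simp add: A_elem_less)
  qed
  have pure_val: "?f c (A_elem n i j) \<in> carrier ?P" if ij: "1 \<le> i" "i < j" "j \<le> n" for c i j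
  proof -
    have "end_position (track (theta_letter n c) 1 (A_word i j)) k = k" if "1 \<le> k" "k \<le> n" for k
      using theta_pure_test n4 ij that unfolding list_all_upt less_Suc_eq_le by (cases c) auto
    then have "word_perm (track (theta_letter n c) 1 (A_word i j)) = id"
      using word_perm_eq_id track_words[OF t A_word_words[OF ij] one] by blast
    then show ?thesis
      unfolding cls[OF ij] using track_words[OF t A_word_words[OF ij] one] by simp
  qed
  have hom: "?f c \<in> hom ?P ?P" for c
    by (rule hom_into_pure[OF n4(2) track_map_hom[OF t one] pure_val])
  have inv: "?f c (?f (\<not> c) x) = x" if x: "x \<in> carrier ?P" for c x
  proof -
    have "(?f c \<circ> ?f (\<not> c)) x = id x"
    proof (rule pure_hom_ext[OF n4(2) P.is_group _ _ _ x])
      show "?f c \<circ> ?f (\<not> c) \<in> hom ?P ?P" using hom hom by (rule hom_compose)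
      show "id \<in> hom ?P ?P" by (simp add: hom_def)
      fix i j assume ij: "1 \<le> i" "i < j" "j \<le> n"
      let ?w = "track (theta_letter n (\<not> c)) 1 (A_word i j)"
      have w: "?w \<in> braid_words n" "word_perm ?w = id"
        using track_words[OF t A_word_words[OF ij] one]
          word_perm_track[OF hom t one A_word_words[OF ij] word_perm_A_word] by auto
      have "braid_test n (track (theta_letter n c) 1 ?w) (A_word i j)"
        using theta_inverse_test n4 ij unfolding list_all_upt less_Suc_eq_le by (cases c) auto
      from braid_test_sound[OF this]
      have "braid_class n (track (theta_letter n c) 1 ?w) = braid_class n (A_word i j)"
        using braid_eq_words braid_class_eq_iff by blast
      then show "(?f c \<circ> ?f (\<not> c)) (A_elem n i j) = id (A_elem n i j)"
        using cls[OF ij] track_map_class[OF t one w] ij by (simp add: A_elem_less)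
    qed
    then show ?thesis by simp
  qed
  have "bij_betw (?f True) (carrier ?P) (carrier ?P)"
    by (rule bij_betw_byWitness[where f' = "?f False"])
      (use inv[of _ True] inv[of _ False] hom[of True] hom[of False] in \<open>auto simp: hom_def\<close>)
  then show auto: "?f True \<in> auto ?P"
    using hom by (simp add: auto_def Bij_def track_map_def)
  show "theta n = ?f True"
    unfolding theta_def
  proof (rule the_equality, intro conjI allI impI)
    fix f assume f: "f \<in> auto ?P \<and>
     (\<forall>i j. 2 \<le> i \<and> i < j \<and> j \<le> n \<longrightarrow> f (A_elem n i j) = A_elem n i j) \<and>
     (\<forall>j. 2 \<le> j \<and> j \<le> n \<longrightarrow>
        f (A_elem n 1 j) =
          inv\<^bsub>?P\<^esub> (A_elem n 1 j) \<otimes>\<^bsub>?P\<^esub> A0_elem n j \<otimes>\<^bsub>?P\<^esub> A_elem n 1 j)"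
    show "f = ?f True"
    proof (rule extensionalityI[of _ "carrier ?P"])
      show "f x = ?f True x" if x: "x \<in> carrier ?P" for x
      proof (rule pure_hom_ext[OF n4(2) P.is_group _ hom _ x])
        show "f \<in> hom ?P ?P" using f by (simp add: auto_def)
        fix i j assume ij: "1 \<le> i" "i < j" "j \<le> n"
        show "f (A_elem n i j) = ?f True (A_elem n i j)"
        proof (cases "i = 1")
          case True
          then show ?thesis using f val[OF ij] ij by simp
        next
          case False
          then have "2 \<le> i" using ij by simp
          then show ?thesis using f val[OF ij] ij by simp
        qed
      qed
    qed (use f in \<open>auto simp: track_map_def auto_def Bij_def\<close>)
  qed (use auto val in auto)
qed

lemma strand_removal_hom:
  "n \<in> {3, 4} \<Longrightarrow> 1 \<le> k \<Longrightarrow> k \<le> n \<Longrightarrow>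
    strand_removal n k \<in> hom (pure_braid_group n) (pure_braid_group (n - 1))"
  using strand_removal_eq by simp

lemma strand_removal_class:
  assumes n: "n \<in> {3, 4}" and k: "1 \<le> k" "k \<le> n" and w: "w \<in> braid_words n" "word_perm w = id"
  shows "strand_removal n k (braid_class n w) = braid_class (n - 1) (track removal_letter k w)"
proof -
  show ?thesis
    unfolding strand_removal_eq(1)[OF n k]
    using removal_track_test[OF n] k w by (intro track_map_class) auto
qed

lemma bdry_hom:
  assumes n: "n \<in> {3, 4}"
  shows "bdry n \<in> hom (pure_braid_group n) (pure_braid_group (n - 1))"
proof -
  have "theta n \<in> hom (pure_braid_group n) (pure_braid_group n)"
    using theta_eq[OF n] by (simp add: auto_def)
  moreover have "strand_removal n 1 \<in> hom (pure_braid_group n) (pure_braid_group (n - 1))"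
    using strand_removal_hom[OF n] n by auto
  ultimately show ?thesis
    unfolding bdry_def by (rule group.hom_compose[OF group_pure_braid_group])
qed

lemma bdry_class:
  assumes n: "n \<in> {3, 4}" and w: "w \<in> braid_words n" "word_perm w = id"
  shows "bdry n (braid_class n w)
    = braid_class (n - 1) (track removal_letter 1 (track (theta_letter n True) 1 w))"
proof -
  have t: "track_test n n (theta_letter n True)"
    using n by (rule theta_track_test)
  have one: "1 \<in> {1..n}" "1 \<le> n" using n by auto
  have hom: "track_map n n (theta_letter n True) 1 \<in> hom (pure_braid_group n) (pure_braid_group n)"
    using theta_eq(2)[OF n] by (simp add: auto_def)
  have v: "track (theta_letter n True) 1 w \<in> braid_words n"
    "word_perm (track (theta_letter n True) 1 w) = id"
    using track_words[OF t w(1) one(1)] word_perm_track[OF hom t one(1) w] by auto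
  have "bdry n (braid_class n w) = strand_removal n 1 (theta n (braid_class n w))"
    using w by (simp add: bdry_def compose_def)
  then show ?thesis
    unfolding theta_eq(1)[OF n] track_map_class[OF t one(1) w]
    using strand_removal_class[OF n order.refl one(2) v] by simp
qed

section \<open>Linking numbers\<close>

definition exponent_sum :: "braid_word \<Rightarrow> int" where
  "exponent_sum w = (\<Sum>(i, b)\<leftarrow>w. if b then 1 else - 1)"

lemma exponent_sum_simps [simp]:
  "exponent_sum [] = 0"
  "exponent_sum ((i, b) # w) = (if b then 1 else - 1) + exponent_sum w"
  "exponent_sum (u @ v) = exponent_sum u + exponent_sum v"
  by (auto simp: exponent_sum_def)

lemma exponent_sum_cong: "braid_eq n u v \<Longrightarrow> exponent_sum u = exponent_sum v"
  by (induction rule: braid_eq.induct) auto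

definition braid_degree :: "braid_word set \<Rightarrow> int" where
  "braid_degree x = exponent_sum (SOME w. w \<in> x)"

lemma braid_degree_class:
  assumes "w \<in> braid_words n"
  shows "braid_degree (braid_class n w) = exponent_sum w"
proof -
  have "w \<in> braid_class n w" using assms by (simp add: mem_braid_class braid_eq.refl)
  then have "(SOME v. v \<in> braid_class n w) \<in> braid_class n w" by (rule someI)
  then show ?thesis unfolding braid_degree_def mem_braid_class by (metis exponent_sum_cong)
qed

lemma braid_degree_hom: "braid_degree \<in> hom (pure_braid_group n) integer_group"
proof (rule homI)
  fix x y assume "x \<in> carrier (pure_braid_group n)" "y \<in> carrier (pure_braid_group n)"
  then obtain u v where "x = braid_class n u" "u \<in> braid_words n" "y = braid_class n v" "v \<in> braid_words n"
    by (auto simp: carrier_pure)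
  then show "braid_degree (x \<otimes>\<^bsub>pure_braid_group n\<^esub> y)
      = braid_degree x \<otimes>\<^bsub>integer_group\<^esub> braid_degree y"
    by (simp add: mult_pure braid_degree_class)
qed simp

text \<open>P_2 consists of the powers of A_{1,2}, whose exponent sum is 2. So P_2 embeds in the
  integers.\<close>

lemma braid_degree_eq_0:
  assumes "x \<in> carrier (pure_braid_group 2)" "braid_degree x = 0"
  shows "x = \<one>\<^bsub>pure_braid_group 2\<^esub>"
proof -
  interpret G: group_hom "pure_braid_group 2" integer_group braid_degree
    using group_pure_braid_group braid_degree_hom by (simp add: group_hom_def group_hom_axioms_def)
  let ?a = "A_elem 2 1 2"
  have a: "?a \<in> carrier (pure_braid_group 2)" by (rule A_elem_in_pure_braid) auto
  have "A_gens 2 \<subseteq> {?a}"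
  proof
    fix y assume "y \<in> A_gens 2"
    then obtain i j where ij: "1 \<le> i" "i < j" "j \<le> 2" "y = A_elem 2 i j" by (auto simp: A_gens_def)
    then have "i = 1 \<and> j = 2" by linarith
    then show "y \<in> {?a}" using ij(4) by blast
  qed
  then have "generate (pure_braid_group 2) (A_gens 2) \<subseteq> generate (pure_braid_group 2) {?a}"
    by (rule group.mono_generate[OF group_pure_braid_group])
  moreover have "carrier (pure_braid_group 2) = generate (pure_braid_group 2) (A_gens 2)"
    by (rule pure_generated) simp
  ultimately have "x \<in> generate (pure_braid_group 2) {?a}" using assms(1) by blast
  then obtain k :: int where k: "x = ?a [^]\<^bsub>pure_braid_group 2\<^esub> k"
    using group.generate_pow[OF group_pure_braid_group a] by auto
  have "braid_degree ?a = 2"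
    using braid_degree_class[OF A_word_words[of 1 2 2]] by (simp add: A_elem_less A_word_def)
  then have "braid_degree x = 2 * k"
    unfolding k using G.hom_int_pow[OF a] by simp
  then show ?thesis using assms(2) k by simp
qed

text \<open>Twice the linking number of the two strands other than k.\<close>

definition linking3 :: "nat \<Rightarrow> braid_word set \<Rightarrow> int" where
  "linking3 k = braid_degree \<circ> strand_removal 3 k"

text \<open>It is used for k < l: the larger index is removed first so that strand k keeps its
  number, and the value is twice the linking number of the two remaining strands.\<close>

definition linking4 :: "nat \<Rightarrow> nat \<Rightarrow> braid_word set \<Rightarrow> int" where
  "linking4 k l = linking3 k \<circ> strand_removal 4 l"

lemma linking3_hom: "1 \<le> k \<Longrightarrow> k \<le> 3 \<Longrightarrow> linking3 k \<in> hom (pure_braid_group 3) integer_group"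
  unfolding linking3_def using strand_removal_hom[of 3 k] braid_degree_hom
  by (intro Group.hom_compose[of _ _ "pure_braid_group 2"]) auto

lemma linking4_hom:
  "1 \<le> k \<Longrightarrow> k < l \<Longrightarrow> l \<le> 4 \<Longrightarrow> linking4 k l \<in> hom (pure_braid_group 4) integer_group"
  unfolding linking4_def using strand_removal_hom[of 4 l] linking3_hom[of k]
  by (intro Group.hom_compose[of _ _ "pure_braid_group 3"]) auto

lemma strand_removal_pure_word:
  assumes n: "n \<in> {3, 4}" and k: "1 \<le> k" "k \<le> n" and w: "w \<in> braid_words n" "word_perm w = id"
  shows "track removal_letter k w \<in> braid_words (n - 1)" "word_perm (track removal_letter k w) = id"
proof -
  have t: "track_test n (n - 1) removal_letter"
    using n by (rule removal_track_test)
  then show "track removal_letter k w \<in> braid_words (n - 1)"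
    using track_words w k by simp
  show "word_perm (track removal_letter k w) = id"
    using word_perm_track[OF strand_removal_eq(2)[OF n k] t] w k by simp
qed

lemma linking3_class:
  assumes "1 \<le> k" "k \<le> 3" "w \<in> braid_words 3" "word_perm w = id"
  shows "linking3 k (braid_class 3 w) = exponent_sum (track removal_letter k w)"
  using strand_removal_class[of 3 k w] strand_removal_pure_word[of 3 k w] assms
  by (simp add: linking3_def braid_degree_class)

lemma linking4_class:
  assumes "1 \<le> k" "k < l" "l \<le> 4" "w \<in> braid_words 4" "word_perm w = id"
  shows "linking4 k l (braid_class 4 w)
    = exponent_sum (track removal_letter k (track removal_letter l w))"
  using strand_removal_class[of 4 l w] strand_removal_pure_word[of 4 l w] assms
  by (simp add: linking4_def linking3_class)

text \<open>The factors 2 below arise because \<open>A\<^sub>1\<^sub>,\<^sub>2\<close> has exponent sum 2.\<close>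

lemma linking3_A:
  assumes "1 \<le> k" "k \<le> 3" "1 \<le> i" "i < j" "j \<le> 3"
  shows "linking3 k (A_elem 3 i j) = (if k \<in> {i, j} then 0 else 2)"
proof -
  have "list_all (\<lambda>k. list_all (\<lambda>j. list_all (\<lambda>i. exponent_sum (track removal_letter k (A_word i j))
      = (if k \<in> {i, j} then 0 else 2)) [1..<j]) [1..<Suc 3]) [1..<Suc 3]"
    by code_simp
  then have "exponent_sum (track removal_letter k (A_word i j)) = (if k \<in> {i, j} then 0 else 2)"
    using assms unfolding list_all_upt less_Suc_eq_le by simp
  then show ?thesis
    using linking3_class[OF assms(1,2) A_word_words[OF assms(3-5)] word_perm_A_word] assms
    by (simp add: A_elem_less)
qed

lemma linking4_A:
  assumes "1 \<le> k" "k < l" "l \<le> 4" "1 \<le> i" "i < j" "j \<le> 4"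
  shows "linking4 k l (A_elem 4 i j) = (if {k, l} \<inter> {i, j} = {} then 2 else 0)"
proof -
  have "list_all (\<lambda>l. list_all (\<lambda>k. list_all (\<lambda>j. list_all (\<lambda>i.
      exponent_sum (track removal_letter k (track removal_letter l (A_word i j)))
      = (if k = i \<or> k = j \<or> l = i \<or> l = j then 0 else 2)) [1..<j]) [1..<Suc 4]) [1..<l]) [1..<Suc 4]"
    by code_simp
  then have "exponent_sum (track removal_letter k (track removal_letter l (A_word i j)))
      = (if k = i \<or> k = j \<or> l = i \<or> l = j then 0 else 2)"
    using assms unfolding list_all_upt less_Suc_eq_le by simp
  then show ?thesis
    using linking4_class[OF assms(1-3) A_word_words[OF assms(4-6)] word_perm_A_word] assms
    by (auto simp: A_elem_less)
qed

lemma integer_hom_add: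
  "f \<in> hom G integer_group \<Longrightarrow> x \<in> carrier G \<Longrightarrow> y \<in> carrier G \<Longrightarrow> f (x \<otimes>\<^bsub>G\<^esub> y) = f x + f y"
  by (simp add: hom_def)

lemma ordered_pairs_3:
  "1 \<le> i \<Longrightarrow> i < j \<Longrightarrow> j \<le> 3 \<Longrightarrow> (i, j) \<in> {(1, 2), (1, 3), (2, 3 :: nat)}"
  by auto

lemma ordered_pairs_4:
  "1 \<le> i \<Longrightarrow> i < j \<Longrightarrow> j \<le> 4 \<Longrightarrow>
    (i, j) \<in> {(1, 2), (1, 3), (2, 3), (1, 4), (2, 4), (3, 4 :: nat)}"
  by auto

text \<open>Up to the factor 2 the linking numbers are dual to the generators, so the two sides
  agree on generators. Hence an element without linking is invisible to all homomorphisms into the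
  integers.\<close>

lemma integer_hom_pure3:
  assumes f: "f \<in> hom (pure_braid_group 3) integer_group" and x: "x \<in> carrier (pure_braid_group 3)"
  shows "2 * f x = f (A_elem 3 1 2) * linking3 3 x + f (A_elem 3 1 3) * linking3 2 x
    + f (A_elem 3 2 3) * linking3 1 x"
proof (rule pure_hom_ext[OF _ group_integer_group _ _ _ x])
  show "(\<lambda>x. 2 * f x) \<in> hom (pure_braid_group 3) integer_group"
    using f by (auto simp: hom_def)
  show "(\<lambda>x. f (A_elem 3 1 2) * linking3 3 x + f (A_elem 3 1 3) * linking3 2 x
    + f (A_elem 3 2 3) * linking3 1 x) \<in> hom (pure_braid_group 3) integer_group"
    by (rule homI) (simp_all add: integer_hom_add[OF linking3_hom] algebra_simps)
  fix i j :: nat assume ij: "1 \<le> i" "i < j" "j \<le> 3"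
  show "2 * f (A_elem 3 i j) = f (A_elem 3 1 2) * linking3 3 (A_elem 3 i j)
      + f (A_elem 3 1 3) * linking3 2 (A_elem 3 i j) + f (A_elem 3 2 3) * linking3 1 (A_elem 3 i j)"
    using ordered_pairs_3[OF ij] by (auto simp: linking3_A)
qed simp

lemma integer_hom_pure4:
  assumes f: "f \<in> hom (pure_braid_group 4) integer_group" and x: "x \<in> carrier (pure_braid_group 4)"
  shows "2 * f x = f (A_elem 4 1 2) * linking4 3 4 x + f (A_elem 4 1 3) * linking4 2 4 x
    + f (A_elem 4 2 3) * linking4 1 4 x + f (A_elem 4 1 4) * linking4 2 3 x
    + f (A_elem 4 2 4) * linking4 1 3 x + f (A_elem 4 3 4) * linking4 1 2 x"
proof (rule pure_hom_ext[OF _ group_integer_group _ _ _ x])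
  show "(\<lambda>x. 2 * f x) \<in> hom (pure_braid_group 4) integer_group"
    using f by (auto simp: hom_def)
  show "(\<lambda>x. f (A_elem 4 1 2) * linking4 3 4 x + f (A_elem 4 1 3) * linking4 2 4 x
    + f (A_elem 4 2 3) * linking4 1 4 x + f (A_elem 4 1 4) * linking4 2 3 x
    + f (A_elem 4 2 4) * linking4 1 3 x + f (A_elem 4 3 4) * linking4 1 2 x)
      \<in> hom (pure_braid_group 4) integer_group"
    by (rule homI) (simp_all add: integer_hom_add[OF linking4_hom] algebra_simps)
  fix i j :: nat assume ij: "1 \<le> i" "i < j" "j \<le> 4"
  show "2 * f (A_elem 4 i j) = f (A_elem 4 1 2) * linking4 3 4 (A_elem 4 i j)
    + f (A_elem 4 1 3) * linking4 2 4 (A_elem 4 i j)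
    + f (A_elem 4 2 3) * linking4 1 4 (A_elem 4 i j) + f (A_elem 4 1 4) * linking4 2 3 (A_elem 4 i j)
    + f (A_elem 4 2 4) * linking4 1 3 (A_elem 4 i j) + f (A_elem 4 3 4) * linking4 1 2 (A_elem 4 i j)"
    using ordered_pairs_4[OF ij] by (auto simp: linking4_A)
qed simp

section \<open>The Heisenberg invariant\<close>

text \<open>With this alternating cocycle, inversion negates all three coordinates, and a commutator
  has central coordinate twice the determinant of the (p, q) parts.\<close>

definition heis_group :: "(int \<times> int \<times> int) monoid" where
  "heis_group =
    \<lparr>carrier = UNIV,
     monoid.mult = (\<lambda>(p, q, z) (p', q', z'). (p + p', q + q', z + z' + p * q' - q * p')),
     one = (0, 0, 0)\<rparr>"

lemma heis_group_simps [simp]: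
  "carrier heis_group = UNIV"
  "\<one>\<^bsub>heis_group\<^esub> = (0, 0, 0)"
  "(p, q, z) \<otimes>\<^bsub>heis_group\<^esub> (p', q', z') = (p + p', q + q', z + z' + p * q' - q * p')"
  by (simp_all add: heis_group_def)

lemma group_heis_group: "group heis_group"
proof (rule groupI)
  fix x :: "int \<times> int \<times> int"
  obtain p q z where "x = (p, q, z)" by (cases x)
  then show "\<exists>y\<in>carrier heis_group. y \<otimes>\<^bsub>heis_group\<^esub> x = \<one>\<^bsub>heis_group\<^esub>"
    by (intro bexI[of _ "(- p, - q, - z)"]) auto
qed (auto simp: algebra_simps)

lemma inv_heis_group: "inv\<^bsub>heis_group\<^esub> (p, q, z) = (- p, - q, - z)"
  by (rule group.inv_equality[OF group_heis_group]) auto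

text \<open>The braids on three strands fixing the first position act on the right of the Heisenberg group:
  \<open>\<sigma>\<^sub>1\<^sup>2\<close> by multiplication with \<open>(-1, 1, 1)\<close> and \<open>\<sigma>\<^sub>2\<close> by multiplication
  with \<open>(1, 0, 0)\<close> followed by the automorphism \<open>(p, q, z) \<mapsto> (p, -q, -z)\<close>; the full
  twist acts trivially. \<open>heis_letter\<close> is the induced action of the whole braid group; its first
  component is the position of the first strand.\<close>

fun heis_sigma :: "bool \<Rightarrow> int \<times> int \<times> int \<Rightarrow> int \<times> int \<times> int" where
  "heis_sigma b (p, q, z) = (if b then (p + 1, - q, q - z) else (p - 1, - q, - q - z))"

fun heis_tau :: "bool \<Rightarrow> int \<times> int \<times> int \<Rightarrow> int \<times> int \<times> int" where
  "heis_tau b (p, q, z) = (if b then (p - 1, q + 1, z + 1 + p + q) else (p + 1, q - 1, z - 1 - p - q))"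

fun heis_letter :: "nat \<times> bool \<Rightarrow> nat \<times> int \<times> int \<times> int \<Rightarrow> nat \<times> int \<times> int \<times> int" where
  "heis_letter (i, b) (k, v) =
    (if i = 1 then
       if k = 1 then (2, if b then v else heis_tau False v)
       else if k = 2 then (1, if b then heis_tau True v else v)
       else (k, heis_sigma b v)
     else
       if k = 1 then (1, heis_sigma b v)
       else if k = 2 then (3, if b then v else heis_sigma True (heis_tau False (heis_sigma False v)))
       else (2, if b then heis_sigma True (heis_tau True (heis_sigma False v)) else v))"

lemma heis_letter_position: "fst x \<in> {1, 2, 3} \<Longrightarrow> i \<in> {1, 2} \<Longrightarrow> fst (heis_letter (i, b) x) \<in> {1, 2, 3}"
  by (cases x) auto

lemma fold_heis_letter_position:
  "w \<in> braid_words 3 \<Longrightarrow> fst x \<in> {1, 2, 3} \<Longrightarrow> fst (fold heis_letter w x) \<in> {1, 2, 3}"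
proof (induction w arbitrary: x)
  case (Cons l w)
  obtain i b where l: "l = (i, b)" by (cases l)
  then have "i \<in> {1, 2}" using Cons.prems by auto
  then show ?case using Cons l heis_letter_position[of x i b] by simp
qed simp

lemma fold_heis_letter_cong:
  "braid_eq 3 u v \<Longrightarrow> fst x \<in> {1, 2, 3} \<Longrightarrow> fold heis_letter u x = fold heis_letter v x"
proof (induction arbitrary: x rule: braid_eq.induct)
  case (sym u v)
  show ?case using sym.IH[OF sym.prems] by simp
next
  case (trans u v w)
  show ?case using trans.IH(1)[OF trans.prems] trans.IH(2)[OF trans.prems] by simp
next
  case (append u u' v v')
  have "fst (fold heis_letter u x) \<in> {1, 2, 3}"
    using fold_heis_letter_position append.prems braid_eq_words[OF append.hyps(1)] by blast
  then show ?case using append.IH(1)[OF append.prems] append.IH(2) by simp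
next
  case (cancel i b)
  obtain k p q z where x: "x = (k, p, q, z)" by (metis surj_pair)
  have "i \<in> {1, 2}" "k \<in> {1, 2, 3}" using cancel x by auto
  then show ?case unfolding x by (cases b) auto
next
  case (far i j)
  then show ?case by simp
next
  case (braid i)
  obtain k p q z where x: "x = (k, p, q, z)" by (metis surj_pair)
  have i: "i = 1" and k: "k \<in> {1, 2, 3}" using braid x by auto
  show ?case using k unfolding x i by auto
qed simp

definition heis :: "braid_word set \<Rightarrow> int \<times> int \<times> int" where
  "heis x = snd (fold heis_letter (SOME w. w \<in> x) (1, 0, 0, 0))"

lemma heis_class:
  assumes "w \<in> braid_words 3"
  shows "heis (braid_class 3 w) = snd (fold heis_letter w (1, 0, 0, 0))"
proof -
  have "w \<in> braid_class 3 w" using assms by (simp add: mem_braid_class braid_eq.refl)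
  then have "(SOME v. v \<in> braid_class 3 w) \<in> braid_class 3 w" by (rule someI)
  then have "braid_eq 3 w (SOME v. v \<in> braid_class 3 w)" by (simp add: mem_braid_class)
  from fold_heis_letter_cong[OF this, of "(1, 0, 0, 0)"] show ?thesis by (simp add: heis_def)
qed

lemma fold_heis_letter_A:
  "fold heis_letter (A_word 1 2) (1, v) = (1, v \<otimes>\<^bsub>heis_group\<^esub> (- 1, 1, 1))"
  "fold heis_letter (A_word 1 3) (1, v) = (1, v \<otimes>\<^bsub>heis_group\<^esub> (- 1, - 1, - 3))"
  "fold heis_letter (A_word 2 3) (1, v) = (1, v \<otimes>\<^bsub>heis_group\<^esub> (2, 0, 0))"
  "fold heis_letter (winv (A_word 1 2)) (1, v) = (1, v \<otimes>\<^bsub>heis_group\<^esub> (1, - 1, - 1))"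
  "fold heis_letter (winv (A_word 1 3)) (1, v) = (1, v \<otimes>\<^bsub>heis_group\<^esub> (1, 1, 3))"
  "fold heis_letter (winv (A_word 2 3)) (1, v) = (1, v \<otimes>\<^bsub>heis_group\<^esub> (- 2, 0, 0))"
  by (cases v; simp add: A_word_def upt_conv_Cons)+

text \<open>A braid fixing the first position need not act by a right translation, since sigma_2
  also involves an automorphism. The generators A_{i,j} do (\<open>fold_heis_letter_A\<close>),
  hence so do all pure braids, and the translation is read off at the identity.\<close>

lemma fold_heis_letter_pure:
  assumes "w \<in> braid_words 3" "word_perm w = id"
  shows "fold heis_letter w (1, v) = (1, v \<otimes>\<^bsub>heis_group\<^esub> heis (braid_class 3 w))"
proof -
  interpret H: group heis_group by (rule group_heis_group)
  obtain w' where w': "w' \<in> word_products (A_words 3)" "braid_eq 3 w w'"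
    using pure_word_product[of 3 w] assms by auto
  obtain ws where ws: "w' = concat ws" "ws \<in> lists (A_words 3 \<union> winv ` A_words 3)"
    using w'(1) by (auto simp: word_products_def)
  have "\<exists>h. \<forall>v. fold heis_letter (concat ws) (1, v) = (1, v \<otimes>\<^bsub>heis_group\<^esub> h)"
    using ws(2)
  proof (induction ws)
    case Nil
    then show ?case using H.r_one by (intro exI[of _ "(0, 0, 0)"]) auto
  next
    case (Cons u us)
    obtain a where a: "a \<in> A_words 3" "u = a \<or> u = winv a" using Cons.hyps by blast
    then obtain i j where "a = A_word i j" "1 \<le> i" "i < j" "j \<le> 3"
      unfolding A_words_def mem_Collect_eq by metis
    then have "a \<in> {A_word 1 2, A_word 1 3, A_word 2 3}" using ordered_pairs_3[of i j] by auto
    then obtain h where "\<And>v. fold heis_letter u (1, v) = (1, v \<otimes>\<^bsub>heis_group\<^esub> h)"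
      using a(2) fold_heis_letter_A by (metis insertE empty_iff)
    moreover obtain h' where "\<And>v. fold heis_letter (concat us) (1, v) = (1, v \<otimes>\<^bsub>heis_group\<^esub> h')"
      using Cons.IH by blast
    ultimately have "fold heis_letter (concat (u # us)) (1, v) = (1, v \<otimes>\<^bsub>heis_group\<^esub> (h \<otimes>\<^bsub>heis_group\<^esub> h'))" for v
      using H.m_assoc[of v h h'] by simp
    then show ?case by blast
  qed
  then obtain h where "\<And>v. fold heis_letter w' (1, v) = (1, v \<otimes>\<^bsub>heis_group\<^esub> h)"
    unfolding ws(1) by blast
  then have h: "fold heis_letter w (1, v) = (1, v \<otimes>\<^bsub>heis_group\<^esub> h)" for v
    using fold_heis_letter_cong[OF w'(2), of "(1, v)"] by simp
  have "heis (braid_class 3 w) = h"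
    unfolding heis_class[OF assms(1)] using h[of "(0, 0, 0)"] H.l_one[of h] by simp
  then show ?thesis using h by simp
qed

lemma heis_hom: "heis \<in> hom (pure_braid_group 3) heis_group"
proof (rule homI)
  fix x y assume "x \<in> carrier (pure_braid_group 3)" "y \<in> carrier (pure_braid_group 3)"
  then obtain u v where u: "x = braid_class 3 u" "u \<in> braid_words 3" "word_perm u = id"
    and v: "y = braid_class 3 v" "v \<in> braid_words 3" "word_perm v = id"
    by (auto simp: carrier_pure)
  have "heis (x \<otimes>\<^bsub>pure_braid_group 3\<^esub> y) = snd (fold heis_letter (u @ v) (1, 0, 0, 0))"
    using u v by (simp add: mult_pure heis_class)
  also have "fold heis_letter (u @ v) (1, 0, 0, 0) = fold heis_letter v (1, heis x)"
    using fold_heis_letter_pure[OF u(2,3), of "(0, 0, 0)"] monoid.l_one[of heis_group "heis x"]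
      group_heis_group u(1) by (simp add: group.is_monoid)
  finally show "heis (x \<otimes>\<^bsub>pure_braid_group 3\<^esub> y) = heis x \<otimes>\<^bsub>heis_group\<^esub> heis y"
    using fold_heis_letter_pure[OF v(2,3)] v(1) by simp
qed simp

section \<open>Groups with a central commutator\<close>

context group
begin

lemma cancel_inv_mult:
  assumes "x \<in> carrier G" "y \<in> carrier G"
  shows "inv x \<otimes> (x \<otimes> y) = y" "x \<otimes> (inv x \<otimes> y) = y"
  using assms by (simp_all add: m_assoc[symmetric])

lemma conj_int_pow:
  assumes "g \<in> carrier G" "x \<in> carrier G"
  shows "g \<otimes> x [^] (i :: int) \<otimes> inv g = (g \<otimes> x \<otimes> inv g) [^] i"
proof (rule hom_int_pow[where h = "\<lambda>x. g \<otimes> x \<otimes> inv g" and G = G and H = G])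
  show "(\<lambda>x. g \<otimes> x \<otimes> inv g) \<in> hom G G"
    using assms by (intro homI) (auto simp: m_assoc cancel_inv_mult)
qed (use assms is_group in auto)

lemma commute_int_pow:
  assumes "x \<otimes> y = y \<otimes> x" "x \<in> carrier G" "y \<in> carrier G"
  shows "x [^] (i :: int) \<otimes> y = y \<otimes> x [^] i"
proof -
  have "y \<otimes> x [^] i \<otimes> inv y = x [^] i"
    using conj_int_pow[of y x i] assms(1)[symmetric] assms(2,3) by (simp add: m_assoc cancel_inv_mult)
  then show ?thesis
    using assms(2,3) inv_solve_right'[of "x [^] i" "y \<otimes> x [^] i" y] by simp
qed

lemma commute_mult:
  assumes "x \<otimes> y = y \<otimes> x" "x \<otimes> z = z \<otimes> x" "x \<in> carrier G" "y \<in> carrier G" "z \<in> carrier G"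
  shows "x \<otimes> (y \<otimes> z) = (y \<otimes> z) \<otimes> x"
  using assms m_assoc[of x y z] m_assoc[of y x z] m_assoc[of y z x] by simp

lemma commute_inv:
  assumes "x \<otimes> y = y \<otimes> x" "x \<in> carrier G" "y \<in> carrier G"
  shows "x \<otimes> inv y = inv y \<otimes> x"
proof -
  have "x \<otimes> inv y = inv y \<otimes> (y \<otimes> x) \<otimes> inv y"
    using assms(2,3) by (simp add: m_assoc cancel_inv_mult)
  also have "\<dots> = inv y \<otimes> x"
    unfolding assms(1)[symmetric] using assms(2,3) by (simp add: m_assoc cancel_inv_mult)
  finally show ?thesis .
qed

lemma commute_int_pows:
  assumes "x \<otimes> y = y \<otimes> x" "x \<in> carrier G" "y \<in> carrier G"
  shows "x [^] (i :: int) \<otimes> y [^] (j :: int) = y [^] j \<otimes> x [^] i"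
  using commute_int_pow[OF commute_int_pow[OF assms(1,2,3), symmetric], symmetric] assms(2,3) by simp

text \<open>This is collection as in the Heisenberg group: the set \<open>R\<close> of elements of
  this shape contains the identity and is stable under left multiplication by powers of a, b and
  d.\<close>

lemma central_commutator_normal_form:
  assumes a: "a \<in> carrier G" and b: "b \<in> carrier G" and d: "d \<in> carrier G"
    and da: "d \<otimes> a = a \<otimes> d" and db: "d \<otimes> b = b \<otimes> d"
    and c: "c = inv a \<otimes> b \<otimes> a \<otimes> inv b" and ca: "c \<otimes> a = a \<otimes> c" and cb: "c \<otimes> b = b \<otimes> c"
    and x: "x \<in> generate G {a, b, d}"
  shows "\<exists>(i :: int) (j :: int) (k :: int) (l :: int). x = a [^] i \<otimes> (b [^] j \<otimes> (d [^] k \<otimes> c [^] l))"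
proof -
  let ?N = "\<lambda>(i :: int) (j :: int) (k :: int) (l :: int). a [^] i \<otimes> (b [^] j \<otimes> (d [^] k \<otimes> c [^] l))"
  define R where "R = {?N i j k l |i j k l. True}"
  have cc: "c \<in> carrier G" using a b c by simp
  have dc: "d \<otimes> c = c \<otimes> d"
    unfolding c using a b d da db by (intro commute_mult commute_inv) auto
  have ba: "b [^] m \<otimes> a [^] i = a [^] i \<otimes> (c [^] (m * i) \<otimes> b [^] m)" for m i :: int
  proof -
    have "inv a \<otimes> b \<otimes> inv (inv a) = c \<otimes> b"
      unfolding c using a b by (simp add: m_assoc cancel_inv_mult)
    then have "inv a \<otimes> b [^] m \<otimes> inv (inv a) = c [^] m \<otimes> b [^] m"
      using conj_int_pow[of "inv a" b m] int_pow_mult_distrib[OF cb cc b, of m] a b by simp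
    then have "b [^] m \<otimes> a = a \<otimes> (c [^] m \<otimes> b [^] m)"
      using a b cc inv_solve_left'[of "c [^] m \<otimes> b [^] m" a "b [^] m \<otimes> a"] by (simp add: m_assoc cancel_inv_mult)
    then have "b [^] m \<otimes> a \<otimes> inv (b [^] m) = a \<otimes> c [^] m"
      using a b cc by (simp add: m_assoc cancel_inv_mult)
    then have "b [^] m \<otimes> a [^] i \<otimes> inv (b [^] m) = a [^] i \<otimes> (c [^] m) [^] i"
      using conj_int_pow[of "b [^] m" a i] int_pow_mult_distrib[OF commute_int_pow[OF ca cc a, of m, symmetric], of i]
        a b cc by simp
    then have "b [^] m \<otimes> a [^] i = a [^] i \<otimes> c [^] (m * i) \<otimes> b [^] m"
      using a b cc inv_solve_right'[of "a [^] i \<otimes> c [^] (m * i)" "b [^] m \<otimes> a [^] i" "b [^] m"]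
      by (simp add: int_pow_pow)
    then show ?thesis using a b cc by (simp add: m_assoc cancel_inv_mult)
  qed
  have A: "a [^] m \<otimes> y \<in> R" if y: "y \<in> R" for y and m :: int
  proof -
    obtain i j k l where y: "y = ?N i j k l" using y unfolding R_def by blast
    have "a [^] m \<otimes> y = ?N (m + i) j k l"
      unfolding y using a b cc d by (simp add: int_pow_mult m_assoc)
    then show ?thesis unfolding R_def by blast
  qed
  have B: "b [^] m \<otimes> y \<in> R" if y: "y \<in> R" for y and m :: int
  proof -
    obtain i j k l where y: "y = ?N i j k l" using y unfolding R_def by blast
    have "b [^] m \<otimes> y = (b [^] m \<otimes> a [^] i) \<otimes> (b [^] j \<otimes> (d [^] k \<otimes> c [^] l))"
      unfolding y using a b cc d by (simp add: m_assoc cancel_inv_mult)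
    also have "\<dots> = a [^] i \<otimes> ((c [^] (m * i) \<otimes> b [^] (m + j)) \<otimes> (d [^] k \<otimes> c [^] l))"
      unfolding ba using a b cc d by (simp add: m_assoc int_pow_mult)
    also have "\<dots> = a [^] i \<otimes> (b [^] (m + j) \<otimes> (c [^] (m * i) \<otimes> d [^] k \<otimes> c [^] l))"
      unfolding commute_int_pows[OF cb cc b] using a b cc d by (simp add: m_assoc cancel_inv_mult)
    also have "\<dots> = ?N i (m + j) k (m * i + l)"
      unfolding commute_int_pows[OF dc[symmetric] cc d] using a b cc d by (simp add: m_assoc int_pow_mult)
    finally show ?thesis unfolding R_def by blast
  qed
  have D: "d [^] m \<otimes> y \<in> R" if y: "y \<in> R" for y and m :: int
  proof -
    obtain i j k l where y: "y = ?N i j k l" using y unfolding R_def by blast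
    have "d [^] m \<otimes> y = (d [^] m \<otimes> a [^] i) \<otimes> (b [^] j \<otimes> (d [^] k \<otimes> c [^] l))"
      unfolding y using a b cc d by (simp add: m_assoc cancel_inv_mult)
    also have "\<dots> = a [^] i \<otimes> ((d [^] m \<otimes> b [^] j) \<otimes> (d [^] k \<otimes> c [^] l))"
      unfolding commute_int_pows[OF da d a] using a b cc d by (simp add: m_assoc cancel_inv_mult)
    also have "\<dots> = ?N i j (m + k) l"
      unfolding commute_int_pows[OF db d b] using a b cc d by (simp add: m_assoc int_pow_mult)
    finally show ?thesis unfolding R_def by blast
  qed
  have R: "y \<in> carrier G" if "y \<in> R" for y
    using that a b d cc unfolding R_def by auto
  have sub: "{a, b, d} \<subseteq> carrier G" using a b d by blast
  have "y \<in> R \<longrightarrow> x \<otimes> y \<in> R" for y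
    using x
  proof (induction arbitrary: y rule: generate.induct)
    case one
    show ?case using R by simp
  next
    case (incl h)
    then show ?case using A[of y 1] B[of y 1] D[of y 1] a b d by auto
  next
    case (inv h)
    have "h [^] (- 1 :: int) = inv h" if "h \<in> carrier G"
      using int_pow_neg[OF that, of 1] that by simp
    then show ?case using inv A[of y "- 1"] B[of y "- 1"] D[of y "- 1"] a b d by auto
  next
    case (eng h1 h2)
    have "h1 \<otimes> h2 \<otimes> y = h1 \<otimes> (h2 \<otimes> y)" if "y \<in> R"
    proof -
      show ?thesis using R[OF that] eng.hyps generate_in_carrier[OF sub] by (simp add: m_assoc cancel_inv_mult)
    qed
    then show ?case using eng.IH(2)[of y] eng.IH(1)[of "h2 \<otimes> y"] by simp
  qed
  moreover have "\<one> = ?N 0 0 0 0" by simp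
  then have "\<one> \<in> R" unfolding R_def by blast
  ultimately have "x \<in> R" using generate_in_carrier[OF sub x] by force
  then show ?thesis unfolding R_def by blast
qed

end

section \<open>Brunnian braids\<close>

lemma Brun_strand_removal:
  "x \<in> Brun n \<Longrightarrow> 1 \<le> k \<Longrightarrow> k \<le> n \<Longrightarrow> strand_removal n k x = \<one>\<^bsub>pure_braid_group (n - 1)\<^esub>"
  by (auto simp: Brun_def kernel_def)

lemma Brun_carrier: "1 \<le> n \<Longrightarrow> x \<in> Brun n \<Longrightarrow> x \<in> carrier (pure_braid_group n)"
  by (auto simp: Brun_def kernel_def)

lemma hom_one: "f \<in> hom G H \<Longrightarrow> group G \<Longrightarrow> group H \<Longrightarrow> f \<one>\<^bsub>G\<^esub> = \<one>\<^bsub>H\<^esub>"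
  by (simp add: group_hom.hom_one group_hom_axioms.intro group_hom_def)

lemma integer_hom_one:
  "f \<in> hom (pure_braid_group n) integer_group \<Longrightarrow> f \<one>\<^bsub>pure_braid_group n\<^esub> = 0"
  using hom_one[OF _ group_pure_braid_group group_integer_group] by simp

lemma Brun3_linking3: "x \<in> Brun 3 \<Longrightarrow> 1 \<le> k \<Longrightarrow> k \<le> 3 \<Longrightarrow> linking3 k x = 0"
  using Brun_strand_removal[of x 3 k] integer_hom_one[OF braid_degree_hom, of 2]
  by (simp add: linking3_def)

lemma Brun3_integer_hom:
  assumes "x \<in> Brun 3" "f \<in> hom (pure_braid_group 3) integer_group"
  shows "f x = 0"
  using integer_hom_pure3[OF assms(2) Brun_carrier[OF _ assms(1)]] Brun3_linking3[OF assms(1)] by simp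

lemma Brun4_integer_hom:
  assumes "x \<in> Brun 4" "f \<in> hom (pure_braid_group 4) integer_group"
  shows "f x = 0"
proof -
  have "linking4 k l x = 0" if "1 \<le> k" "k < l" "l \<le> 4" for k l
    using Brun_strand_removal[OF assms(1), of l] integer_hom_one[OF linking3_hom, of k] that
    by (simp add: linking4_def)
  then show ?thesis
    using integer_hom_pure4[OF assms(2) Brun_carrier[OF _ assms(1)]] by simp
qed

text \<open>An element killed by all integer-valued homomorphisms is killed by every homomorphism
  into P_2, since exponent sum embeds P_2 in the integers. The condition mentions no strand, so
  endomorphisms will preserve it.\<close>

lemma Zn3_iff:
  "x \<in> Zn 3 \<longleftrightarrow> x \<in> carrier (pure_braid_group 3) \<and>
    (\<forall>f \<in> hom (pure_braid_group 3) integer_group. f x = 0)"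
proof
  assume "x \<in> Zn 3"
  then show "x \<in> carrier (pure_braid_group 3) \<and>
      (\<forall>f \<in> hom (pure_braid_group 3) integer_group. f x = 0)"
    using Brun_carrier[of 3 x] Brun3_integer_hom[of x] by (auto simp: Zn_def)
next
  assume x: "x \<in> carrier (pure_braid_group 3) \<and>
      (\<forall>f \<in> hom (pure_braid_group 3) integer_group. f x = 0)"
  have *: "g x = \<one>\<^bsub>pure_braid_group 2\<^esub>"
    if "g \<in> hom (pure_braid_group 3) (pure_braid_group 2)" for g
  proof -
    have "braid_degree \<circ> g \<in> hom (pure_braid_group 3) integer_group"
      using that braid_degree_hom by (rule Group.hom_compose)
    then have "braid_degree (g x) = 0" using x by fastforce
    moreover have "g x \<in> carrier (pure_braid_group 2)" using x hom_in_carrier[OF that] by blast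
    ultimately show ?thesis by (intro braid_degree_eq_0)
  qed
  show "x \<in> Zn 3"
    using x *[OF bdry_hom[of 3, simplified]] *[OF strand_removal_hom[of 3, simplified]]
    by (auto simp: Zn_def Brun_def kernel_def)
qed

lemma bdry4_in_Zn3:
  assumes "x \<in> Brun 4"
  shows "bdry 4 x \<in> Zn 3"
  unfolding Zn3_iff
proof (intro conjI ballI)
  have h: "bdry 4 \<in> hom (pure_braid_group 4) (pure_braid_group 3)" using bdry_hom[of 4] by simp
  show "bdry 4 x \<in> carrier (pure_braid_group 3)"
    using hom_in_carrier[OF h] Brun_carrier[OF _ assms] by simp
  fix f assume "f \<in> hom (pure_braid_group 3) integer_group"
  with h have "f \<circ> bdry 4 \<in> hom (pure_braid_group 4) integer_group" by (rule Group.hom_compose)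
  from Brun4_integer_hom[OF assms this] show "f (bdry 4 x) = 0" by simp
qed

section \<open>The five faces and the alternating sum of central coordinates\<close>

definition face :: "nat \<Rightarrow> braid_word set \<Rightarrow> braid_word set" where
  "face r = (if r = 0 then bdry 4 else strand_removal 4 r)"

definition face_word :: "nat \<Rightarrow> braid_word \<Rightarrow> braid_word" where
  "face_word r w =
    (if r = 0 then track removal_letter 1 (track (theta_letter 4 True) 1 w) else track removal_letter r w)"

lemma face_hom: "r \<le> 4 \<Longrightarrow> face r \<in> hom (pure_braid_group 4) (pure_braid_group 3)"
  using bdry_hom[of 4] strand_removal_hom[of 4 r] by (simp add: face_def)

lemma face_class:
  "r \<le> 4 \<Longrightarrow> w \<in> braid_words 4 \<Longrightarrow> word_perm w = id \<Longrightarrow>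
    face r (braid_class 4 w) = braid_class 3 (face_word r w)"
  using bdry_class[of 4 w] strand_removal_class[of 4 r w] by (simp add: face_def face_word_def)

lemma face_words: "r \<le> 4 \<Longrightarrow> w \<in> braid_words 4 \<Longrightarrow> face_word r w \<in> braid_words 3"
  using track_words[OF removal_track_test[of 4], of w r]
    track_words[OF removal_track_test[of 4], of "track (theta_letter 4 True) 1 w" 1]
    track_words[OF theta_track_test[of 4], of w 1 True]
  by (auto simp: face_word_def)

definition heis_p :: "braid_word set \<Rightarrow> int" where "heis_p x = fst (heis x)"
definition heis_q :: "braid_word set \<Rightarrow> int" where "heis_q x = fst (snd (heis x))"
definition heis_z :: "braid_word set \<Rightarrow> int" where "heis_z x = snd (snd (heis x))"

lemma heis_mult:
  assumes "x \<in> carrier (pure_braid_group 3)" "y \<in> carrier (pure_braid_group 3)"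
  shows "heis_p (x \<otimes>\<^bsub>pure_braid_group 3\<^esub> y) = heis_p x + heis_p y"
    and "heis_q (x \<otimes>\<^bsub>pure_braid_group 3\<^esub> y) = heis_q x + heis_q y"
    and "heis_z (x \<otimes>\<^bsub>pure_braid_group 3\<^esub> y)
      = heis_z x + heis_z y + heis_p x * heis_q y - heis_q x * heis_p y"
  using hom_mult[OF heis_hom assms]
  by (cases "heis x"; cases "heis y"; simp add: heis_p_def heis_q_def heis_z_def)+

lemma heis_p_hom: "heis_p \<in> hom (pure_braid_group 3) integer_group"
  and heis_q_hom: "heis_q \<in> hom (pure_braid_group 3) integer_group"
  by (simp_all add: hom_def heis_mult)

lemma heis_z_one: "heis_z \<one>\<^bsub>pure_braid_group 3\<^esub> = 0"
  using heis_class[of "[]"] by (simp add: one_pure heis_z_def)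

definition pq_value :: "nat \<Rightarrow> nat \<times> nat \<Rightarrow> int \<times> int" where
  "pq_value r = (\<lambda>(i, j).
    case fold heis_letter (face_word r (A_word i j)) (1, 0, 0, 0) of (k, p, q, z) \<Rightarrow> (p, q))"

text \<open>Rows are the faces 0 to 4, face 0 being the boundary; columns are the six generators in
  the order of \<open>integer_hom_pure4\<close>. As p and q are additive, the table determines them
  on every face of every element of P_4.\<close>

lemma pq_value_table:
  "map (\<lambda>r. map (pq_value r) [(1, 2), (1, 3), (2, 3), (1, 4), (2, 4), (3, 4)]) [0, 1, 2, 3, 4] =
    [[(2, 0), (-1, -1), (-1, 1), (-1, 1), (-1, -1), (2, 0)],
     [(0, 0), (0, 0), (-1, 1), (0, 0), (-1, -1), (2, 0)],
     [(0, 0), (-1, 1), (0, 0), (-1, -1), (0, 0), (2, 0)],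
     [(-1, 1), (0, 0), (0, 0), (-1, -1), (2, 0), (0, 0)],
     [(-1, 1), (-1, -1), (2, 0), (0, 0), (0, 0), (0, 0)]]"
  by code_simp

lemma face_pq_value:
  assumes "r \<le> 4" "1 \<le> i" "i < j" "j \<le> 4"
  shows "heis_p (face r (A_elem 4 i j)) = fst (pq_value r (i, j))"
    and "heis_q (face r (A_elem 4 i j)) = snd (pq_value r (i, j))"
proof -
  have "face r (A_elem 4 i j) = braid_class 3 (face_word r (A_word i j))"
    using assms by (simp add: A_elem_less face_class A_word_words word_perm_A_word)
  then show "heis_p (face r (A_elem 4 i j)) = fst (pq_value r (i, j))"
    "heis_q (face r (A_elem 4 i j)) = snd (pq_value r (i, j))"
    using heis_class[OF face_words[OF assms(1) A_word_words[OF assms(2-4)]]]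
    by (simp_all add: heis_p_def heis_q_def pq_value_def split: prod.splits)
qed

lemma face_heis:
  assumes x: "x \<in> carrier (pure_braid_group 4)"
  shows
    "2 * heis_p (face 0 x) = 2 * linking4 3 4 x - linking4 2 4 x - linking4 1 4 x - linking4 2 3 x
      - linking4 1 3 x + 2 * linking4 1 2 x"
    "2 * heis_q (face 0 x) = - linking4 2 4 x + linking4 1 4 x + linking4 2 3 x - linking4 1 3 x"
    "2 * heis_p (face 1 x) = - linking4 1 4 x - linking4 1 3 x + 2 * linking4 1 2 x"
    "2 * heis_q (face 1 x) = linking4 1 4 x - linking4 1 3 x"
    "2 * heis_p (face 2 x) = - linking4 2 4 x - linking4 2 3 x + 2 * linking4 1 2 x"
    "2 * heis_q (face 2 x) = linking4 2 4 x - linking4 2 3 x"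
    "2 * heis_p (face 3 x) = - linking4 3 4 x - linking4 2 3 x + 2 * linking4 1 3 x"
    "2 * heis_q (face 3 x) = linking4 3 4 x - linking4 2 3 x"
    "2 * heis_p (face 4 x) = - linking4 3 4 x - linking4 2 4 x + 2 * linking4 1 4 x"
    "2 * heis_q (face 4 x) = linking4 3 4 x - linking4 2 4 x"
proof -
  have p: "heis_p \<circ> face r \<in> hom (pure_braid_group 4) integer_group"
    and q: "heis_q \<circ> face r \<in> hom (pure_braid_group 4) integer_group" if "r \<le> 4" for r
    using Group.hom_compose[OF face_hom heis_p_hom] Group.hom_compose[OF face_hom heis_q_hom] that by auto
  note table = pq_value_table[unfolded list.map list.inject]
  show
    "2 * heis_p (face 0 x) = 2 * linking4 3 4 x - linking4 2 4 x - linking4 1 4 x - linking4 2 3 x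
      - linking4 1 3 x + 2 * linking4 1 2 x"
    "2 * heis_q (face 0 x) = - linking4 2 4 x + linking4 1 4 x + linking4 2 3 x - linking4 1 3 x"
    using integer_hom_pure4[OF p[of 0] x] integer_hom_pure4[OF q[of 0] x] table
    by (simp_all add: face_pq_value)
  show
    "2 * heis_p (face 1 x) = - linking4 1 4 x - linking4 1 3 x + 2 * linking4 1 2 x"
    "2 * heis_q (face 1 x) = linking4 1 4 x - linking4 1 3 x"
    using integer_hom_pure4[OF p[of 1] x] integer_hom_pure4[OF q[of 1] x] table
    by (simp_all add: face_pq_value)
  show
    "2 * heis_p (face 2 x) = - linking4 2 4 x - linking4 2 3 x + 2 * linking4 1 2 x"
    "2 * heis_q (face 2 x) = linking4 2 4 x - linking4 2 3 x"
    using integer_hom_pure4[OF p[of 2] x] integer_hom_pure4[OF q[of 2] x] table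
    by (simp_all add: face_pq_value)
  show
    "2 * heis_p (face 3 x) = - linking4 3 4 x - linking4 2 3 x + 2 * linking4 1 3 x"
    "2 * heis_q (face 3 x) = linking4 3 4 x - linking4 2 3 x"
    using integer_hom_pure4[OF p[of 3] x] integer_hom_pure4[OF q[of 3] x] table
    by (simp_all add: face_pq_value)
  show
    "2 * heis_p (face 4 x) = - linking4 3 4 x - linking4 2 4 x + 2 * linking4 1 4 x"
    "2 * heis_q (face 4 x) = linking4 3 4 x - linking4 2 4 x"
    using integer_hom_pure4[OF p[of 4] x] integer_hom_pure4[OF q[of 4] x] table
    by (simp_all add: face_pq_value)
qed

lemma heis_z_face_hom:
  "(\<lambda>x. heis_z (face 0 x) - heis_z (face 1 x) + heis_z (face 2 x) - heis_z (face 3 x) + heis_z (face 4 x))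
    \<in> hom (pure_braid_group 4) integer_group"
proof (rule homI)
  fix x y assume xy: "x \<in> carrier (pure_braid_group 4)" "y \<in> carrier (pure_braid_group 4)"
  let ?w = "\<lambda>r. heis_p (face r x) * heis_q (face r y) - heis_q (face r x) * heis_p (face r y)"
  have z: "heis_z (face r (x \<otimes>\<^bsub>pure_braid_group 4\<^esub> y)) = heis_z (face r x) + heis_z (face r y) + ?w r"
    if "r \<le> 4" for r
    using heis_mult(3)[OF hom_in_carrier[OF face_hom[OF that] xy(1)] hom_in_carrier[OF face_hom[OF that] xy(2)]]
      hom_mult[OF face_hom[OF that] xy] by simp
  \<comment> \<open>The factor 4 expresses each determinant by the doubled values in
    \<open>face_heis\<close>; the cancellation is then a polynomial identity in the linking numbers
    of x and y.\<close>
  have w: "4 * ?w r = (2 * heis_p (face r x)) * (2 * heis_q (face r y))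
      - (2 * heis_q (face r x)) * (2 * heis_p (face r y))" for r
    by (simp add: algebra_simps)
  have "4 * ?w 0 - 4 * ?w 1 + 4 * ?w 2 - 4 * ?w 3 + 4 * ?w 4 = 0"
    unfolding w face_heis[OF xy(1)] face_heis[OF xy(2)] by (simp add: algebra_simps)
  then show "heis_z (face 0 (x \<otimes>\<^bsub>pure_braid_group 4\<^esub> y)) - heis_z (face 1 (x \<otimes>\<^bsub>pure_braid_group 4\<^esub> y))
      + heis_z (face 2 (x \<otimes>\<^bsub>pure_braid_group 4\<^esub> y)) - heis_z (face 3 (x \<otimes>\<^bsub>pure_braid_group 4\<^esub> y))
      + heis_z (face 4 (x \<otimes>\<^bsub>pure_braid_group 4\<^esub> y))
    = (heis_z (face 0 x) - heis_z (face 1 x) + heis_z (face 2 x) - heis_z (face 3 x) + heis_z (face 4 x))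
      \<otimes>\<^bsub>integer_group\<^esub>
      (heis_z (face 0 y) - heis_z (face 1 y) + heis_z (face 2 y) - heis_z (face 3 y) + heis_z (face 4 y))"
    by (simp add: z)
qed simp

lemma heis_z_bdry4:
  assumes "x \<in> Brun 4"
  shows "heis_z (bdry 4 x) = 0"
proof -
  have "heis_z (face r x) = 0" if "1 \<le> r" "r \<le> 4" for r
    using Brun_strand_removal[OF assms that] that heis_z_one by (simp add: face_def)
  then show ?thesis
    using Brun4_integer_hom[OF assms heis_z_face_hom] by (simp add: face_def)
qed

section \<open>Generators of P_3 and explicit boundaries\<close>

abbreviation P3 :: "braid_word set monoid" where "P3 \<equiv> pure_braid_group 3"
abbreviation P4 :: "braid_word set monoid" where "P4 \<equiv> pure_braid_group 4"

lemma braid_class_eqI: "braid_test n u v \<Longrightarrow> braid_class n u = braid_class n v"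
  using braid_test_sound[of n u v] braid_eq_words[of n u v] braid_class_eq_iff[of u n v] by blast

definition pure_test :: "nat \<Rightarrow> braid_word \<Rightarrow> bool" where
  "pure_test n w \<longleftrightarrow> list_all (\<lambda>(i, b). 1 \<le> i \<and> i < n) w
     \<and> map (end_position w) [1..<Suc n] = [1..<Suc n]"

lemma pure_test_sound:
  assumes "pure_test n w"
  shows "w \<in> braid_words n \<and> word_perm w = id"
proof -
  have "map (end_position w) [1..<Suc n] = map id [1..<Suc n]"
    using assms by (simp only: pure_test_def list.map_id)
  then have "end_position w k = k" if "1 \<le> k" "k \<le> n" for k
    using that unfolding map_eq_conv by auto
  moreover have "w \<in> braid_words n"
    using assms by (simp only: pure_test_def braid_words_list_all)
  ultimately show ?thesis using word_perm_eq_id by blast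
qed

definition removal_trivial :: "braid_word \<Rightarrow> nat \<Rightarrow> bool" where
  "removal_trivial w k \<longleftrightarrow> braid_test 3 (track removal_letter k w) []"

lemma Brun4_class:
  assumes "pure_test 4 w" "list_all (removal_trivial w) [1..<5]"
  shows "braid_class 4 w \<in> Brun 4"
proof -
  have w: "w \<in> braid_words 4" "word_perm w = id" using pure_test_sound[OF assms(1)] by auto
  have "strand_removal 4 k (braid_class 4 w) = \<one>\<^bsub>P3\<^esub>" if "1 \<le> k" "k \<le> 4" for k
  proof -
    have "braid_test 3 (track removal_letter k w) []"
      using assms(2) that unfolding list_all_upt removal_trivial_def by simp
    then show ?thesis
      using strand_removal_class[of 4 k w] that w braid_class_eqI[of 3] by (simp add: one_pure)
  qed
  then show ?thesis using w by (simp add: Brun_def kernel_def)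
qed

definition elem_a :: "braid_word set" where "elem_a = A_elem 3 1 3"
definition elem_b :: "braid_word set" where "elem_b = A_elem 3 2 3"
definition elem_d :: "braid_word set" where
  "elem_d = braid_class 3 (A_word 1 2 @ A_word 1 3 @ A_word 2 3)"
definition word_c :: braid_word where
  "word_c = winv (A_word 1 3) @ A_word 2 3 @ A_word 1 3 @ winv (A_word 2 3)"
definition elem_c :: "braid_word set" where "elem_c = braid_class 3 word_c"

lemma A_words_3:
  "A_word 1 2 \<in> braid_words 3" "A_word 1 3 \<in> braid_words 3" "A_word 2 3 \<in> braid_words 3"
  by (rule A_word_words; simp)+

lemmas A_words_3' [simp] = A_words_3 A_words_3[unfolded One_nat_def]

lemma word_c_pure [simp]: "word_c \<in> braid_words 3" "word_perm word_c = id"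
proof -
  have "pure_test 3 word_c" by code_simp
  then show "word_c \<in> braid_words 3" "word_perm word_c = id" using pure_test_sound by auto
qed

lemma elem_classes:
  "elem_a = braid_class 3 (A_word 1 3)" "elem_b = braid_class 3 (A_word 2 3)"
  by (simp_all add: elem_a_def elem_b_def A_elem_less)

lemma elems_carrier [simp]:
  "elem_a \<in> carrier P3" "elem_b \<in> carrier P3" "elem_c \<in> carrier P3" "elem_d \<in> carrier P3"
  by (simp_all add: elem_classes elem_c_def elem_d_def word_perm_A_word word_perm_append)

lemma elem_c_eq: "elem_c = inv\<^bsub>P3\<^esub> elem_a \<otimes>\<^bsub>P3\<^esub> elem_b \<otimes>\<^bsub>P3\<^esub> elem_a \<otimes>\<^bsub>P3\<^esub> inv\<^bsub>P3\<^esub> elem_b"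
  by (simp add: elem_classes elem_c_def word_c_def inv_pure word_perm_A_word mult_pure)

lemma elem_d_central:
  "elem_d \<otimes>\<^bsub>P3\<^esub> elem_a = elem_a \<otimes>\<^bsub>P3\<^esub> elem_d" "elem_d \<otimes>\<^bsub>P3\<^esub> elem_b = elem_b \<otimes>\<^bsub>P3\<^esub> elem_d"
proof -
  have "braid_test 3 ((A_word 1 2 @ A_word 1 3 @ A_word 2 3) @ A_word 1 3)
        (A_word 1 3 @ (A_word 1 2 @ A_word 1 3 @ A_word 2 3))"
    "braid_test 3 ((A_word 1 2 @ A_word 1 3 @ A_word 2 3) @ A_word 2 3)
        (A_word 2 3 @ (A_word 1 2 @ A_word 1 3 @ A_word 2 3))"
    by code_simp+
  from this[THEN braid_class_eqI]
  show "elem_d \<otimes>\<^bsub>P3\<^esub> elem_a = elem_a \<otimes>\<^bsub>P3\<^esub> elem_d" "elem_d \<otimes>\<^bsub>P3\<^esub> elem_b = elem_b \<otimes>\<^bsub>P3\<^esub> elem_d"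
    by (simp_all add: elem_classes elem_d_def mult_pure)
qed

lemma P3_generated: "carrier P3 = generate P3 {elem_a, elem_b, elem_d}"
proof
  interpret P: group P3 by (rule group_pure_braid_group)
  have sub: "{elem_a, elem_b, elem_d} \<subseteq> carrier P3" by simp
  show "generate P3 {elem_a, elem_b, elem_d} \<subseteq> carrier P3" using P.generate_incl[OF sub] .
  let ?G = "generate P3 {elem_a, elem_b, elem_d}"
  \<comment> \<open>Because d = A_{1,2} a b.\<close>
  have "A_elem 3 1 2 = elem_d \<otimes>\<^bsub>P3\<^esub> (inv\<^bsub>P3\<^esub> elem_b \<otimes>\<^bsub>P3\<^esub> inv\<^bsub>P3\<^esub> elem_a)"
  proof -
    have "braid_test 3 (A_word 1 2)
        ((A_word 1 2 @ A_word 1 3 @ A_word 2 3) @ winv (A_word 2 3) @ winv (A_word 1 3))"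
      by code_simp
    from braid_class_eqI[OF this] show ?thesis
      by (simp add: A_elem_less elem_classes elem_d_def inv_pure word_perm_A_word mult_pure)
  qed
  moreover have "elem_d \<in> ?G" "inv\<^bsub>P3\<^esub> elem_b \<in> ?G" "inv\<^bsub>P3\<^esub> elem_a \<in> ?G" "elem_a \<in> ?G" "elem_b \<in> ?G"
    by (auto intro: generate.incl generate.inv)
  ultimately have *: "A_elem 3 1 2 \<in> ?G" "A_elem 3 1 3 \<in> ?G" "A_elem 3 2 3 \<in> ?G"
    unfolding elem_a_def[symmetric] elem_b_def[symmetric] by (simp_all only: generate.eng)
  have "A_gens 3 \<subseteq> ?G"
  proof
    fix y assume "y \<in> A_gens 3"
    then obtain i j where ij: "1 \<le> i" "i < j" "j \<le> 3" "y = A_elem 3 i j" by (auto simp: A_gens_def)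
    then show "y \<in> ?G" using * ordered_pairs_3[of i j] by auto
  qed
  then have "generate P3 (A_gens 3) \<subseteq> ?G"
    using P.generate_subgroup_incl P.generate_is_subgroup[OF sub] by blast
  then show "carrier P3 \<subseteq> ?G" using pure_generated[of 3] by simp
qed

lemma Bd3_eq: "Bd 3 = bdry 4 ` Brun 4"
  by (simp add: Bd_def)

lemma Brun4_normal: "Brun 4 \<lhd> P4"
proof -
  interpret P: group P4 by (rule group_pure_braid_group)
  have k: "kernel P4 P3 (strand_removal 4 k) \<lhd> P4" if "k \<in> {1..4}" for k
    using group_hom.normal_kernel[of P4 P3 "strand_removal 4 k"] strand_removal_hom[of 4 k] that
      group_pure_braid_group by (simp add: group_hom_def group_hom_axioms_def)
  have "{1..4} = {1, 2, 3, 4 :: nat}" by auto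
  then have "Brun 4 = kernel P4 P3 (strand_removal 4 1) \<inter> (kernel P4 P3 (strand_removal 4 2)
      \<inter> (kernel P4 P3 (strand_removal 4 3) \<inter> kernel P4 P3 (strand_removal 4 4)))"
    by (simp add: Brun_def)
  then show ?thesis using k by (auto intro!: P.normal_subgroup_intersect)
qed

lemma bdry4_hom: "bdry 4 \<in> hom P4 P3"
  using bdry_hom[of 4] by simp

lemma bdry4_class: "pure_test 4 w \<Longrightarrow> bdry 4 (braid_class 4 w) = braid_class 3 (face_word 0 w)"
  using bdry_class[of 4 w] pure_test_sound[of 4 w] by (simp add: face_word_def)

text \<open>Theta fixes A_{i+1,j+1} for i at least 1, and removing strand 1 lowers both indices, so
  every A_{i,j} is hit. Surjectivity is what carries normality from Brun_4 to its image
  Bd_3.\<close>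

lemma bdry4_surj: "bdry 4 ` carrier P4 = carrier P3"
proof
  interpret D: group_hom P4 P3 "bdry 4"
    using group_pure_braid_group bdry4_hom by (simp add: group_hom_def group_hom_axioms_def)
  show "bdry 4 ` carrier P4 \<subseteq> carrier P3" by auto
  have "braid_class 3 (A_word i j) = bdry 4 (A_elem 4 (Suc i) (Suc j))" if ij: "1 \<le> i" "i < j" "j \<le> 3" for i j
  proof -
    have "list_all (\<lambda>j. list_all (\<lambda>i. pure_test 4 (A_word (Suc i) (Suc j))
        \<and> braid_test 3 (face_word 0 (A_word (Suc i) (Suc j))) (A_word i j)) [1..<j]) [1..<Suc 3]"
      by code_simp
    then have "pure_test 4 (A_word (Suc i) (Suc j))
        \<and> braid_test 3 (face_word 0 (A_word (Suc i) (Suc j))) (A_word i j)"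
      using ij unfolding list_all_upt by simp
    then show ?thesis
      using bdry4_class[of "A_word (Suc i) (Suc j)"] ij
        braid_class_eqI[of 3 "face_word 0 (A_word (Suc i) (Suc j))" "A_word i j"]
      by (simp add: A_elem_less)
  qed
  then have "A_elem 3 i j \<in> bdry 4 ` carrier P4" if "1 \<le> i" "i < j" "j \<le> 3" for i j
    using that A_elem_in_pure_braid[of "Suc i" 4 "Suc j"] A_elem_less[of i j 3] by auto
  then have "A_gens 3 \<subseteq> bdry 4 ` carrier P4"
    by (auto simp: A_gens_def)
  then have "generate P3 (A_gens 3) \<subseteq> bdry 4 ` carrier P4"
    using D.H.generate_subgroup_incl D.img_is_subgroup by blast
  then show "carrier P3 \<subseteq> bdry 4 ` carrier P4" using pure_generated[of 3] by simp
qed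

lemma Bd3_normal: "Bd 3 \<lhd> P3"
proof -
  have "group_hom P4 P3 (bdry 4)"
    using group_pure_braid_group bdry4_hom by (simp add: group_hom_def group_hom_axioms_def)
  then show ?thesis
    unfolding Bd3_eq using bdry4_surj by (rule normal.surj_hom_normal_subgroup[OF Brun4_normal])
qed

text \<open>In the second element, the boundary of \<open>(A\<^sub>1\<^sub>,\<^sub>2 A\<^sub>1\<^sub>,\<^sub>4)\<^sup>-\<^sup>1\<close> is
  \<open>A\<^sub>1\<^sub>,\<^sub>3\<close> times the full twist.\<close>

lemma commutators_in_Bd3:
  "elem_c \<otimes>\<^bsub>P3\<^esub> elem_b \<otimes>\<^bsub>P3\<^esub> inv\<^bsub>P3\<^esub> elem_c \<otimes>\<^bsub>P3\<^esub> inv\<^bsub>P3\<^esub> elem_b \<in> Bd 3"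
  "elem_c \<otimes>\<^bsub>P3\<^esub> elem_a \<otimes>\<^bsub>P3\<^esub> inv\<^bsub>P3\<^esub> elem_c \<otimes>\<^bsub>P3\<^esub> inv\<^bsub>P3\<^esub> elem_a \<in> Bd 3"
proof -
  \<comment> \<open>\<open>?v\<close> dies when strand 2, 3 or 4 is removed, while A_{1,2} and
    \<open>?y\<close> die when strand 1 is removed, so both commutators are Brunnian. The boundary
    takes \<open>?v\<close> to c and A_{1,2} to A_{2,3} times the inverse of the full twist, which
    is central and drops out of the commutator.\<close>
  let ?v = "winv (A_word 2 4) @ A_word 3 4 @ A_word 2 4 @ winv (A_word 3 4)"
  let ?y = "winv (A_word 1 2 @ A_word 1 4)"
  let ?w1 = "?v @ A_word 1 2 @ winv ?v @ winv (A_word 1 2)"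
  let ?w2 = "?v @ ?y @ winv ?v @ winv ?y"
  have p: "pure_test 4 ?w1" "pure_test 4 ?w2" by code_simp+
  have r: "list_all (removal_trivial ?w1) [1..<5]"
    "list_all (removal_trivial ?w2) [1..<5]"
    by code_simp+
  have t: "braid_test 3 (face_word 0 ?w1) (word_c @ A_word 2 3 @ winv word_c @ winv (A_word 2 3))"
    "braid_test 3 (face_word 0 ?w2) (word_c @ A_word 1 3 @ winv word_c @ winv (A_word 1 3))"
    by code_simp+
  have "braid_class 3 (word_c @ A_word 2 3 @ winv word_c @ winv (A_word 2 3)) \<in> Bd 3"
    unfolding Bd3_eq t(1)[THEN braid_class_eqI, symmetric] bdry4_class[OF p(1), symmetric]
    by (rule imageI[OF Brun4_class[OF p(1) r(1)]])
  moreover have "braid_class 3 (word_c @ A_word 1 3 @ winv word_c @ winv (A_word 1 3)) \<in> Bd 3"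
    unfolding Bd3_eq t(2)[THEN braid_class_eqI, symmetric] bdry4_class[OF p(2), symmetric]
    by (rule imageI[OF Brun4_class[OF p(2) r(2)]])
  ultimately show
    "elem_c \<otimes>\<^bsub>P3\<^esub> elem_b \<otimes>\<^bsub>P3\<^esub> inv\<^bsub>P3\<^esub> elem_c \<otimes>\<^bsub>P3\<^esub> inv\<^bsub>P3\<^esub> elem_b \<in> Bd 3"
    "elem_c \<otimes>\<^bsub>P3\<^esub> elem_a \<otimes>\<^bsub>P3\<^esub> inv\<^bsub>P3\<^esub> elem_c \<otimes>\<^bsub>P3\<^esub> inv\<^bsub>P3\<^esub> elem_a \<in> Bd 3"
    by (simp_all add: elem_classes elem_c_def inv_pure word_perm_A_word mult_pure)
qed

lemma group_hom_integer: "f \<in> hom P3 integer_group \<Longrightarrow> group_hom P3 integer_group f"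
  using group_pure_braid_group by (simp add: group_hom_def group_hom_axioms_def)

lemma linking3_elems:
  assumes "1 \<le> k" "k \<le> 3"
  shows "linking3 k elem_a = (if k = 2 then 2 else 0)" "linking3 k elem_b = (if k = 1 then 2 else 0)"
    "linking3 k elem_d = 2"
proof -
  have k: "k = 1 \<or> k = 2 \<or> k = 3" using assms by linarith
  show "linking3 k elem_a = (if k = 2 then 2 else 0)" "linking3 k elem_b = (if k = 1 then 2 else 0)"
    using k by (auto simp: elem_a_def elem_b_def linking3_A)
  interpret F: group_hom P3 integer_group "linking3 k"
    using linking3_hom[OF assms] by (rule group_hom_integer)
  have d: "elem_d = A_elem 3 1 2 \<otimes>\<^bsub>P3\<^esub> (A_elem 3 1 3 \<otimes>\<^bsub>P3\<^esub> A_elem 3 2 3)"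
    by (simp add: elem_d_def A_elem_less mult_pure)
  have "linking3 k elem_d
      = linking3 k (A_elem 3 1 2) + (linking3 k (A_elem 3 1 3) + linking3 k (A_elem 3 2 3))"
    unfolding d by (simp add: A_elem_in_pure_braid)
  then show "linking3 k elem_d = 2"
    using k by (auto simp: linking3_A)
qed

lemma integer_hom_inv:
  assumes f: "f \<in> hom P3 integer_group" and x: "x \<in> carrier P3"
  shows "f (inv\<^bsub>P3\<^esub> x) = - f x"
proof -
  interpret F: group_hom P3 integer_group f using f by (rule group_hom_integer)
  have "f x + f (inv\<^bsub>P3\<^esub> x) = 0"
    using integer_hom_add[OF f x F.G.inv_closed[OF x]] x integer_hom_one[OF f] by simp
  then show ?thesis by simp
qed

lemma subgroup_Zn3: "subgroup (Zn 3) P3"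
proof -
  interpret P: group P3 by (rule group_pure_braid_group)
  show ?thesis
  proof (rule P.subgroupI)
    have "\<one>\<^bsub>P3\<^esub> \<in> Zn 3" using integer_hom_one[of _ 3] by (simp add: Zn3_iff)
    then show "Zn 3 \<noteq> {}" by blast
  qed (auto simp: Zn3_iff integer_hom_add integer_hom_inv)
qed

lemma elem_c_in_Zn3 [simp]: "elem_c \<in> Zn 3"
proof -
  interpret P: group P3 by (rule group_pure_braid_group)
  show ?thesis
    unfolding Zn3_iff
    by (subst (2) elem_c_eq) (simp add: integer_hom_add integer_hom_inv)
qed

lemma (in group) commutator_one:
  assumes "x \<otimes> y \<otimes> inv x \<otimes> inv y = \<one>" "x \<in> carrier G" "y \<in> carrier G"
  shows "x \<otimes> y = y \<otimes> x"
  using assms inv_solve_right'[of \<one> "x \<otimes> y \<otimes> inv x" y] inv_solve_right'[of y "x \<otimes> y" x] by simp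

text \<open>Modulo M the element c is central, so \<open>central_commutator_normal_form\<close>
  applies, and the linking numbers rule out a, b and d in a cycle. M is left general because the
  lemma is applied to Bd_3 and, in \<open>Bd3_invariant\<close>, to a subgroup of it.\<close>

lemma Zn3_cyclic_mod:
  assumes M: "M \<lhd> P3" "M \<subseteq> Zn 3"
    and ca: "elem_c \<otimes>\<^bsub>P3\<^esub> elem_a \<otimes>\<^bsub>P3\<^esub> inv\<^bsub>P3\<^esub> elem_c \<otimes>\<^bsub>P3\<^esub> inv\<^bsub>P3\<^esub> elem_a \<in> M"
    and cb: "elem_c \<otimes>\<^bsub>P3\<^esub> elem_b \<otimes>\<^bsub>P3\<^esub> inv\<^bsub>P3\<^esub> elem_c \<otimes>\<^bsub>P3\<^esub> inv\<^bsub>P3\<^esub> elem_b \<in> M"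
    and x: "x \<in> Zn 3"
  shows "\<exists>m \<in> M. \<exists>l :: int. x = m \<otimes>\<^bsub>P3\<^esub> elem_c [^]\<^bsub>P3\<^esub> l"
proof -
  interpret M: normal M P3 by (rule M(1))
  define h where "h = (\<lambda>x. M #>\<^bsub>P3\<^esub> x)"
  interpret H: group_hom P3 "P3 Mod M" h
    using M.r_coset_hom_Mod M.factorgroup_is_group M.is_group
    by (simp add: group_hom_def group_hom_axioms_def h_def)
  have one: "h m = \<one>\<^bsub>P3 Mod M\<^esub>" if "m \<in> M" for m
    using M.rcos_const[OF M.is_group that] by (simp add: h_def)
  have "h elem_c \<otimes>\<^bsub>P3 Mod M\<^esub> h elem_a = h elem_a \<otimes>\<^bsub>P3 Mod M\<^esub> h elem_c"
    by (rule H.H.commutator_one) (use one[OF ca] in \<open>simp_all del: mult_FactGroup one_FactGroup\<close>)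
  moreover have "h elem_c \<otimes>\<^bsub>P3 Mod M\<^esub> h elem_b = h elem_b \<otimes>\<^bsub>P3 Mod M\<^esub> h elem_c"
    by (rule H.H.commutator_one) (use one[OF cb] in \<open>simp_all del: mult_FactGroup one_FactGroup\<close>)
  moreover have "h elem_d \<otimes>\<^bsub>P3 Mod M\<^esub> h elem_a = h elem_a \<otimes>\<^bsub>P3 Mod M\<^esub> h elem_d"
    "h elem_d \<otimes>\<^bsub>P3 Mod M\<^esub> h elem_b = h elem_b \<otimes>\<^bsub>P3 Mod M\<^esub> h elem_d"
    using H.hom_mult elem_d_central by (metis elems_carrier)+
  moreover have "h elem_c = inv\<^bsub>P3 Mod M\<^esub> h elem_a \<otimes>\<^bsub>P3 Mod M\<^esub> h elem_b \<otimes>\<^bsub>P3 Mod M\<^esub> h elem_a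
      \<otimes>\<^bsub>P3 Mod M\<^esub> inv\<^bsub>P3 Mod M\<^esub> h elem_b"
    unfolding elem_c_eq by (simp del: mult_FactGroup one_FactGroup)
  moreover have xP: "x \<in> carrier P3" using x by (simp add: Zn3_iff)
  have "generate (P3 Mod M) (h ` {elem_a, elem_b, elem_d}) = h ` generate P3 {elem_a, elem_b, elem_d}"
    by (rule H.generate_img) simp
  then have "h x \<in> generate (P3 Mod M) {h elem_a, h elem_b, h elem_d}"
    unfolding P3_generated[symmetric] image_insert image_empty using xP by blast
  ultimately obtain i j k l :: int where "h x = h elem_a [^]\<^bsub>P3 Mod M\<^esub> i \<otimes>\<^bsub>P3 Mod M\<^esub>
      (h elem_b [^]\<^bsub>P3 Mod M\<^esub> j \<otimes>\<^bsub>P3 Mod M\<^esub> (h elem_d [^]\<^bsub>P3 Mod M\<^esub> k \<otimes>\<^bsub>P3 Mod M\<^esub> h elem_c [^]\<^bsub>P3 Mod M\<^esub> l))"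
    using H.H.central_commutator_normal_form[of "h elem_a" "h elem_b" "h elem_d" "h elem_c" "h x"]
    by auto
  then have hx: "h x = h (elem_a [^]\<^bsub>P3\<^esub> i \<otimes>\<^bsub>P3\<^esub> (elem_b [^]\<^bsub>P3\<^esub> j \<otimes>\<^bsub>P3\<^esub>
      (elem_d [^]\<^bsub>P3\<^esub> k \<otimes>\<^bsub>P3\<^esub> elem_c [^]\<^bsub>P3\<^esub> l)))"
    by (simp add: H.hom_int_pow del: mult_FactGroup one_FactGroup)
  have "x \<in> M #>\<^bsub>P3\<^esub> x" using M.rcos_self[OF xP M.is_subgroup] .
  then have "x \<in> M #>\<^bsub>P3\<^esub> (elem_a [^]\<^bsub>P3\<^esub> i \<otimes>\<^bsub>P3\<^esub> (elem_b [^]\<^bsub>P3\<^esub> j \<otimes>\<^bsub>P3\<^esub>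
      (elem_d [^]\<^bsub>P3\<^esub> k \<otimes>\<^bsub>P3\<^esub> elem_c [^]\<^bsub>P3\<^esub> l)))"
    using hx by (simp only: h_def)
  then obtain m where m: "m \<in> M" and xm: "x = m \<otimes>\<^bsub>P3\<^esub> (elem_a [^]\<^bsub>P3\<^esub> i \<otimes>\<^bsub>P3\<^esub> (elem_b [^]\<^bsub>P3\<^esub> j \<otimes>\<^bsub>P3\<^esub>
      (elem_d [^]\<^bsub>P3\<^esub> k \<otimes>\<^bsub>P3\<^esub> elem_c [^]\<^bsub>P3\<^esub> l)))"
    unfolding r_coset_def by (elim UN_E singletonE)
  \<comment> \<open>As x, m and c are cycles, each linking number leaves a linear equation: r = 3
    gives k = 0, then r = 2 gives i = 0 and r = 1 gives j = 0.\<close>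
  have eq: "i * linking3 r elem_a + j * linking3 r elem_b + k * linking3 r elem_d = 0"
    if r: "1 \<le> r" "r \<le> 3" for r
  proof -
    interpret F: group_hom P3 integer_group "linking3 r"
      using linking3_hom[OF r] by (rule group_hom_integer)
    have 0: "linking3 r y = 0" if "y \<in> Zn 3" for y
      using that linking3_hom[OF r] by (simp add: Zn3_iff)
    have "m \<in> carrier P3" using m M.subset by blast
    then have "linking3 r x = linking3 r m + (i * linking3 r elem_a + (j * linking3 r elem_b
        + (k * linking3 r elem_d + l * linking3 r elem_c)))"
      unfolding xm by (simp add: F.hom_int_pow)
    then show ?thesis using 0[OF x] 0[of m] m M(2) 0[OF elem_c_in_Zn3] by auto
  qed
  have "k = 0" using eq[of 3] by (simp add: linking3_elems)
  moreover have "i = 0" "j = 0"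
    using eq[of 2] eq[of 1] calculation by (simp_all add: linking3_elems)
  ultimately have "x = m \<otimes>\<^bsub>P3\<^esub> elem_c [^]\<^bsub>P3\<^esub> l" using xm by simp
  then show ?thesis using m by blast
qed

section \<open>The quotient of cycles by boundaries\<close>

lemma Zn3_heis:
  assumes "x \<in> Zn 3"
  shows "heis x = (0, 0, heis_z x)" "heis_p x = 0" "heis_q x = 0"
  using assms heis_p_hom heis_q_hom by (auto simp: Zn3_iff heis_p_def heis_q_def heis_z_def prod_eq_iff)

text \<open>On cycles p and q vanish, and with them the correction term.\<close>

lemma heis_z_mult:
  "x \<in> Zn 3 \<Longrightarrow> y \<in> Zn 3 \<Longrightarrow> heis_z (x \<otimes>\<^bsub>P3\<^esub> y) = heis_z x + heis_z y"
  using heis_mult(3)[of x y] Zn3_heis by (simp add: Zn3_iff)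

lemma heis_z_int_pow:
  assumes "x \<in> Zn 3"
  shows "heis_z (x [^]\<^bsub>P3\<^esub> (l :: int)) = l * heis_z x"
proof -
  have "(\<lambda>z. (0, 0, z)) \<in> hom integer_group heis_group" by (simp add: hom_def)
  from hom_int_pow[OF this, of "heis_z x" l]
  have "(0, 0, heis_z x) [^]\<^bsub>heis_group\<^esub> l = (0, 0, l * heis_z x)"
    using group_heis_group by simp
  moreover have "heis (x [^]\<^bsub>P3\<^esub> l) = heis x [^]\<^bsub>heis_group\<^esub> l"
    using assms by (intro hom_int_pow[OF heis_hom _ group_pure_braid_group group_heis_group])
      (simp add: Zn3_iff)
  ultimately have "heis (x [^]\<^bsub>P3\<^esub> l) = (0, 0, l * heis_z x)"
    using Zn3_heis(1)[OF assms] by simp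
  then show ?thesis by (simp add: heis_z_def[of "x [^]\<^bsub>P3\<^esub> l"])
qed

text \<open>c is the commutator of a^-1 and b, whose (p, q) parts are (1, 1) and (2, 0) with
  determinant -2, so the value is -4.\<close>

lemma heis_z_elem_c: "heis_z elem_c \<noteq> 0"
proof -
  have "snd (snd (snd (fold heis_letter word_c (1, 0, 0, 0)))) \<noteq> 0" by code_simp
  then show ?thesis by (simp add: heis_z_def elem_c_def heis_class)
qed

lemma Bd3_subset: "Bd 3 \<subseteq> Zn 3"
  by (auto simp: Bd3_eq bdry4_in_Zn3)

lemma Zn3_int_pow: "x \<in> Zn 3 \<Longrightarrow> x [^]\<^bsub>P3\<^esub> (l :: int) \<in> Zn 3"
  by (rule group.subgroup_int_pow_closed[OF group_pure_braid_group subgroup_Zn3])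

lemma Bd3_iff: "x \<in> Bd 3 \<longleftrightarrow> x \<in> Zn 3 \<and> heis_z x = 0"
proof
  assume "x \<in> Bd 3"
  then show "x \<in> Zn 3 \<and> heis_z x = 0" using heis_z_bdry4 bdry4_in_Zn3 by (auto simp: Bd3_eq)
next
  assume x: "x \<in> Zn 3 \<and> heis_z x = 0"
  then obtain m l where m: "m \<in> Bd 3" "x = m \<otimes>\<^bsub>P3\<^esub> elem_c [^]\<^bsub>P3\<^esub> (l :: int)"
    using Zn3_cyclic_mod[OF Bd3_normal Bd3_subset commutators_in_Bd3(2,1)] by blast
  have mZ: "m \<in> Zn 3" "heis_z m = 0" using m(1) heis_z_bdry4 bdry4_in_Zn3 by (auto simp: Bd3_eq)
  then have "heis_z x = l * heis_z elem_c"
    unfolding m(2) by (simp add: heis_z_mult Zn3_int_pow heis_z_int_pow)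
  then have "l = 0" using x heis_z_elem_c by simp
  then show "x \<in> Bd 3" using m mZ group.is_monoid[OF group_pure_braid_group, of 3]
    by (simp add: Zn3_iff monoid.r_one)
qed

section \<open>Invariance under endomorphisms\<close>

lemma Zn3_invariant:
  assumes "\<phi> \<in> hom P3 P3" "x \<in> Zn 3"
  shows "\<phi> x \<in> Zn 3"
  unfolding Zn3_iff
proof (intro conjI ballI)
  show "\<phi> x \<in> carrier P3" using hom_in_carrier[OF assms(1)] assms(2) by (simp add: Zn3_iff)
  fix f assume "f \<in> hom P3 integer_group"
  with assms(1) have "f \<circ> \<phi> \<in> hom P3 integer_group" by (rule Group.hom_compose)
  then show "f (\<phi> x) = 0" using assms(2) by (fastforce simp: Zn3_iff)
qed

text \<open>Since \<open>heis \<circ> \<phi>\<close> kills the commutators of \<open>elem_c\<close>, the cycles are still generated by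
  \<open>elem_c\<close> modulo the part of the boundaries killed by \<open>heis \<circ> \<phi>\<close>.\<close>

lemma Bd3_invariant:
  assumes \<phi>: "\<phi> \<in> hom P3 P3" and x: "x \<in> Bd 3"
  shows "\<phi> x \<in> Bd 3"
proof -
  interpret F: group_hom P3 heis_group "heis \<circ> \<phi>"
    using Group.hom_compose[OF \<phi> heis_hom] group_pure_braid_group group_heis_group
    by (simp add: group_hom_def group_hom_axioms_def)
  define M where "M = Bd 3 \<inter> kernel P3 heis_group (heis \<circ> \<phi>)"
  have M: "M \<lhd> P3" unfolding M_def by (rule F.G.normal_subgroup_intersect[OF Bd3_normal F.normal_kernel])
  have z: "heis (\<phi> elem_c) = (0, 0, heis_z (\<phi> elem_c))"
    by (rule Zn3_heis(1)[OF Zn3_invariant[OF \<phi>]]) simp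
  have k: "elem_c \<otimes>\<^bsub>P3\<^esub> y \<otimes>\<^bsub>P3\<^esub> inv\<^bsub>P3\<^esub> elem_c \<otimes>\<^bsub>P3\<^esub> inv\<^bsub>P3\<^esub> y \<in> kernel P3 heis_group (heis \<circ> \<phi>)"
    if y: "y \<in> carrier P3" for y
  proof -
    obtain p q r where "heis (\<phi> y) = (p, q, r)" by (metis prod_cases3)
    then have "(heis \<circ> \<phi>) (elem_c \<otimes>\<^bsub>P3\<^esub> y \<otimes>\<^bsub>P3\<^esub> inv\<^bsub>P3\<^esub> elem_c \<otimes>\<^bsub>P3\<^esub> inv\<^bsub>P3\<^esub> y) = (0, 0, 0)"
      using y z by (simp add: inv_heis_group del: comp_apply) (simp add: inv_heis_group)
    then show ?thesis using y by (simp add: kernel_def)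
  qed
  have "\<exists>m \<in> M. \<exists>l :: int. x = m \<otimes>\<^bsub>P3\<^esub> elem_c [^]\<^bsub>P3\<^esub> l"
  proof (rule Zn3_cyclic_mod[OF M])
    show "M \<subseteq> Zn 3" using Bd3_subset by (auto simp: M_def)
  qed (use k commutators_in_Bd3 x Bd3_subset in \<open>auto simp: M_def\<close>)
  then obtain m l where m: "m \<in> M" "x = m \<otimes>\<^bsub>P3\<^esub> elem_c [^]\<^bsub>P3\<^esub> (l :: int)" by blast
  have mZ: "m \<in> Zn 3" "heis_z m = 0" using m(1) by (simp_all add: M_def Bd3_iff)
  then have "heis_z x = l * heis_z elem_c"
    unfolding m(2) by (simp add: heis_z_mult Zn3_int_pow heis_z_int_pow)
  then have "l = 0" using x heis_z_elem_c by (simp add: Bd3_iff)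
  then have "x = m" using m mZ by (simp add: Zn3_iff)
  then have "heis (\<phi> x) = (0, 0, 0)" using m(1) by (simp add: M_def kernel_def)
  then show ?thesis using Zn3_invariant[OF \<phi>] x by (simp add: Bd3_iff heis_z_def)
qed

text \<open>The cycles are powers of c modulo boundaries, and boundaries go to boundaries; so the
  factor k, the degree of the induced map on the quotient, can be read off at c.\<close>

lemma heis_z_endomorphism:
  assumes \<phi>: "\<phi> \<in> hom P3 P3"
  shows "\<exists>k. \<forall>x \<in> Zn 3. heis_z (\<phi> x) = k * heis_z x"
proof -
  interpret F: group_hom P3 P3 \<phi>
    using \<phi> group_pure_braid_group by (simp add: group_hom_def group_hom_axioms_def)
  have cyc: "\<exists>m \<in> Bd 3. \<exists>l :: int. x = m \<otimes>\<^bsub>P3\<^esub> elem_c [^]\<^bsub>P3\<^esub> l" if "x \<in> Zn 3" for x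
    by (rule Zn3_cyclic_mod[OF Bd3_normal Bd3_subset commutators_in_Bd3(2,1) that])
  have cZ: "\<phi> elem_c \<in> Zn 3" by (rule Zn3_invariant[OF \<phi>]) simp
  obtain n k where n: "n \<in> Bd 3" "\<phi> elem_c = n \<otimes>\<^bsub>P3\<^esub> elem_c [^]\<^bsub>P3\<^esub> (k :: int)"
    using cyc[OF cZ] by blast
  then have k: "heis_z (\<phi> elem_c) = k * heis_z elem_c"
    by (simp add: Bd3_iff heis_z_mult Zn3_int_pow heis_z_int_pow)
  have "heis_z (\<phi> x) = k * heis_z x" if x: "x \<in> Zn 3" for x
  proof -
    obtain m l where m: "m \<in> Bd 3" "x = m \<otimes>\<^bsub>P3\<^esub> elem_c [^]\<^bsub>P3\<^esub> (l :: int)"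
      using cyc[OF x] by blast
    have mZ: "m \<in> Zn 3" "heis_z m = 0" "\<phi> m \<in> Zn 3" "heis_z (\<phi> m) = 0"
      using m(1) Bd3_invariant[OF \<phi> m(1)] by (simp_all add: Bd3_iff)
    then have "\<phi> x = \<phi> m \<otimes>\<^bsub>P3\<^esub> \<phi> elem_c [^]\<^bsub>P3\<^esub> l"
      unfolding m(2) by (simp add: F.hom_int_pow Zn3_iff)
    then have "heis_z (\<phi> x) = l * (k * heis_z elem_c)"
      using mZ cZ k by (simp add: heis_z_mult Zn3_int_pow heis_z_int_pow)
    moreover have "heis_z x = l * heis_z elem_c"
      unfolding m(2) using mZ by (simp add: heis_z_mult Zn3_int_pow heis_z_int_pow)
    ultimately show ?thesis by simp
  qed
  then show ?thesis by blast
qed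

section \<open>The quotient group and the induced automorphisms\<close>

abbreviation bd_coset :: "braid_word set \<Rightarrow> braid_word set set" where
  "bd_coset x \<equiv> Bd 3 #>\<^bsub>P3\<^esub> x"

lemma Zn3_carrier: "x \<in> Zn 3 \<Longrightarrow> x \<in> carrier P3"
  by (simp add: Zn3_iff)

lemma Zn3_mult: "x \<in> Zn 3 \<Longrightarrow> y \<in> Zn 3 \<Longrightarrow> x \<otimes>\<^bsub>P3\<^esub> y \<in> Zn 3"
  by (rule subgroup.m_closed[OF subgroup_Zn3])

lemma Zn3_inv: "x \<in> Zn 3 \<Longrightarrow> inv\<^bsub>P3\<^esub> x \<in> Zn 3"
  by (rule subgroup.m_inv_closed[OF subgroup_Zn3])

lemma heis_z_inv:
  assumes "x \<in> Zn 3"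
  shows "heis_z (inv\<^bsub>P3\<^esub> x) = - heis_z x"
proof -
  have "heis_z (x \<otimes>\<^bsub>P3\<^esub> inv\<^bsub>P3\<^esub> x) = 0"
    using group.r_inv[OF group_pure_braid_group Zn3_carrier[OF assms]] heis_z_one by simp
  then show ?thesis using heis_z_mult[OF assms Zn3_inv[OF assms]] by simp
qed

lemma bd_coset_eq_iff:
  assumes "x \<in> Zn 3" "y \<in> Zn 3"
  shows "bd_coset x = bd_coset y \<longleftrightarrow> heis_z x = heis_z y"
proof -
  interpret N: normal "Bd 3" P3 by (rule Bd3_normal)
  have c: "x \<in> carrier P3" "y \<in> carrier P3" using assms by (simp_all add: Zn3_carrier)
  have "bd_coset x = bd_coset y \<longleftrightarrow> x \<otimes>\<^bsub>P3\<^esub> inv\<^bsub>P3\<^esub> y \<in> Bd 3"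
  proof
    assume "bd_coset x = bd_coset y"
    then have "x \<in> bd_coset y" using N.rcos_self[OF c(1) N.is_subgroup] by simp
    then show "x \<otimes>\<^bsub>P3\<^esub> inv\<^bsub>P3\<^esub> y \<in> Bd 3"
      using N.rcos_module_imp[OF N.is_group c(2)] by simp
  next
    assume "x \<otimes>\<^bsub>P3\<^esub> inv\<^bsub>P3\<^esub> y \<in> Bd 3"
    then have "x \<in> bd_coset y" using N.rcos_module_rev[OF N.is_group c(2) c(1)] by simp
    then show "bd_coset x = bd_coset y"
      using N.repr_independence[OF _ c(2) N.is_subgroup] by simp
  qed
  also have "\<dots> \<longleftrightarrow> heis_z x = heis_z y"
    using assms by (simp add: Bd3_iff Zn3_mult Zn3_inv heis_z_mult heis_z_inv)
  finally show ?thesis .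
qed

lemma Bd3_normal_Zn3: "Bd 3 \<lhd> P3\<lparr>carrier := Zn 3\<rparr>"
  by (rule group.normal_restrict_supergroup[OF group_pure_braid_group subgroup_Zn3 Bd3_normal Bd3_subset])

lemma group_ZBd3: "group (ZBd 3)"
  unfolding ZBd_def by (rule normal.factorgroup_is_group[OF Bd3_normal_Zn3])

lemma carrier_ZBd3: "carrier (ZBd 3) = bd_coset ` Zn 3"
  unfolding ZBd_def carrier_FactGroup by (simp add: r_coset_def)

lemma mult_ZBd3:
  assumes "x \<in> Zn 3" "y \<in> Zn 3"
  shows "bd_coset x \<otimes>\<^bsub>ZBd 3\<^esub> bd_coset y = bd_coset (x \<otimes>\<^bsub>P3\<^esub> y)"
  using normal.rcos_sum[OF Bd3_normal Zn3_carrier[OF assms(1)] Zn3_carrier[OF assms(2)]]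
  by (simp add: ZBd_def set_mult_def)

lemma inv_ZBd3:
  assumes "x \<in> Zn 3"
  shows "inv\<^bsub>ZBd 3\<^esub> bd_coset x = bd_coset (inv\<^bsub>P3\<^esub> x)"
proof (rule group.inv_equality[OF group_ZBd3])
  have "bd_coset (inv\<^bsub>P3\<^esub> x) \<otimes>\<^bsub>ZBd 3\<^esub> bd_coset x = bd_coset \<one>\<^bsub>P3\<^esub>"
    using assms group.l_inv[OF group_pure_braid_group Zn3_carrier[OF assms]]
    by (simp add: mult_ZBd3 Zn3_inv)
  also have "\<dots> = \<one>\<^bsub>ZBd 3\<^esub>"
    using group.coset_mult_one[OF group_pure_braid_group, of "Bd 3" 3] Bd3_subset Zn3_carrier
    by (auto simp: ZBd_def)
  finally show "bd_coset (inv\<^bsub>P3\<^esub> x) \<otimes>\<^bsub>ZBd 3\<^esub> bd_coset x = \<one>\<^bsub>ZBd 3\<^esub>" .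
qed (use assms in \<open>simp_all add: carrier_ZBd3 Zn3_inv\<close>)

lemma ZBd3_id_auto: "(\<lambda>C\<in>carrier (ZBd 3). C) \<in> auto (ZBd 3)"
  by (rule group.id_in_auto[OF group_ZBd3])

lemma ZBd3_inv_auto: "(\<lambda>C\<in>carrier (ZBd 3). inv\<^bsub>ZBd 3\<^esub> C) \<in> auto (ZBd 3)"
proof -
  interpret Q: group "ZBd 3" by (rule group_ZBd3)
  \<comment> \<open>The central coordinate is additive on cycles and separates cosets, so the
    quotient embeds in the integers; commutativity makes inversion a homomorphism.\<close>
  have comm: "C \<otimes>\<^bsub>ZBd 3\<^esub> D = D \<otimes>\<^bsub>ZBd 3\<^esub> C" if "C \<in> carrier (ZBd 3)" "D \<in> carrier (ZBd 3)" for C D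
  proof -
    obtain x y where "x \<in> Zn 3" "C = bd_coset x" "y \<in> Zn 3" "D = bd_coset y"
      using \<open>C \<in> carrier (ZBd 3)\<close> \<open>D \<in> carrier (ZBd 3)\<close> unfolding carrier_ZBd3 by blast
    then show ?thesis by (simp add: mult_ZBd3 bd_coset_eq_iff Zn3_mult heis_z_mult)
  qed
  have "(\<lambda>C\<in>carrier (ZBd 3). inv\<^bsub>ZBd 3\<^esub> C) \<in> hom (ZBd 3) (ZBd 3)"
  proof (rule homI)
    fix C D assume CD: "C \<in> carrier (ZBd 3)" "D \<in> carrier (ZBd 3)"
    then show "(\<lambda>C\<in>carrier (ZBd 3). inv\<^bsub>ZBd 3\<^esub> C) (C \<otimes>\<^bsub>ZBd 3\<^esub> D)
      = (\<lambda>C\<in>carrier (ZBd 3). inv\<^bsub>ZBd 3\<^esub> C) C \<otimes>\<^bsub>ZBd 3\<^esub> (\<lambda>C\<in>carrier (ZBd 3). inv\<^bsub>ZBd 3\<^esub> C) D"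
      using comm[of "inv\<^bsub>ZBd 3\<^esub> C" "inv\<^bsub>ZBd 3\<^esub> D"] by (simp add: Q.inv_mult_group)
  qed simp
  moreover have "bij_betw (\<lambda>C\<in>carrier (ZBd 3). inv\<^bsub>ZBd 3\<^esub> C) (carrier (ZBd 3)) (carrier (ZBd 3))"
    by (rule bij_betw_byWitness[where f' = "\<lambda>C. inv\<^bsub>ZBd 3\<^esub> C"]) auto
  ultimately show ?thesis by (simp add: auto_def Bij_def)
qed

lemma auto_inverse:
  assumes "\<phi> \<in> auto P3"
  obtains \<psi> where "\<psi> \<in> hom P3 P3" "\<And>x. x \<in> carrier P3 \<Longrightarrow> \<psi> (\<phi> x) = x"
    "\<And>x. x \<in> carrier P3 \<Longrightarrow> \<phi> (\<psi> x) = x"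
proof -
  have h: "\<phi> \<in> hom P3 P3" "\<phi> \<in> Bij (carrier P3)" using assms by (simp_all add: auto_def)
  let ?\<psi> = "restrict (inv_into (carrier P3) \<phi>) (carrier P3)"
  have b: "bij_betw \<phi> (carrier P3) (carrier P3)" using h(2) by (simp add: Bij_def)
  show thesis
  proof (rule that)
    show "?\<psi> \<in> hom P3 P3" by (rule group.restrict_inv_into_hom[OF group_pure_braid_group h])
    show "?\<psi> (\<phi> x) = x" if "x \<in> carrier P3" for x
      using that hom_in_carrier[OF h(1) that] bij_betw_inv_into_left[OF b that] by simp
    show "\<phi> (?\<psi> x) = x" if "x \<in> carrier P3" for x
      using that bij_betw_inv_into_right[OF b that] by simp
  qed
qed

lemma auto_image_bd_coset:
  assumes \<phi>: "\<phi> \<in> auto P3" and x: "x \<in> Zn 3"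
  shows "\<phi> ` bd_coset x = bd_coset (\<phi> x)"
proof -
  have h: "\<phi> \<in> hom P3 P3" using \<phi> by (simp add: auto_def)
  have mult: "\<phi> (m \<otimes>\<^bsub>P3\<^esub> x) = \<phi> m \<otimes>\<^bsub>P3\<^esub> \<phi> x" if "m \<in> Bd 3" for m
    using that by (intro hom_mult[OF h]) (simp_all add: Bd3_iff Zn3_carrier x)
  obtain \<psi> where \<psi>: "\<psi> \<in> hom P3 P3" "\<And>x. x \<in> carrier P3 \<Longrightarrow> \<phi> (\<psi> x) = x"
    using auto_inverse[OF \<phi>] by metis
  \<comment> \<open>\<open>induced_aut\<close> sends a coset to its image as a set, so an inclusion
    is not enough; the inverse automorphism preserves Bd_3 as well.\<close>
  have Bd: "\<phi> ` Bd 3 = Bd 3"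
  proof
    show "\<phi> ` Bd 3 \<subseteq> Bd 3" using Bd3_invariant[OF h] by blast
    show "Bd 3 \<subseteq> \<phi> ` Bd 3"
    proof
      fix m assume m: "m \<in> Bd 3"
      then have "m = \<phi> (\<psi> m)" using \<psi>(2)[of m] by (simp add: Bd3_iff Zn3_carrier)
      then show "m \<in> \<phi> ` Bd 3" using Bd3_invariant[OF \<psi>(1) m] by (rule image_eqI)
    qed
  qed
  have "\<phi> ` bd_coset x = (\<lambda>m. \<phi> (m \<otimes>\<^bsub>P3\<^esub> x)) ` Bd 3"
    unfolding r_coset_def UNION_singleton_eq_range image_image ..
  also have "\<dots> = (\<lambda>m. \<phi> m \<otimes>\<^bsub>P3\<^esub> \<phi> x) ` Bd 3"
    using mult by (intro image_cong HOL.refl)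
  also have "\<dots> = (\<lambda>m. m \<otimes>\<^bsub>P3\<^esub> \<phi> x) ` (\<phi> ` Bd 3)"
    unfolding image_image ..
  also have "\<dots> = bd_coset (\<phi> x)"
    unfolding Bd r_coset_def UNION_singleton_eq_range ..
  finally show ?thesis .
qed

lemma induced_aut_bd_coset:
  "\<phi> \<in> auto P3 \<Longrightarrow> x \<in> Zn 3 \<Longrightarrow> induced_aut 3 \<phi> (bd_coset x) = bd_coset (\<phi> x)"
  by (simp add: induced_aut_def carrier_ZBd3 auto_image_bd_coset)

text \<open>The degrees of an automorphism and of its inverse are integers with product 1, as one
  sees at c, where the central coordinate is non-zero.\<close>

lemma auto_heis_z:
  assumes \<phi>: "\<phi> \<in> auto P3"
  shows "(\<forall>x \<in> Zn 3. heis_z (\<phi> x) = heis_z x) \<or> (\<forall>x \<in> Zn 3. heis_z (\<phi> x) = - heis_z x)"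
proof -
  have h: "\<phi> \<in> hom P3 P3" using \<phi> by (simp add: auto_def)
  obtain \<psi> where \<psi>: "\<psi> \<in> hom P3 P3" "\<And>x. x \<in> carrier P3 \<Longrightarrow> \<psi> (\<phi> x) = x"
    using auto_inverse[OF \<phi>] by metis
  obtain k l where k: "\<forall>x \<in> Zn 3. heis_z (\<phi> x) = k * heis_z x"
    and l: "\<forall>x \<in> Zn 3. heis_z (\<psi> x) = l * heis_z x"
    using heis_z_endomorphism[OF h] heis_z_endomorphism[OF \<psi>(1)] by blast
  have "heis_z elem_c = l * (k * heis_z elem_c)"
    using k l \<psi>(2)[of elem_c] Zn3_invariant[OF h, of elem_c] by (metis elem_c_in_Zn3 elems_carrier(3))
  then have "l * k = 1" using heis_z_elem_c by simp
  then have "k = 1 \<or> k = - 1" by (auto simp: zmult_eq_1_iff)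
  then show ?thesis using k by auto
qed

lemma induced_aut_id:
  assumes "\<phi> \<in> auto P3" "\<forall>x \<in> Zn 3. heis_z (\<phi> x) = heis_z x"
  shows "induced_aut 3 \<phi> = (\<lambda>C\<in>carrier (ZBd 3). C)"
proof (rule extensionalityI[of _ "carrier (ZBd 3)"])
  fix C assume "C \<in> carrier (ZBd 3)"
  then obtain x where x: "x \<in> Zn 3" "C = bd_coset x" by (auto simp: carrier_ZBd3)
  have "\<phi> x \<in> Zn 3" using Zn3_invariant x assms(1) by (simp add: auto_def)
  then show "induced_aut 3 \<phi> C = (\<lambda>C\<in>carrier (ZBd 3). C) C"
    using x assms by (simp add: induced_aut_bd_coset bd_coset_eq_iff carrier_ZBd3)
qed (simp_all add: induced_aut_def)

lemma induced_aut_inv: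
  assumes "\<phi> \<in> auto P3" "\<forall>x \<in> Zn 3. heis_z (\<phi> x) = - heis_z x"
  shows "induced_aut 3 \<phi> = (\<lambda>C\<in>carrier (ZBd 3). inv\<^bsub>ZBd 3\<^esub> C)"
proof (rule extensionalityI[of _ "carrier (ZBd 3)"])
  fix C assume "C \<in> carrier (ZBd 3)"
  then obtain x where x: "x \<in> Zn 3" "C = bd_coset x" by (auto simp: carrier_ZBd3)
  have "\<phi> x \<in> Zn 3" using Zn3_invariant x assms(1) by (simp add: auto_def)
  then show "induced_aut 3 \<phi> C = (\<lambda>C\<in>carrier (ZBd 3). inv\<^bsub>ZBd 3\<^esub> C) C"
    using x assms
    by (simp add: induced_aut_bd_coset bd_coset_eq_iff carrier_ZBd3 inv_ZBd3 Zn3_inv heis_z_inv)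
qed (simp_all add: induced_aut_def)

lemma carrier_AutoGroup: "carrier (AutoGroup G) = auto G"
  by (simp add: AutoGroup_def)

lemma mult_AutoGroup:
  "f \<in> auto G \<Longrightarrow> g \<in> auto G \<Longrightarrow> f \<otimes>\<^bsub>AutoGroup G\<^esub> g = compose (carrier G) f g"
  by (simp add: AutoGroup_def BijGroup_def auto_def)

lemma induced_aut_auto: "\<phi> \<in> auto P3 \<Longrightarrow> induced_aut 3 \<phi> \<in> auto (ZBd 3)"
  using auto_heis_z[of \<phi>] induced_aut_id[of \<phi>] induced_aut_inv[of \<phi>] ZBd3_id_auto ZBd3_inv_auto by auto

lemma induced_aut_hom: "induced_aut 3 \<in> hom (AutoGroup P3) (AutoGroup (ZBd 3))"
proof (rule homI)
  fix \<phi> \<psi> assume "\<phi> \<in> carrier (AutoGroup P3)" "\<psi> \<in> carrier (AutoGroup P3)"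
  then have a: "\<phi> \<in> auto P3" "\<psi> \<in> auto P3" by (simp_all add: carrier_AutoGroup)
  have c: "compose (carrier P3) \<phi> \<psi> \<in> auto P3"
    using monoid.m_closed[OF group.is_monoid[OF group.AutoGroup[OF group_pure_braid_group]], of \<phi> 3 \<psi>] a
    by (simp add: carrier_AutoGroup mult_AutoGroup)
  have "induced_aut 3 (compose (carrier P3) \<phi> \<psi>)
      = compose (carrier (ZBd 3)) (induced_aut 3 \<phi>) (induced_aut 3 \<psi>)"
  proof (rule extensionalityI[of _ "carrier (ZBd 3)"])
    fix C assume "C \<in> carrier (ZBd 3)"
    then obtain x where x: "x \<in> Zn 3" "C = bd_coset x" by (auto simp: carrier_ZBd3)
    have "\<psi> x \<in> Zn 3" using Zn3_invariant x a by (simp add: auto_def)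
    then show "induced_aut 3 (compose (carrier P3) \<phi> \<psi>) C
        = compose (carrier (ZBd 3)) (induced_aut 3 \<phi>) (induced_aut 3 \<psi>) C"
      using x a c by (simp add: compose_def induced_aut_bd_coset carrier_ZBd3 Zn3_carrier)
  qed (simp_all add: induced_aut_def)
  then show "induced_aut 3 (\<phi> \<otimes>\<^bsub>AutoGroup P3\<^esub> \<psi>)
      = induced_aut 3 \<phi> \<otimes>\<^bsub>AutoGroup (ZBd 3)\<^esub> induced_aut 3 \<psi>"
    using a by (simp add: mult_AutoGroup induced_aut_auto)
qed (simp add: carrier_AutoGroup induced_aut_auto)

text \<open>Conjugation by \<open>\<sigma>\<^sub>1\<close> swaps \<open>A\<^sub>1\<^sub>,\<^sub>3\<close> and \<open>A\<^sub>2\<^sub>,\<^sub>3\<close> modulo commutators and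
  therefore reverses the sign of their commutator.\<close>

definition sigma_conj :: "bool \<Rightarrow> braid_word set \<Rightarrow> braid_word set" where
  "sigma_conj b = (\<lambda>x\<in>carrier P3. braid_class 3 [(1, b)] \<otimes>\<^bsub>braid_group 3\<^esub> x
    \<otimes>\<^bsub>braid_group 3\<^esub> braid_class 3 [(1, \<not> b)])"

lemma sigma_conj_class:
  "w \<in> braid_words 3 \<Longrightarrow> word_perm w = id \<Longrightarrow>
    sigma_conj b (braid_class 3 w) = braid_class 3 ([(1, b)] @ w @ [(1, \<not> b)])"
  by (simp add: sigma_conj_def mult_braid_class)

lemma word_perm_sigma_conj:
  "word_perm w = id \<Longrightarrow> word_perm ([(i, b)] @ w @ [(i, \<not> b)]) = id"
  by (simp add: word_perm_append fun_eq_iff)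

lemma sigma_conj_inverse:
  assumes "x \<in> carrier P3"
  shows "sigma_conj b x \<in> carrier P3" "sigma_conj (\<not> b) (sigma_conj b x) = x"
proof -
  obtain w where w: "w \<in> braid_words 3" "word_perm w = id" "x = braid_class 3 w"
    using assms by (rule pure_braid_word_cases)
  let ?w = "[(1, b)] @ w @ [(1, \<not> b)]"
  have v: "?w \<in> braid_words 3" "word_perm ?w = id"
    using w word_perm_sigma_conj[OF w(2), of 1 b] by auto
  then show "sigma_conj b x \<in> carrier P3"
    unfolding w(3) sigma_conj_class[OF w(1,2)] by (rule pure_class_in)
  have c: "braid_eq 3 [(1, \<not> b), (1, b)] []"
    using braid_eq.cancel[of 1 3 "\<not> b"] by simp
  have "braid_eq 3 ([(1, \<not> b), (1, b)] @ w @ [(1, \<not> b), (1, b)]) ([] @ w @ [])"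
    using c w(1) by (intro braid_eq.append braid_eq.refl)
  then show "sigma_conj (\<not> b) (sigma_conj b x) = x"
    unfolding w(3) sigma_conj_class[OF w(1,2)] sigma_conj_class[OF v]
    using v w by (subst braid_class_eq_iff) auto
qed

lemma sigma_conj_auto: "sigma_conj True \<in> auto P3"
proof -
  have "sigma_conj True \<in> hom P3 P3"
  proof (rule homI)
    fix x y assume x: "x \<in> carrier P3" and y: "y \<in> carrier P3"
    show "sigma_conj True x \<in> carrier P3" using sigma_conj_inverse(1)[OF x] .
    obtain u v where u: "u \<in> braid_words 3" "word_perm u = id" "x = braid_class 3 u"
      and v: "v \<in> braid_words 3" "word_perm v = id" "y = braid_class 3 v"
      using pure_braid_word_cases[OF x] pure_braid_word_cases[OF y] by metis
    have "braid_eq 3 (([(1, True)] @ u) @ [] @ (v @ [(1, False)]))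
        (([(1, True)] @ u) @ [(1, False), (1, True)] @ (v @ [(1, False)]))"
      using braid_eq.sym[OF braid_eq.cancel[of 1 3 False]] u v by (intro braid_eq_context) auto
    then have "braid_class 3 ([(1, True)] @ (u @ v) @ [(1, False)])
        = braid_class 3 (([(1, True)] @ u @ [(1, False)]) @ ([(1, True)] @ v @ [(1, False)]))"
      using u v by (subst braid_class_eq_iff) auto
    then show "sigma_conj True (x \<otimes>\<^bsub>P3\<^esub> y) = sigma_conj True x \<otimes>\<^bsub>P3\<^esub> sigma_conj True y"
      using u v by (simp add: mult_pure sigma_conj_class word_perm_append)
  qed
  moreover have "bij_betw (sigma_conj True) (carrier P3) (carrier P3)"
    by (rule bij_betw_byWitness[where f' = "sigma_conj False"])
      (use sigma_conj_inverse[of _ True] sigma_conj_inverse[of _ False] in auto)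
  ultimately show ?thesis by (simp add: auto_def Bij_def sigma_conj_def)
qed

text \<open>By the dichotomy \<open>auto_heis_z\<close> it is enough to see that the central
  coordinate of c changes.\<close>

lemma sigma_conj_heis_z: "\<forall>x \<in> Zn 3. heis_z (sigma_conj True x) = - heis_z x"
proof -
  have "snd (snd (snd (fold heis_letter ([(1, True)] @ word_c @ [(1, False)]) (1, 0, 0, 0))))
      \<noteq> snd (snd (snd (fold heis_letter word_c (1, 0, 0, 0))))"
    by code_simp
  then have "heis_z (sigma_conj True elem_c) \<noteq> heis_z elem_c"
    using sigma_conj_class[OF word_c_pure, of True] heis_class[of word_c]
      heis_class[of "[(1, True)] @ word_c @ [(1, False)]"]
    by (simp add: elem_c_def heis_z_def)
  then show ?thesis using auto_heis_z[OF sigma_conj_auto] elem_c_in_Zn3 by blast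
qed

theorem proposition1p2:
  shows "induced_aut 3 \<in> hom (AutoGroup (pure_braid_group 3)) (AutoGroup (ZBd 3))
    \<and> (\<exists>\<phi> \<in> carrier (AutoGroup (pure_braid_group 3)).
          induced_aut 3 \<phi> \<noteq> \<one>\<^bsub>AutoGroup (ZBd 3)\<^esub>)
    \<and> induced_aut 3 ` carrier (AutoGroup (pure_braid_group 3))
        = {\<lambda>C\<in>carrier (ZBd 3). C, \<lambda>C\<in>carrier (ZBd 3). inv\<^bsub>ZBd 3\<^esub> C}"
proof (intro conjI)
  let ?id = "\<lambda>C\<in>carrier (ZBd 3). C" and ?inv = "\<lambda>C\<in>carrier (ZBd 3). inv\<^bsub>ZBd 3\<^esub> C"
  show "induced_aut 3 \<in> hom (AutoGroup P3) (AutoGroup (ZBd 3))" by (rule induced_aut_hom)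
  have s: "induced_aut 3 (sigma_conj True) = ?inv"
    by (rule induced_aut_inv[OF sigma_conj_auto sigma_conj_heis_z])
  \<comment> \<open>The coset of c is not its own inverse, since its central coordinate is non-zero;
    this separates inversion from the identity.\<close>
  have "bd_coset elem_c \<in> carrier (ZBd 3)" by (simp add: carrier_ZBd3)
  moreover have "inv\<^bsub>ZBd 3\<^esub> bd_coset elem_c \<noteq> bd_coset elem_c"
    using heis_z_elem_c by (simp add: inv_ZBd3 bd_coset_eq_iff Zn3_inv heis_z_inv)
  ultimately have "?inv \<noteq> ?id" by (metis restrict_apply')
  then show "\<exists>\<phi> \<in> carrier (AutoGroup P3). induced_aut 3 \<phi> \<noteq> \<one>\<^bsub>AutoGroup (ZBd 3)\<^esub>"
    using s sigma_conj_auto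
    by (intro bexI[of _ "sigma_conj True"]) (simp_all add: carrier_AutoGroup AutoGroup_def BijGroup_def)
  have i: "(\<lambda>x\<in>carrier P3. x) \<in> auto P3" by (rule group.id_in_auto[OF group_pure_braid_group])
  have "induced_aut 3 (\<lambda>x\<in>carrier P3. x) = ?id"
    by (rule induced_aut_id[OF i]) (simp add: Zn3_carrier)
  then have "{?id, ?inv} \<subseteq> induced_aut 3 ` auto P3"
    using s i sigma_conj_auto by (metis empty_subsetI imageI insert_subset)
  moreover have "induced_aut 3 ` auto P3 \<subseteq> {?id, ?inv}"
    using auto_heis_z induced_aut_id induced_aut_inv by blast
  ultimately show "induced_aut 3 ` carrier (AutoGroup P3) = {?id, ?inv}"
    unfolding carrier_AutoGroup by blast
qed

end
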